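(* Let $\mathcal{E}$ be a category with finite limits and let $c$ be a $\triangleleft$-comonoid in $\mathbf{Poly}_{\mathcal{E}}$. Then the category $c\text{-}\mathbf{Coalg}$ of $c$-coalgebras is equivalent to the category of internal copresheaves on $c$ (that is, on the internal category corresponding to $c$).
   Context: For $f\colon B\to A$ in $\mathcal{E}$, $\Delta_f\colon\mathcal{E}/A\to\mathcal{E}/B$ denotes pullback along $f$; $f$ is exponentiable if $\Delta_f$ has a right adjoint $\Pi_f$. A polynomial in $\mathcal{E}$ is an exponentiable morphism $p\colon P_*\to P$. A morphism of polynomials $\phi\colon p\to q$ is a pair $\phi_1\colon P\to Q$, $\phi^\sharp\colon P\times_Q Q_*\to P_*$ with $p\circ\phi^\sharp$ the projection to $P$, up to isomorphism of the choice of pullback; it is cartesian if $\phi^\sharp$ is an isomorphism. Composition is $(\psi\circ\phi)_1=\psi_1\circ\phi_1$, $(\psi\circ\phi)^\sharp=\phi^\sharp\circ(P\times_Q\psi^\sharp)$. This gives the category $\mathbf{Poly}_{\mathcal{E}}$. It is monoidal under $(y,\triangleleft)$, where $y=\mathrm{id}_1$ and $p\triangleleft q$ is the composite of projections $(\Pi_p(Q\times P_* )\times_P P_* )\times_Q Q_*\to\Pi_p(Q\times P_* )\times_P P_*\to\Pi_p(Q\times P_* )$, with $\Pi_p(Q\times P_* )\times_P P_*\to Q$ the counit of $\Delta_p\dashv\Pi_p$ followed by projection. In generalized elements, positions are pairs $(x\colon X\to P,\ f\colon X\times_PP_*\to Q)$ and a direction at $(x,f)$ is a pair $(y,z)$ with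 $y$ in $P_*$ over $x$, $z$ in $Q_*$ over $f(y)$. On morphisms, $\phi\triangleleft\psi$ sends $(x,f)$ to $(\phi_1x,\psi_1\circ f\circ\phi^\sharp(x,-))$ and a direction $(y',z')$ there to $(\phi^\sharp(x,y'),\psi^\sharp(f(\phi^\sharp(x,y')),z'))$. A $\triangleleft$-comonoid is a polynomial $c\colon C_*\to C$ with counit $\epsilon\colon c\to y$ and comultiplication $\delta\colon c\to c\triangleleft c$ satisfying the counit and coassociativity equations. It corresponds to a category $\mathbf{C}$ internal to $\mathcal{E}$ with objects $C$, morphisms $C_*$, source $c$, identities $i=\epsilon^\sharp\colon C\to C_*$, target $t\colon C_*\to C$ determined by $\delta_1=(\mathrm{id}_C,t)\colon C\to\Pi_c(C\times C_* )$, and composition $k=\delta^\sharp\colon C_*\times_{t,C,c}C_*\to C_*$. Polynomial functor: $\mathbf{P}(p)\colon\mathcal{E}\to\mathcal{E}$ is $\mathbf{P}(p)(A)=\Pi_p(A\times P_* )$ (as an object of $\mathcal{E}$), so maps $X\to\mathbf{P}(p)(A)$ are pairs $(x\colon X\to P,\ f\colon X\times_PP_*\to A)$. A morphism $\phi\colon p\to q$ induces $\mathbf{P}(\phi)\colon\mathbf{P}(p)\to\mathbf{P}(q)$, $(x,f)\mapsto(\phi_1x,\ f\circ\phi^\sharp(x,-))$. Canonically $\mathbf{P}(y)\cong\mathrm{id}_{\mathcal{E}}$ and $\mathbf{P}(p\triangleleft q)\cong\mathbf{P}(p)\circ\mathbf{P}(q)$. A $c$-coalgebra is an object $S$ of $\mathcal{E}$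 with $\kappa\colon S\to\mathbf{P}(c)(S)$ such that $\mathbf{P}(\epsilon)_S\circ\kappa$ is the canonical isomorphism $S\cong\mathbf{P}(y)(S)$ and $\mathbf{P}(\delta)_S\circ\kappa=\mathbf{P}(c)(\kappa)\circ\kappa$ under $\mathbf{P}(c\triangleleft c)(S)\cong\mathbf{P}(c)(\mathbf{P}(c)(S))$. A homomorphism $S\to S'$ is a morphism $\psi$ in $\mathcal{E}$ with $\kappa'\circ\psi=\mathbf{P}(c)(\psi)\circ\kappa$. An internal cofunctor $\phi\colon\mathbf{D}\to\mathbf{C}$ between internal categories (source, target, identity, composition $s,t,i,k$, primed for $\mathbf{C}$; $k$ is defined on $D_1\times_{t,D_0,s}D_1$) consists of $\phi_1\colon D_0\to C_0$ and $\phi^\sharp\colon D_0\times_{C_0}C_1\to D_1$ (pullback of $s'$ along $\phi_1$; up to choice of pullback) with $s\circ\phi^\sharp$ the projection to $D_0$, $\phi^\sharp(x,i'(\phi_1x))=i(x)$, $\phi_1t\phi^\sharp(x,y)=t'(y)$, and $\phi^\sharp(x,k'(y,z))=k(\phi^\sharp(x,y),\phi^\sharp(t\phi^\sharp(x,y),z))$. Identities and composition of cofunctors are as for morphisms of polynomials. An internal copresheaf (internal discrete opfibration) on $\mathbf{C}$ is an internal cofunctor $\phi\colon\mathbf{D}\to\mathbf{C}$ whose underlying morphism of polynomials is cartesian (i.e. $\phi^\sharp$ is an isomorphism). A morphism of internal copresheaves $\mathbf{D},\mathbf{D}'$ on $\mathbf{C}$ is an internal cofunctor $\mathbf{D}\to\mathbf{D}'$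 commuting over $\mathbf{C}$. *)

theory Defs
  imports Main
begin

section \<open>Categories, functors, adjunctions, equivalences\<close>

record ('o, 'm) category =
  Obj :: "'o set"
  Arr :: "'m set"
  Dom :: "'m \<Rightarrow> 'o"
  Cod :: "'m \<Rightarrow> 'o"
  Id :: "'o \<Rightarrow> 'm"
  Comp :: "'m \<Rightarrow> 'm \<Rightarrow> 'm"  (infixr "\<cdot>\<index>" 70)

definition Hom :: "('o, 'm) category \<Rightarrow> 'o \<Rightarrow> 'o \<Rightarrow> 'm set" where
  "Hom E A B = {f \<in> Arr E. Dom E f = A \<and> Cod E f = B}"

locale category =
  fixes E :: "('o, 'm) category"  (structure)
  assumes Dom_in_Obj: "f \<in> Arr E \<Longrightarrow> Dom E f \<in> Obj E"
    and Cod_in_Obj: "f \<in> Arr E \<Longrightarrow> Cod E f \<in> Obj E"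
    and Id_in_Hom: "A \<in> Obj E \<Longrightarrow> Id E A \<in> Hom E A A"
    and Comp_in_Hom: "\<lbrakk>f \<in> Hom E A B; g \<in> Hom E B C\<rbrakk> \<Longrightarrow> g \<cdot> f \<in> Hom E A C"
    and Comp_Id: "f \<in> Hom E A B \<Longrightarrow> f \<cdot> Id E A = f"
    and Id_Comp: "f \<in> Hom E A B \<Longrightarrow> Id E B \<cdot> f = f"
    and Comp_assoc:
      "\<lbrakk>f \<in> Hom E A B; g \<in> Hom E B C; h \<in> Hom E C D\<rbrakk> \<Longrightarrow> (h \<cdot> g) \<cdot> f = h \<cdot> (g \<cdot> f)"

definition is_iso :: "('o, 'm) category \<Rightarrow> 'm \<Rightarrow> bool" where
  "is_iso E f \<longleftrightarrow> f \<in> Arr E \<and>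
    (\<exists>g \<in> Hom E (Cod E f) (Dom E f).
      g \<cdot>\<^bsub>E\<^esub> f = Id E (Dom E f) \<and> f \<cdot>\<^bsub>E\<^esub> g = Id E (Cod E f))"

record ('o, 'm, 'p, 'n) cat_functor =
  FO :: "'o \<Rightarrow> 'p"
  FA :: "'m \<Rightarrow> 'n"

definition is_functor ::
    "('o, 'm) category \<Rightarrow> ('p, 'n) category \<Rightarrow> ('o, 'm, 'p, 'n) cat_functor \<Rightarrow> bool" where
  "is_functor C D F \<longleftrightarrow> category C \<and> category D \<and>
    (\<forall>A \<in> Obj C. FO F A \<in> Obj D) \<and>
    (\<forall>f \<in> Arr C. FA F f \<in> Hom D (FO F (Dom C f)) (FO F (Cod C f))) \<and>
    (\<forall>A \<in> Obj C. FA F (Id C A) = Id D (FO F A)) \<and>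
    (\<forall>f \<in> Arr C. \<forall>g \<in> Arr C. Cod C f = Dom C g \<longrightarrow>
       FA F (g \<cdot>\<^bsub>C\<^esub> f) = FA F g \<cdot>\<^bsub>D\<^esub> FA F f)"

definition id_functor :: "('o, 'm, 'o, 'm) cat_functor" where
  "id_functor = \<lparr>FO = (\<lambda>A. A), FA = (\<lambda>f. f)\<rparr>"

definition comp_functor ::
    "('p, 'n, 'q, 'k) cat_functor \<Rightarrow> ('o, 'm, 'p, 'n) cat_functor \<Rightarrow> ('o, 'm, 'q, 'k) cat_functor" where
  "comp_functor G F = \<lparr>FO = (\<lambda>A. FO G (FO F A)), FA = (\<lambda>f. FA G (FA F f))\<rparr>"

definition nat_trans ::
    "('o, 'm) category \<Rightarrow> ('p, 'n) category \<Rightarrow> ('o, 'm, 'p, 'n) cat_functor \<Rightarrow>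
     ('o, 'm, 'p, 'n) cat_functor \<Rightarrow> ('o \<Rightarrow> 'n) \<Rightarrow> bool" where
  "nat_trans C D F G \<tau> \<longleftrightarrow> is_functor C D F \<and> is_functor C D G \<and>
    (\<forall>A \<in> Obj C. \<tau> A \<in> Hom D (FO F A) (FO G A)) \<and>
    (\<forall>f \<in> Arr C. \<tau> (Cod C f) \<cdot>\<^bsub>D\<^esub> FA F f = FA G f \<cdot>\<^bsub>D\<^esub> \<tau> (Dom C f))"

definition nat_iso ::
    "('o, 'm) category \<Rightarrow> ('p, 'n) category \<Rightarrow> ('o, 'm, 'p, 'n) cat_functor \<Rightarrow>
     ('o, 'm, 'p, 'n) cat_functor \<Rightarrow> ('o \<Rightarrow> 'n) \<Rightarrow> bool" where
  "nat_iso C D F G \<tau> \<longleftrightarrow> nat_trans C D F G \<tau> \<and> (\<forall>A \<in> Obj C. is_iso D (\<tau> A))"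

definition equivalent_categories :: "('o, 'm) category \<Rightarrow> ('p, 'n) category \<Rightarrow> bool" where
  "equivalent_categories C D \<longleftrightarrow>
    (\<exists>F G \<eta> \<epsilon>. is_functor C D F \<and> is_functor D C G \<and>
      nat_iso C C id_functor (comp_functor G F) \<eta> \<and>
      nat_iso D D (comp_functor F G) id_functor \<epsilon>)"

definition adjunction ::
    "('o, 'm) category \<Rightarrow> ('p, 'n) category \<Rightarrow> ('o, 'm, 'p, 'n) cat_functor \<Rightarrow>
     ('p, 'n, 'o, 'm) cat_functor \<Rightarrow> ('o \<Rightarrow> 'm) \<Rightarrow> ('p \<Rightarrow> 'n) \<Rightarrow> bool" where
  "adjunction C D L R \<eta> \<epsilon> \<longleftrightarrow> is_functor C D L \<and> is_functor D C R \<and>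
    nat_trans C C id_functor (comp_functor R L) \<eta> \<and>
    nat_trans D D (comp_functor L R) id_functor \<epsilon> \<and>
    (\<forall>A \<in> Obj C. \<epsilon> (FO L A) \<cdot>\<^bsub>D\<^esub> FA L (\<eta> A) = Id D (FO L A)) \<and>
    (\<forall>B \<in> Obj D. FA R (\<epsilon> B) \<cdot>\<^bsub>C\<^esub> \<eta> (FO R B) = Id C (FO R B))"


section \<open>Finite limits\<close>

definition is_cone ::
    "('j, 'k) category \<Rightarrow> ('o, 'm) category \<Rightarrow> ('j, 'k, 'o, 'm) cat_functor \<Rightarrow> 'o \<Rightarrow>
     ('j \<Rightarrow> 'm) \<Rightarrow> bool" where
  "is_cone J E F L \<pi> \<longleftrightarrow> L \<in> Obj E \<and> (\<forall>j \<in> Obj J. \<pi> j \<in> Hom E L (FO F j)) \<and>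
    (\<forall>u \<in> Arr J. FA F u \<cdot>\<^bsub>E\<^esub> \<pi> (Dom J u) = \<pi> (Cod J u))"

definition is_limit ::
    "('j, 'k) category \<Rightarrow> ('o, 'm) category \<Rightarrow> ('j, 'k, 'o, 'm) cat_functor \<Rightarrow> 'o \<Rightarrow>
     ('j \<Rightarrow> 'm) \<Rightarrow> bool" where
  "is_limit J E F L \<pi> \<longleftrightarrow> is_cone J E F L \<pi> \<and>
    (\<forall>X \<xi>. is_cone J E F X \<xi> \<longrightarrow>
       (\<exists>!h. h \<in> Hom E X L \<and> (\<forall>j \<in> Obj J. \<pi> j \<cdot>\<^bsub>E\<^esub> h = \<xi> j)))"

text \<open>Every finite category is isomorphic to one whose objects and arrows are natural numbers,
  so index categories over \<^typ>\<open>nat\<close> suffice.\<close>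

definition has_finite_limits :: "('o, 'm) category \<Rightarrow> bool" where
  "has_finite_limits E \<longleftrightarrow>
    (\<forall>(J :: (nat, nat) category) F.
       is_functor J E F \<and> finite (Obj J) \<and> finite (Arr J) \<longrightarrow> (\<exists>L \<pi>. is_limit J E F L \<pi>))"

text \<open>A morphism of polynomials \<open>\<phi> : p \<rightarrow> q\<close>: \<open>pos \<phi>\<close> is \<open>\<phi>\<^sub>1\<close> and \<open>sharp \<phi>\<close> is \<open>\<phi>\<^sup>\<sharp>\<close>.
  A polynomial is an arrow \<open>p : P\<^sub>* \<rightarrow> P\<close> of the ambient category, so \<open>P\<^sub>*\<close> and \<open>P\<close> are its
  domain and codomain.\<close>

record 'm poly_map =
  pdom :: 'm
  pcod :: 'm
  pos :: 'm
  sharp :: 'm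

text \<open>Internal category data. The objects of objects and of arrows are the codomain and the domain
  of the source arrow.\<close>

record 'm internal_cat =
  isrc :: 'm
  itgt :: 'm
  iid :: 'm
  icomp :: 'm

context
  fixes E :: "('o, 'm) category"  (structure)
begin

text \<open>Terminal object, products and pullbacks are chosen once and for all by Hilbert choice.\<close>

definition is_terminal :: "'o \<Rightarrow> bool" where
  "is_terminal T \<longleftrightarrow> T \<in> Obj E \<and> (\<forall>A \<in> Obj E. \<exists>!f. f \<in> Hom E A T)"

definition one :: 'o where
  "one = (SOME T. is_terminal T)"

definition bang :: "'o \<Rightarrow> 'm" where
  "bang A = (THE f. f \<in> Hom E A one)"

definition is_product :: "'o \<Rightarrow> 'o \<Rightarrow> 'm \<Rightarrow> 'm \<Rightarrow> bool" where
  "is_product A B p q \<longleftrightarrow> p \<in> Hom E (Dom E p) A \<and> q \<in> Hom E (Dom E p) B \<and>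
    (\<forall>X \<in> Obj E. \<forall>u \<in> Hom E X A. \<forall>v \<in> Hom E X B.
      \<exists>!h. h \<in> Hom E X (Dom E p) \<and> p \<cdot> h = u \<and> q \<cdot> h = v)"

definition chosen_product :: "'o \<Rightarrow> 'o \<Rightarrow> 'm \<times> 'm" where
  "chosen_product A B = (SOME (p, q). is_product A B p q)"

definition prd1 :: "'o \<Rightarrow> 'o \<Rightarrow> 'm" where
  "prd1 A B = fst (chosen_product A B)"

definition prd2 :: "'o \<Rightarrow> 'o \<Rightarrow> 'm" where
  "prd2 A B = snd (chosen_product A B)"

definition prd_pair :: "'m \<Rightarrow> 'm \<Rightarrow> 'm" where
  "prd_pair u v =
    (let A = Cod E u; B = Cod E v in
      (THE h. h \<in> Hom E (Dom E u) (Dom E (prd1 A B)) \<and> prd1 A B \<cdot> h = u \<and> prd2 A B \<cdot> h = v))"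

definition is_pullback :: "'m \<Rightarrow> 'm \<Rightarrow> 'm \<Rightarrow> 'm \<Rightarrow> bool" where
  "is_pullback f g p q \<longleftrightarrow> f \<in> Arr E \<and> g \<in> Arr E \<and> Cod E f = Cod E g \<and>
    p \<in> Hom E (Dom E p) (Dom E f) \<and> q \<in> Hom E (Dom E p) (Dom E g) \<and> f \<cdot> p = g \<cdot> q \<and>
    (\<forall>X \<in> Obj E. \<forall>u \<in> Hom E X (Dom E f). \<forall>v \<in> Hom E X (Dom E g). f \<cdot> u = g \<cdot> v \<longrightarrow>
      (\<exists>!h. h \<in> Hom E X (Dom E p) \<and> p \<cdot> h = u \<and> q \<cdot> h = v))"

definition chosen_pullback :: "'m \<Rightarrow> 'm \<Rightarrow> 'm \<times> 'm" where
  "chosen_pullback f g = (SOME (p, q). is_pullback f g p q)"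

text \<open>For \<open>f : X \<rightarrow> Z\<close> and \<open>g : Y \<rightarrow> Z\<close>, \<open>pb f g\<close> is \<open>X \<times>\<^sub>Z Y\<close> and \<open>pb_pair f g u v\<close> is the
  generalized element \<open>(u, v)\<close> of it.\<close>

definition pr1 :: "'m \<Rightarrow> 'm \<Rightarrow> 'm" where
  "pr1 f g = fst (chosen_pullback f g)"

definition pr2 :: "'m \<Rightarrow> 'm \<Rightarrow> 'm" where
  "pr2 f g = snd (chosen_pullback f g)"

definition pb :: "'m \<Rightarrow> 'm \<Rightarrow> 'o" where
  "pb f g = Dom E (pr1 f g)"

definition pb_pair :: "'m \<Rightarrow> 'm \<Rightarrow> 'm \<Rightarrow> 'm \<Rightarrow> 'm" where
  "pb_pair f g u v =
    (THE h. h \<in> Hom E (Dom E u) (pb f g) \<and> pr1 f g \<cdot> h = u \<and> pr2 f g \<cdot> h = v)"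


section \<open>Exponentiable morphisms\<close>

text \<open>An arrow of the slice over \<open>A\<close> is a triple \<open>(f, h, g)\<close> of an arrow \<open>h\<close> together with its
  domain \<open>f\<close> and its codomain \<open>g\<close>.\<close>

definition slice :: "'o \<Rightarrow> ('m, 'm \<times> 'm \<times> 'm) category" where
  "slice A = \<lparr>
    Obj = {f \<in> Arr E. Cod E f = A},
    Arr = {(f, h, g). f \<in> Arr E \<and> Cod E f = A \<and> g \<in> Arr E \<and> Cod E g = A \<and>
                      h \<in> Hom E (Dom E f) (Dom E g) \<and> g \<cdot> h = f},
    Dom = (\<lambda>(f, h, g). f),
    Cod = (\<lambda>(f, h, g). g),
    Id = (\<lambda>f. (f, Id E (Dom E f), f)),
    Comp = (\<lambda>(g', k, l) (f, h, g). (f, k \<cdot> h, l))\<rparr>"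

definition slice_arrow :: "'m \<times> 'm \<times> 'm \<Rightarrow> 'm" where
  "slice_arrow = (\<lambda>(f, h, g). h)"

text \<open>\<open>\<Delta>\<^sub>f : E/A \<rightarrow> E/B\<close> for \<open>f : B \<rightarrow> A\<close>.\<close>

definition pullback_functor ::
    "'m \<Rightarrow> ('m, 'm \<times> 'm \<times> 'm, 'm, 'm \<times> 'm \<times> 'm) cat_functor" where
  "pullback_functor f = \<lparr>
    FO = (\<lambda>a. pr2 a f),
    FA = (\<lambda>(a, h, b). (pr2 a f, pb_pair b f (h \<cdot> pr1 a f) (pr2 a f), pr2 b f))\<rparr>"

definition exponentiable :: "'m \<Rightarrow> bool" where
  "exponentiable f \<longleftrightarrow> f \<in> Arr E \<and>
    (\<exists>R \<eta> \<epsilon>. adjunction (slice (Cod E f)) (slice (Dom E f)) (pullback_functor f) R \<eta> \<epsilon>)"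

definition chosen_adjunction ::
    "'m \<Rightarrow> ('m, 'm \<times> 'm \<times> 'm, 'm, 'm \<times> 'm \<times> 'm) cat_functor \<times>
      ('m \<Rightarrow> 'm \<times> 'm \<times> 'm) \<times> ('m \<Rightarrow> 'm \<times> 'm \<times> 'm)" where
  "chosen_adjunction f = (SOME (R, \<eta>, \<epsilon>).
    adjunction (slice (Cod E f)) (slice (Dom E f)) (pullback_functor f) R \<eta> \<epsilon>)"

definition Pi_functor :: "'m \<Rightarrow> ('m, 'm \<times> 'm \<times> 'm, 'm, 'm \<times> 'm \<times> 'm) cat_functor" where
  "Pi_functor f = fst (chosen_adjunction f)"

definition Pi_unit :: "'m \<Rightarrow> 'm \<Rightarrow> 'm \<times> 'm \<times> 'm" where
  "Pi_unit f = fst (snd (chosen_adjunction f))"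

definition Pi_counit :: "'m \<Rightarrow> 'm \<Rightarrow> 'm \<times> 'm \<times> 'm" where
  "Pi_counit f = snd (snd (chosen_adjunction f))"


section \<open>The category of polynomials\<close>

definition is_poly_map :: "'m poly_map \<Rightarrow> bool" where
  "is_poly_map \<phi> \<longleftrightarrow> pdom \<phi> \<in> Arr E \<and> pcod \<phi> \<in> Arr E \<and>
    pos \<phi> \<in> Hom E (Cod E (pdom \<phi>)) (Cod E (pcod \<phi>)) \<and>
    sharp \<phi> \<in> Hom E (pb (pos \<phi>) (pcod \<phi>)) (Dom E (pdom \<phi>)) \<and>
    pdom \<phi> \<cdot> sharp \<phi> = pr1 (pos \<phi>) (pcod \<phi>)"

text \<open>\<open>\<phi>\<^sup>\<sharp>(x, y)\<close> for generalized elements \<open>x\<close> of \<open>P\<close> and \<open>y\<close> of \<open>Q\<^sub>*\<close>.\<close>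

definition sharp_at :: "'m poly_map \<Rightarrow> 'm \<Rightarrow> 'm \<Rightarrow> 'm" where
  "sharp_at \<phi> x y = sharp \<phi> \<cdot> pb_pair (pos \<phi>) (pcod \<phi>) x y"

definition poly_id :: "'m \<Rightarrow> 'm poly_map" where
  "poly_id p = \<lparr>pdom = p, pcod = p, pos = Id E (Cod E p), sharp = pr2 (Id E (Cod E p)) p\<rparr>"

text \<open>\<open>(\<psi> \<circ> \<phi>)\<^sup>\<sharp>(x, z) = \<phi>\<^sup>\<sharp>(x, \<psi>\<^sup>\<sharp>(\<phi>\<^sub>1 x, z))\<close>, evaluated at the generic element \<open>(x, z)\<close>.\<close>

definition poly_comp :: "'m poly_map \<Rightarrow> 'm poly_map \<Rightarrow> 'm poly_map" where
  "poly_comp \<psi> \<phi> =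
    (let h = pos \<psi> \<cdot> pos \<phi>; x = pr1 h (pcod \<psi>); z = pr2 h (pcod \<psi>) in
      \<lparr>pdom = pdom \<phi>, pcod = pcod \<psi>, pos = h,
       sharp = sharp_at \<phi> x (sharp_at \<psi> (pos \<phi> \<cdot> x) z)\<rparr>)"

definition Poly :: "('m, 'm poly_map) category" where
  "Poly = \<lparr>
    Obj = {p. exponentiable p},
    Arr = {\<phi>. exponentiable (pdom \<phi>) \<and> exponentiable (pcod \<phi>) \<and> is_poly_map \<phi>},
    Dom = pdom, Cod = pcod, Id = poly_id, Comp = poly_comp\<rparr>"

definition cartesian :: "'m poly_map \<Rightarrow> bool" where
  "cartesian \<phi> \<longleftrightarrow> is_poly_map \<phi> \<and> is_iso E (sharp \<phi>)"


section \<open>Polynomial functors\<close>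

text \<open>\<open>PF_map p A\<close> is the object \<open>\<Pi>\<^sub>p(A \<times> P\<^sub>*)\<close> of the slice over \<open>P\<close>; \<open>PF p A\<close> is the underlying
  object \<open>\<^bold>P(p)(A)\<close>, and \<open>PF_ev p A : \<^bold>P(p)(A) \<times>\<^sub>P P\<^sub>* \<rightarrow> A\<close> is the counit followed by the
  projection.\<close>

definition PF_map :: "'m \<Rightarrow> 'o \<Rightarrow> 'm" where
  "PF_map p A = FO (Pi_functor p) (prd2 A (Dom E p))"

definition PF :: "'m \<Rightarrow> 'o \<Rightarrow> 'o" where
  "PF p A = Dom E (PF_map p A)"

definition PF_ev :: "'m \<Rightarrow> 'o \<Rightarrow> 'm" where
  "PF_ev p A = prd1 A (Dom E p) \<cdot> slice_arrow (Pi_counit p (prd2 A (Dom E p)))"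

text \<open>\<open>f(y)\<close>, where \<open>u = (x, f)\<close> is a generalized element of \<open>\<^bold>P(p)(A)\<close> and \<open>y\<close> lies over \<open>x\<close>.\<close>

definition PF_at :: "'m \<Rightarrow> 'o \<Rightarrow> 'm \<Rightarrow> 'm \<Rightarrow> 'm" where
  "PF_at p A u y = PF_ev p A \<cdot> pb_pair (PF_map p A) p u y"

text \<open>The generalized element \<open>X \<rightarrow> \<^bold>P(p)(A)\<close> corresponding to a pair \<open>x : X \<rightarrow> P\<close>,
  \<open>f : X \<times>\<^sub>P P\<^sub>* \<rightarrow> A\<close>: the transpose of \<open>(f, pr2) : \<Delta>\<^sub>p(x) \<rightarrow> A \<times> P\<^sub>*\<close> under
  \<open>\<Delta>\<^sub>p \<stileturn> \<Pi>\<^sub>p\<close>.\<close>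

definition PF_elem :: "'m \<Rightarrow> 'o \<Rightarrow> 'm \<Rightarrow> 'm \<Rightarrow> 'm" where
  "PF_elem p A x f =
    slice_arrow (FA (Pi_functor p) (pr2 x p, prd_pair f (pr2 x p), prd2 A (Dom E p)))
      \<cdot> slice_arrow (Pi_unit p x)"

definition PF_arr :: "'m \<Rightarrow> 'm \<Rightarrow> 'm" where
  "PF_arr p g =
    (let A = Dom E g; B = Cod E g; U = Dom E p in
      slice_arrow (FA (Pi_functor p) (prd2 A U, prd_pair (g \<cdot> prd1 A U) (prd2 A U), prd2 B U)))"

text \<open>\<open>\<^bold>P(\<phi>)\<^sub>A : (x, f) \<mapsto> (\<phi>\<^sub>1 x, f \<circ> \<phi>\<^sup>\<sharp>(x, -))\<close> at the generic element of \<open>\<^bold>P(p)(A)\<close>.\<close>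

definition PF_trans :: "'m poly_map \<Rightarrow> 'o \<Rightarrow> 'm" where
  "PF_trans \<phi> A =
    (let p = pdom \<phi>; q = pcod \<phi>; x = PF_map p A; x' = pos \<phi> \<cdot> x; a = pr1 x' q; y' = pr2 x' q in
      PF_elem q A x' (PF_at p A a (sharp_at \<phi> (x \<cdot> a) y')))"


section \<open>The composition product\<close>

definition y_poly :: 'm where
  "y_poly = Id E one"

definition tri :: "'m \<Rightarrow> 'm \<Rightarrow> 'm"  (infixr "\<triangleleft>" 65) where
  "p \<triangleleft> q = pr1 (PF_map p (Cod E q)) p \<cdot> pr1 (PF_ev p (Cod E q)) q"

text \<open>The direction \<open>(y, z)\<close> of \<open>p \<triangleleft> q\<close> at the position \<open>u\<close>, and the components \<open>y\<close> and \<open>z\<close> of a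
  direction.\<close>

definition tri_dir :: "'m \<Rightarrow> 'm \<Rightarrow> 'm \<Rightarrow> 'm \<Rightarrow> 'm \<Rightarrow> 'm" where
  "tri_dir p q u y z =
    pb_pair (PF_ev p (Cod E q)) q (pb_pair (PF_map p (Cod E q)) p u y) z"

definition tri_fst :: "'m \<Rightarrow> 'm \<Rightarrow> 'm" where
  "tri_fst p q = pr2 (PF_map p (Cod E q)) p \<cdot> pr1 (PF_ev p (Cod E q)) q"

definition tri_snd :: "'m \<Rightarrow> 'm \<Rightarrow> 'm" where
  "tri_snd p q = pr2 (PF_ev p (Cod E q)) q"

definition tri_map :: "'m poly_map \<Rightarrow> 'm poly_map \<Rightarrow> 'm poly_map" where
  "tri_map \<phi> \<psi> =
    (let p = pdom \<phi>; p' = pcod \<phi>; q = pdom \<psi>; q' = pcod \<psi>;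
         x = PF_map p (Cod E q); x' = pos \<phi> \<cdot> x; a = pr1 x' p'; b = pr2 x' p';
         h = PF_elem p' (Cod E q') x'
               (pos \<psi> \<cdot> PF_at p (Cod E q) a (sharp_at \<phi> (x \<cdot> a) b));
         u = pr1 h (p' \<triangleleft> q'); d = pr2 h (p' \<triangleleft> q');
         y' = tri_fst p' q' \<cdot> d; z' = tri_snd p' q' \<cdot> d;
         y = sharp_at \<phi> (x \<cdot> u) y';
         z = sharp_at \<psi> (PF_at p (Cod E q) u y) z'
     in \<lparr>pdom = p \<triangleleft> q, pcod = p' \<triangleleft> q', pos = h, sharp = tri_dir p q u y z\<rparr>)"

text \<open>The left unitor \<open>y \<triangleleft> p \<rightarrow> p\<close> sends a position \<open>(!, f)\<close> to \<open>f(!)\<close>, and a direction \<open>z\<close> back to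
  \<open>(!, z)\<close>.\<close>

definition unitor_l :: "'m \<Rightarrow> 'm poly_map" where
  "unitor_l p =
    (let T = PF y_poly (Cod E p); h = PF_at y_poly (Cod E p) (Id E T) (bang T);
         u = pr1 h p; z = pr2 h p
     in \<lparr>pdom = y_poly \<triangleleft> p, pcod = p, pos = h, sharp = tri_dir y_poly p u (bang (pb h p)) z\<rparr>)"

text \<open>The right unitor \<open>p \<triangleleft> y \<rightarrow> p\<close> sends a position \<open>(x, !)\<close> to \<open>x\<close>, and a direction \<open>y\<close> back to
  \<open>(y, !)\<close>.\<close>

definition unitor_r :: "'m \<Rightarrow> 'm poly_map" where
  "unitor_r p =
    (let h = PF_map p one; u = pr1 h p; y = pr2 h p
     in \<lparr>pdom = p \<triangleleft> y_poly, pcod = p, pos = h, sharp = tri_dir p y_poly u y (bang (pb h p))\<rparr>)"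

text \<open>The canonical map \<open>A \<rightarrow> \<^bold>P(y)(A)\<close>, and the canonical map
  \<open>\<^bold>P(p \<triangleleft> q)(A) \<rightarrow> \<^bold>P(p)(\<^bold>P(q)(A))\<close>, which sends \<open>((x, f), g)\<close> to
  \<open>(x, y \<mapsto> (f(y), z \<mapsto> g(y, z)))\<close>.\<close>

definition PF_y :: "'o \<Rightarrow> 'm" where
  "PF_y A = PF_elem y_poly A (bang A) (pr1 (bang A) y_poly)"

definition PF_tri :: "'m \<Rightarrow> 'm \<Rightarrow> 'o \<Rightarrow> 'm" where
  "PF_tri p q A =
    (let u = PF_map (p \<triangleleft> q) A; x = PF_map p (Cod E q) \<cdot> u;
         a = pr1 x p; y = pr2 x p;
         fy = PF_at p (Cod E q) (u \<cdot> a) y;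
         w = pr1 fy q; z = pr2 fy q;
         gyz = PF_at (p \<triangleleft> q) A (a \<cdot> w) (tri_dir p q (u \<cdot> a \<cdot> w) (y \<cdot> w) z)
     in PF_elem p (PF q A) x (PF_elem q A fy gyz))"

text \<open>The associator \<open>(p \<triangleleft> q) \<triangleleft> r \<rightarrow> p \<triangleleft> (q \<triangleleft> r)\<close>; on directions it sends \<open>(y, (z, w))\<close> back to
  \<open>((y, z), w)\<close>.\<close>

definition associator :: "'m \<Rightarrow> 'm \<Rightarrow> 'm \<Rightarrow> 'm poly_map" where
  "associator p q r =
    (let h = PF_tri p q (Cod E r);
         v = pr1 h (p \<triangleleft> (q \<triangleleft> r)); d = pr2 h (p \<triangleleft> (q \<triangleleft> r));
         y = tri_fst p (q \<triangleleft> r) \<cdot> d; e = tri_snd p (q \<triangleleft> r) \<cdot> d;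
         z = tri_fst q r \<cdot> e; w = tri_snd q r \<cdot> e;
         u = PF_map (p \<triangleleft> q) (Cod E r) \<cdot> v
     in \<lparr>pdom = (p \<triangleleft> q) \<triangleleft> r, pcod = p \<triangleleft> (q \<triangleleft> r), pos = h,
         sharp = tri_dir (p \<triangleleft> q) r v (tri_dir p q u y z) w\<rparr>)"


section \<open>Comonoids and coalgebras\<close>

definition is_comonoid :: "'m \<Rightarrow> 'm poly_map \<Rightarrow> 'm poly_map \<Rightarrow> bool" where
  "is_comonoid c \<epsilon> \<delta> \<longleftrightarrow>
    c \<in> Obj Poly \<and> \<epsilon> \<in> Hom Poly c y_poly \<and> \<delta> \<in> Hom Poly c (c \<triangleleft> c) \<and>
    unitor_l c \<cdot>\<^bsub>Poly\<^esub> tri_map \<epsilon> (Id Poly c) \<cdot>\<^bsub>Poly\<^esub> \<delta> = Id Poly c \<and>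
    unitor_r c \<cdot>\<^bsub>Poly\<^esub> tri_map (Id Poly c) \<epsilon> \<cdot>\<^bsub>Poly\<^esub> \<delta> = Id Poly c \<and>
    associator c c c \<cdot>\<^bsub>Poly\<^esub> tri_map \<delta> (Id Poly c) \<cdot>\<^bsub>Poly\<^esub> \<delta> =
      tri_map (Id Poly c) \<delta> \<cdot>\<^bsub>Poly\<^esub> \<delta>"

definition is_coalgebra ::
    "'m \<Rightarrow> 'm poly_map \<Rightarrow> 'm poly_map \<Rightarrow> 'o \<times> 'm \<Rightarrow> bool" where
  "is_coalgebra c \<epsilon> \<delta> = (\<lambda>(S, \<kappa>).
    S \<in> Obj E \<and> \<kappa> \<in> Hom E S (PF c S) \<and>
    PF_trans \<epsilon> S \<cdot> \<kappa> = PF_y S \<and>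
    PF_tri c c S \<cdot> PF_trans \<delta> S \<cdot> \<kappa> = PF_arr c \<kappa> \<cdot> \<kappa>)"

definition is_coalgebra_hom :: "'m \<Rightarrow> 'o \<times> 'm \<Rightarrow> 'm \<Rightarrow> 'o \<times> 'm \<Rightarrow> bool" where
  "is_coalgebra_hom c = (\<lambda>(S, \<kappa>) \<psi> (S', \<kappa>').
    \<psi> \<in> Hom E S S' \<and> \<kappa>' \<cdot> \<psi> = PF_arr c \<psi> \<cdot> \<kappa>)"

text \<open>Here and in the category of copresheaves, an arrow is a triple of its domain, the underlying
  map and its codomain.\<close>

definition Coalg ::
    "'m \<Rightarrow> 'm poly_map \<Rightarrow> 'm poly_map \<Rightarrow>
     ('o \<times> 'm, ('o \<times> 'm) \<times> 'm \<times> ('o \<times> 'm)) category" where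
  "Coalg c \<epsilon> \<delta> = \<lparr>
    Obj = {S. is_coalgebra c \<epsilon> \<delta> S},
    Arr = {(S, \<psi>, S'). is_coalgebra c \<epsilon> \<delta> S \<and> is_coalgebra c \<epsilon> \<delta> S' \<and> is_coalgebra_hom c S \<psi> S'},
    Dom = (\<lambda>(S, \<psi>, S'). S),
    Cod = (\<lambda>(S, \<psi>, S'). S'),
    Id = (\<lambda>S. (S, Id E (fst S), S)),
    Comp = (\<lambda>(T, \<chi>, T') (S, \<psi>, S'). (S, \<chi> \<cdot> \<psi>, T'))\<rparr>"


section \<open>Internal categories, cofunctors and copresheaves\<close>

text \<open>Composition is in diagrammatic order: \<open>icomp_at D f g\<close> is \<open>k(f, g)\<close> with \<open>t f = s g\<close>.\<close>

definition icomp_at :: "'m internal_cat \<Rightarrow> 'm \<Rightarrow> 'm \<Rightarrow> 'm" where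
  "icomp_at D f g = icomp D \<cdot> pb_pair (itgt D) (isrc D) f g"

definition is_internal_cat :: "'m internal_cat \<Rightarrow> bool" where
  "is_internal_cat D \<longleftrightarrow>
    (let s = isrc D; t = itgt D; i = iid D; k = icomp D; D0 = Cod E s; D1 = Dom E s;
         t2 = t \<cdot> pr2 t s;
         f = pr1 t s \<cdot> pr1 t2 s; g = pr2 t s \<cdot> pr1 t2 s; h = pr2 t2 s in
      s \<in> Arr E \<and> t \<in> Hom E D1 D0 \<and> i \<in> Hom E D0 D1 \<and> k \<in> Hom E (pb t s) D1 \<and>
      s \<cdot> i = Id E D0 \<and> t \<cdot> i = Id E D0 \<and>
      s \<cdot> k = s \<cdot> pr1 t s \<and> t \<cdot> k = t \<cdot> pr2 t s \<and>
      icomp_at D (i \<cdot> s) (Id E D1) = Id E D1 \<and>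
      icomp_at D (Id E D1) (i \<cdot> t) = Id E D1 \<and>
      icomp_at D (icomp_at D f g) h = icomp_at D f (icomp_at D g h))"

text \<open>The internal category of a comonoid. The first three fields are \<open>c\<close>, the \<open>t\<close> with
  \<open>\<delta>\<^sub>1 = (id, t)\<close>, i.e. \<open>t(y) = \<delta>\<^sub>1(c(y))(y)\<close>, and \<open>\<epsilon>\<^sup>\<sharp>\<close> along \<open>C \<cong> C \<times>\<^sub>1 1\<close>; the last one is
  \<open>\<delta>\<^sup>\<sharp>(c(y), (y, z))\<close> at the generic composable pair \<open>(y, z)\<close>.\<close>

definition comonoid_cat :: "'m \<Rightarrow> 'm poly_map \<Rightarrow> 'm poly_map \<Rightarrow> 'm internal_cat" where
  "comonoid_cat c \<epsilon> \<delta> =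
    (let C = Cod E c;
         t = PF_at c C (pos \<delta> \<cdot> c) (Id E (Dom E c));
         y = pr1 t c; z = pr2 t c
     in \<lparr>isrc = c, itgt = t,
         iid = sharp_at \<epsilon> (Id E C) (bang C),
         icomp = sharp_at \<delta> (c \<cdot> y) (tri_dir c c (pos \<delta> \<cdot> c \<cdot> y) y z)\<rparr>)"

text \<open>A cofunctor is given by its underlying map between the source arrows, which need not be
  exponentiable.\<close>

definition is_cofunctor :: "'m internal_cat \<Rightarrow> 'm internal_cat \<Rightarrow> 'm poly_map \<Rightarrow> bool" where
  "is_cofunctor D C \<phi> \<longleftrightarrow>
    is_internal_cat D \<and> is_internal_cat C \<and>
    is_poly_map \<phi> \<and> pdom \<phi> = isrc D \<and> pcod \<phi> = isrc C \<and>
    (let \<phi>1 = pos \<phi>; D0 = Cod E (isrc D);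
         tc = itgt C \<cdot> pr2 \<phi>1 (isrc C);
         x = pr1 \<phi>1 (isrc C) \<cdot> pr1 tc (isrc C);
         y = pr2 \<phi>1 (isrc C) \<cdot> pr1 tc (isrc C);
         z = pr2 tc (isrc C) in
      sharp_at \<phi> (Id E D0) (iid C \<cdot> \<phi>1) = iid D \<and>
      \<phi>1 \<cdot> itgt D \<cdot> sharp \<phi> = tc \<and>
      sharp_at \<phi> x (icomp_at C y z) =
        icomp_at D (sharp_at \<phi> x y) (sharp_at \<phi> (itgt D \<cdot> sharp_at \<phi> x y) z))"

definition is_copresheaf :: "'m internal_cat \<Rightarrow> 'm internal_cat \<times> 'm poly_map \<Rightarrow> bool" where
  "is_copresheaf C = (\<lambda>(D, \<phi>). is_cofunctor D C \<phi> \<and> cartesian \<phi>)"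

definition is_copresheaf_hom ::
    "'m internal_cat \<times> 'm poly_map \<Rightarrow> 'm poly_map \<Rightarrow> 'm internal_cat \<times> 'm poly_map \<Rightarrow> bool" where
  "is_copresheaf_hom = (\<lambda>(D, \<phi>) \<psi> (D', \<phi>'). is_cofunctor D D' \<psi> \<and> poly_comp \<phi>' \<psi> = \<phi>)"

definition Copresheaves ::
    "'m internal_cat \<Rightarrow>
     ('m internal_cat \<times> 'm poly_map,
      ('m internal_cat \<times> 'm poly_map) \<times> 'm poly_map \<times> ('m internal_cat \<times> 'm poly_map)) category" where
  "Copresheaves C = \<lparr>
    Obj = {X. is_copresheaf C X},
    Arr = {(X, \<psi>, Y). is_copresheaf C X \<and> is_copresheaf C Y \<and> is_copresheaf_hom X \<psi> Y},
    Dom = (\<lambda>(X, \<psi>, Y). X),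
    Cod = (\<lambda>(X, \<psi>, Y). Y),
    Id = (\<lambda>X. (X, poly_id (isrc (fst X)), X)),
    Comp = (\<lambda>(Y, \<chi>, Z) (X, \<psi>, Y'). (X, poly_comp \<chi> \<psi>, Z))\<rparr>"

end

end

theory Submission
  imports Defs
begin

text \<open>All identities are checked on generalized elements: an element of \<open>\<^bold>P(p)(A)\<close> is determined by its
  position \<open>x\<close> and the values \<open>f(y)\<close> of the second component, which turns every diagram into an
  equation between such values. A cofunctor \<open>\<phi>\<close> from \<open>\<^bold>D\<close> to the category of \<open>c\<close> gives the coalgebra
  \<open>\<kappa> = (\<phi>\<^sub>1, t \<circ> \<phi>\<^sup>\<sharp>)\<close> on \<open>D\<^sub>0\<close>, and a cofunctor between such \<open>\<^bold>D\<close> over \<open>c\<close> gives a homomorphism by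
  restriction to objects. On copresheaves this functor is full and faithful, because \<open>\<phi>\<^sup>\<sharp>\<close> is invertible,
  and it is surjective on objects, because a coalgebra has a category of elements.\<close>

section \<open>Surjective equivalences\<close>

text \<open>Unfolded, a coalgebra is an object \<open>S\<close> with a map \<open>x\<close> to the
  objects of the internal category and an action sending an element \<open>a\<close> and an arrow
  \<open>z\<close> out of \<open>x a\<close> to the value of \<open>\<kappa> a\<close> at
  \<open>z\<close>. The counit law makes identities act trivially; the comultiplication law makes
  targets match and composites act successively. Taking targets of lifted arrows in a discrete
  opfibration is exactly such an action. The obstacle is that pullbacks, products and right adjoints
  are available only as arbitrary choices with a universal property. Beta and eta rules for elements
  of \<open>PF p A\<close> are therefore extracted from the triangle identities, and every operation
  is shown to commute with change of stage, so that an equation at the generic element, as the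
  definitions state it, is interchangeable with the same equation at all elements. The eta rule also
  makes surjectivity on objects an equality rather than an isomorphism, which leaves a nontrivial
  natural isomorphism only on the side of copresheaves.\<close>

lemma is_functor_comp_functor:
  assumes F: "is_functor C D F" and G: "is_functor D C' G"
  shows "is_functor C C' (comp_functor G F)"
  unfolding is_functor_def
proof (intro conjI ballI impI)
  show "category C" "category C'" using F G by (auto simp: is_functor_def)
  show "FO (comp_functor G F) A \<in> Obj C'" if "A \<in> Obj C" for A
    using F G that by (simp add: is_functor_def comp_functor_def)
  show "FA (comp_functor G F) f \<in>
      Hom C' (FO (comp_functor G F) (Dom C f)) (FO (comp_functor G F) (Cod C f))"
    if "f \<in> Arr C" for f
    using F G that by (simp add: is_functor_def comp_functor_def Hom_def)
  show "FA (comp_functor G F) (Id C A) = Id C' (FO (comp_functor G F) A)" if "A \<in> Obj C" for A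
    using F G that by (simp add: is_functor_def comp_functor_def)
  show "FA (comp_functor G F) (g \<cdot>\<^bsub>C\<^esub> f) = FA (comp_functor G F) g \<cdot>\<^bsub>C'\<^esub> FA (comp_functor G F) f"
    if "f \<in> Arr C" "g \<in> Arr C" "Cod C f = Dom C g" for f g
    using F G that by (simp add: is_functor_def comp_functor_def Hom_def)
qed

text \<open>A chosen section \<open>S\<close> of the object map, together with the unique lifts of
  arrows, defines \<open>G\<close>. Since \<open>F\<close> after \<open>G\<close> is the identity on
  the objects and arrows of \<open>C\<close>, only the isomorphism on \<open>D\<close> has
  content.\<close>

lemma equivalent_categories_if_surjective:
  assumes F: "is_functor D C F"
    and faithful: "\<And>X Y f g. \<lbrakk>f \<in> Hom D X Y; g \<in> Hom D X Y; FA F f = FA F g\<rbrakk> \<Longrightarrow> f = g"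
    and full: "\<And>X Y u. \<lbrakk>X \<in> Obj D; Y \<in> Obj D; u \<in> Hom C (FO F X) (FO F Y)\<rbrakk> \<Longrightarrow>
      \<exists>f \<in> Hom D X Y. FA F f = u"
    and surj: "\<And>A. A \<in> Obj C \<Longrightarrow> \<exists>X \<in> Obj D. FO F X = A"
  shows "equivalent_categories C D"
proof -
  interpret C: category C using F by (simp add: is_functor_def)
  interpret D: category D using F by (simp add: is_functor_def)
  have F_Hom: "FA F f \<in> Hom C (FO F X) (FO F Y)" if "f \<in> Hom D X Y" for f X Y
    using F that by (auto simp: is_functor_def Hom_def)
  have F_Id: "FA F (Id D X) = Id C (FO F X)" if "X \<in> Obj D" for X
    using F that by (simp add: is_functor_def)
  have F_Comp: "FA F (g \<cdot>\<^bsub>D\<^esub> f) = FA F g \<cdot>\<^bsub>C\<^esub> FA F f"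
    if "f \<in> Hom D X Y" "g \<in> Hom D Y Z" for f g X Y Z
    using F that by (auto simp: is_functor_def Hom_def)
  have F_Obj: "FO F X \<in> Obj C" if "X \<in> Obj D" for X
    using F that by (simp add: is_functor_def)
  obtain S where S: "\<And>A. A \<in> Obj C \<Longrightarrow> S A \<in> Obj D \<and> FO F (S A) = A"
    using surj by metis
  obtain l where l: "\<And>X Y u. \<lbrakk>X \<in> Obj D; Y \<in> Obj D; u \<in> Hom C (FO F X) (FO F Y)\<rbrakk> \<Longrightarrow>
      l X Y u \<in> Hom D X Y \<and> FA F (l X Y u) = u"
    using full by metis
  define G where "G = \<lparr>FO = S, FA = (\<lambda>u. l (S (Dom C u)) (S (Cod C u)) u)\<rparr>"
  have G_simps: "FO G A = S A" "FA G u = l (S (Dom C u)) (S (Cod C u)) u" for A u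
    by (simp_all add: G_def)
  have HomC: "u \<in> Hom C A B \<longleftrightarrow> u \<in> Arr C \<and> Dom C u = A \<and> Cod C u = B" for u A B
    by (simp add: Hom_def)
  have G_Hom: "FA G u \<in> Hom D (S A) (S B) \<and> FA F (FA G u) = u" if "u \<in> Hom C A B" for u A B
    using l[of "S A" "S B" u] S[of A] S[of B] that C.Dom_in_Obj[of u] C.Cod_in_Obj[of u]
    by (auto simp: G_simps HomC)
  have G: "is_functor C D G"
    unfolding is_functor_def
  proof (intro conjI ballI impI)
    show "category C" "category D" by unfold_locales
    show "FO G A \<in> Obj D" if "A \<in> Obj C" for A using S that by (simp add: G_simps)
    show "FA G u \<in> Hom D (FO G (Dom C u)) (FO G (Cod C u))" if "u \<in> Arr C" for u
      using G_Hom[of u] that by (simp add: G_simps HomC)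
    show "FA G (Id C A) = Id D (FO G A)" if A: "A \<in> Obj C" for A
      using G_Hom[OF C.Id_in_Hom[OF A]] S[OF A] D.Id_in_Hom[of "S A"] F_Id[of "S A"]
      by (auto intro: faithful simp: G_simps(1))
    show "FA G (v \<cdot>\<^bsub>C\<^esub> u) = FA G v \<cdot>\<^bsub>D\<^esub> FA G u"
      if "u \<in> Arr C" "v \<in> Arr C" "Cod C u = Dom C v" for u v
    proof -
      have u: "u \<in> Hom C (Dom C u) (Dom C v)" and v: "v \<in> Hom C (Dom C v) (Cod C v)"
        using that by (simp_all add: HomC)
      have vu: "v \<cdot>\<^bsub>C\<^esub> u \<in> Hom C (Dom C u) (Cod C v)" using C.Comp_in_Hom[OF u v] .
      have "FA G v \<cdot>\<^bsub>D\<^esub> FA G u \<in> Hom D (S (Dom C u)) (S (Cod C v))"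
        using D.Comp_in_Hom G_Hom u v by blast
      moreover have "FA F (FA G v \<cdot>\<^bsub>D\<^esub> FA G u) = v \<cdot>\<^bsub>C\<^esub> u"
        using F_Comp[OF conjunct1[OF G_Hom[OF u]] conjunct1[OF G_Hom[OF v]]] G_Hom[OF u] G_Hom[OF v]
        by simp
      ultimately show ?thesis
        using G_Hom[OF vu] by (intro faithful) auto
    qed
  qed
  have id_C: "is_functor C C id_functor" and id_D: "is_functor D D id_functor"
    by (auto simp: is_functor_def id_functor_def Hom_def C.category_axioms D.category_axioms)
  note FG = is_functor_comp_functor[OF G F] and GF = is_functor_comp_functor[OF F G]
  \<comment> \<open>\<open>e X\<close> and \<open>e' X\<close> lift the same identity in opposite
    directions. Their composites lie over identities, and the two sides of the naturality square lie
    over the same arrow, so faithfulness gives inverses and naturality.\<close>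
  define e where "e X = l (S (FO F X)) X (Id C (FO F X))" for X
  define e' where "e' X = l X (S (FO F X)) (Id C (FO F X))" for X
  have e: "e X \<in> Hom D (S (FO F X)) X" "FA F (e X) = Id C (FO F X)"
    and e': "e' X \<in> Hom D X (S (FO F X))" "FA F (e' X) = Id C (FO F X)" if "X \<in> Obj D" for X
    using that S[OF F_Obj[OF that]] l C.Id_in_Hom[OF F_Obj[OF that]]
    unfolding e_def e'_def by auto
  have e_iso: "is_iso D (e X)" if X: "X \<in> Obj D" for X
  proof -
    let ?Y = "S (FO F X)"
    have Y: "?Y \<in> Obj D" "FO F ?Y = FO F X" using S F_Obj X by auto
    have "e' X \<cdot>\<^bsub>D\<^esub> e X = Id D ?Y"
      using D.Comp_in_Hom[OF e(1)[OF X] e'(1)[OF X]] F_Comp[OF e(1)[OF X] e'(1)[OF X]]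
        e(2)[OF X] e'(2)[OF X] F_Id[OF Y(1)] D.Id_in_Hom[OF Y(1)] Y(2)
        C.Id_Comp[OF C.Id_in_Hom[OF F_Obj[OF X]]]
      by (intro faithful) auto
    moreover have "e X \<cdot>\<^bsub>D\<^esub> e' X = Id D X"
      using D.Comp_in_Hom[OF e'(1)[OF X] e(1)[OF X]] F_Comp[OF e'(1)[OF X] e(1)[OF X]]
        e(2)[OF X] e'(2)[OF X] F_Id[OF X] D.Id_in_Hom[OF X]
        C.Id_Comp[OF C.Id_in_Hom[OF F_Obj[OF X]]]
      by (intro faithful) auto
    ultimately show ?thesis
      using e(1)[OF X] e'(1)[OF X] by (auto simp: is_iso_def Hom_def)
  qed
  have e_nat: "e (Cod D f) \<cdot>\<^bsub>D\<^esub> FA G (FA F f) = f \<cdot>\<^bsub>D\<^esub> e (Dom D f)" if f: "f \<in> Arr D" for f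
  proof -
    let ?X = "Dom D f" and ?Y = "Cod D f"
    have X: "?X \<in> Obj D" and Y: "?Y \<in> Obj D" and fH: "f \<in> Hom D ?X ?Y"
      using f D.Dom_in_Obj D.Cod_in_Obj by (auto simp: Hom_def)
    note g = G_Hom[OF F_Hom[OF fH]]
    have 1: "e ?Y \<cdot>\<^bsub>D\<^esub> FA G (FA F f) \<in> Hom D (S (FO F ?X)) ?Y"
      using D.Comp_in_Hom[OF _ e(1)[OF Y]] g by blast
    have 2: "f \<cdot>\<^bsub>D\<^esub> e ?X \<in> Hom D (S (FO F ?X)) ?Y"
      using D.Comp_in_Hom[OF e(1)[OF X] fH] .
    have "FA F (e ?Y \<cdot>\<^bsub>D\<^esub> FA G (FA F f)) = FA F (f \<cdot>\<^bsub>D\<^esub> e ?X)"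
      using F_Comp[OF conjunct1[OF g] e(1)[OF Y]] F_Comp[OF e(1)[OF X] fH] g
        e(2)[OF X] e(2)[OF Y] C.Comp_Id[OF F_Hom[OF fH]] C.Id_Comp[OF F_Hom[OF fH]]
      by simp
    then show ?thesis using 1 2 faithful by blast
  qed
  have C_iso: "is_iso C (Id C A)" if "A \<in> Obj C" for A
    using C.Id_in_Hom[OF that] C.Id_Comp[OF C.Id_in_Hom[OF that]]
    by (auto simp: is_iso_def Hom_def)
  have nat_C: "FO F (S A) = A" "Id C (Cod C u) \<cdot>\<^bsub>C\<^esub> u = u \<cdot>\<^bsub>C\<^esub> Id C (Dom C u)"
    if "A \<in> Obj C" "u \<in> Arr C" for A u
    using that S C.Id_Comp[of u] C.Comp_Id[of u] by (auto simp: Hom_def)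
  have G_sect: "FA F (FA G u) = u" if "u \<in> Arr C" for u
    using G_Hom[of u] that by (simp add: HomC)
  have "nat_iso C C id_functor (comp_functor F G) (Id C)"
    unfolding nat_iso_def nat_trans_def
    using id_C FG C_iso C.Id_in_Hom S G_sect C.Id_Comp C.Comp_Id
    by (auto simp: id_functor_def comp_functor_def G_simps(1) HomC)
  moreover have "nat_iso D D (comp_functor G F) id_functor e"
    unfolding nat_iso_def nat_trans_def
    using id_D GF e_iso e e_nat by (auto simp: id_functor_def comp_functor_def G_simps(1))
  ultimately show ?thesis
    unfolding equivalent_categories_def using F G by blast
qed

text \<open>Both \<open>Coalg\<close> and \<open>Copresheaves\<close> unfold to this record. Once
  arrows are tagged with their endpoints, the category axioms reduce to facts about the underlying
  maps.\<close>

lemma category_triples: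
  assumes hom_id: "\<And>X. ob X \<Longrightarrow> hom X (idt X) X"
    and hom_comp: "\<And>X Y Z f g. \<lbrakk>ob X; ob Y; ob Z; hom X f Y; hom Y g Z\<rbrakk> \<Longrightarrow> hom X (cmp g f) Z"
    and unit_r: "\<And>X Y f. \<lbrakk>ob X; ob Y; hom X f Y\<rbrakk> \<Longrightarrow> cmp f (idt X) = f"
    and unit_l: "\<And>X Y f. \<lbrakk>ob X; ob Y; hom X f Y\<rbrakk> \<Longrightarrow> cmp (idt Y) f = f"
    and assoc: "\<And>X Y Z W f g h. \<lbrakk>ob X; ob Y; ob Z; ob W; hom X f Y; hom Y g Z; hom Z h W\<rbrakk> \<Longrightarrow>
      cmp (cmp h g) f = cmp h (cmp g f)"
  shows "category \<lparr>Obj = {X. ob X}, Arr = {(X, f, Y). ob X \<and> ob Y \<and> hom X f Y},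
    Dom = (\<lambda>(X, f, Y). X), Cod = (\<lambda>(X, f, Y). Y), Id = (\<lambda>X. (X, idt X, X)),
    Comp = (\<lambda>(Y, g, Z) (X, f, Y'). (X, cmp g f, Z))\<rparr>"
  by unfold_locales (auto simp: Hom_def intro: hom_id hom_comp unit_r unit_l assoc)

section \<open>Finite limits\<close>

locale finitely_complete_category = category E for E :: "('o, 'm) category" (structure) +
  assumes finite_limits: "has_finite_limits E"
begin

abbreviation "arr f \<equiv> f \<in> Arr E"
abbreviation "src \<equiv> Dom E"
abbreviation "tgt \<equiv> Cod E"
abbreviation "obj A \<equiv> A \<in> Obj E"
abbreviation "poly_map \<equiv> is_poly_map E"
abbreviation "sh \<equiv> sharp_at E"

lemma Comp_simps [simp]:
  assumes "arr f" "arr g" "src g = tgt f"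
  shows "arr (g \<cdot> f)" "src (g \<cdot> f) = src f" "tgt (g \<cdot> f) = tgt g"
  using Comp_in_Hom[of f "src f" "tgt f" g "tgt g"] assms by (auto simp: Hom_def)

lemma assoc [simp]:
  assumes "arr f" "arr g" "arr h" "src g = tgt f" "src h = tgt g"
  shows "(h \<cdot> g) \<cdot> f = h \<cdot> g \<cdot> f"
  using Comp_assoc assms by (simp add: Hom_def)

lemma Id_simps [simp]:
  assumes "obj A"
  shows "arr (Id E A)" "src (Id E A) = A" "tgt (Id E A) = A"
  using Id_in_Hom[OF assms] by (auto simp: Hom_def)

lemma Comp_Id_simps [simp]:
  assumes "arr f"
  shows "src f = A \<Longrightarrow> f \<cdot> Id E A = f" "tgt f = B \<Longrightarrow> Id E B \<cdot> f = f"
  using Comp_Id[of f] Id_Comp[of f] assms by (auto simp: Hom_def)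

lemma Obj_simps [simp]: "arr f \<Longrightarrow> obj (src f)" "arr f \<Longrightarrow> obj (tgt f)"
  using Dom_in_Obj Cod_in_Obj by auto

text \<open>The simplifier keeps composites nested to the right, so an equation for
  \<open>f \<cdot> u\<close> no longer matches once a further map is precomposed; this rule restores
  it.\<close>

lemma Comp_cong1:
  assumes "f \<cdot> u = g" "arr f" "arr u" "arr w" "src f = tgt u" "src u = tgt w"
  shows "f \<cdot> u \<cdot> w = g \<cdot> w"
  using assms assoc[of w u f] by simp

text \<open>A limit of the empty diagram, whose cones are bare objects.\<close>

lemma ex_terminal: "\<exists>T. is_terminal E T"
proof -
  define J :: "(nat, nat) category" where
    "J = \<lparr>Obj = {}, Arr = {}, Dom = id, Cod = id, Id = id, Comp = (\<lambda>_ _. 0)\<rparr>"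
  define F :: "(nat, nat, 'o, 'm) cat_functor" where "F = \<lparr>FO = undefined, FA = undefined\<rparr>"
  have "category J" by unfold_locales (auto simp: J_def Hom_def)
  then have "is_functor J E F \<and> finite (Obj J) \<and> finite (Arr J)"
    using category_axioms by (auto simp: is_functor_def J_def)
  then obtain L \<pi> where L: "is_limit J E F L \<pi>"
    using finite_limits unfolding has_finite_limits_def by blast
  have "obj L" using L by (simp add: is_limit_def is_cone_def)
  moreover have "\<exists>!h. h \<in> Hom E X L" if "obj X" for X
  proof -
    have "is_cone J E F X undefined" using that by (simp add: is_cone_def J_def)
    then show ?thesis using L by (auto simp: is_limit_def J_def)
  qed
  ultimately show ?thesis unfolding is_terminal_def by blast
qed

lemma ex_pullback:
  assumes f: "arr f" and g: "arr g" and fg: "tgt f = tgt g"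
  shows "\<exists>p q. is_pullback E f g p q"
proof -
  \<comment> \<open>The index category is the cospan from 0 and 1 to 2: the arrows 0, 1, 2 are the
    identities, 3 and 4 the legs. If the outer of two composable arrows is not an identity, the
    inner one is, so the composite is the outer arrow.\<close>
  define J :: "(nat, nat) category" where
    "J = \<lparr>Obj = {0, 1, 2}, Arr = {0, 1, 2, 3, 4},
      Dom = (\<lambda>u. if u = 3 then 0 else if u = 4 then 1 else u),
      Cod = (\<lambda>u. if u = 3 \<or> u = 4 then 2 else u),
      Id = id, Comp = (\<lambda>u v. if u \<le> 2 then v else u)\<rparr>"
  define F :: "(nat, nat, 'o, 'm) cat_functor" where
    "F = \<lparr>FO = (\<lambda>j. if j = 0 then src f else if j = 1 then src g else tgt f),
      FA = (\<lambda>u. if u = 3 then f else if u = 4 then g else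
        Id E (if u = 0 then src f else if u = 1 then src g else tgt f))\<rparr>"
  have "category J" by unfold_locales (auto simp: J_def Hom_def split: if_splits)
  then have "is_functor J E F \<and> finite (Obj J) \<and> finite (Arr J)"
    using category_axioms assms by (auto simp: is_functor_def J_def F_def Hom_def split: if_splits)
  then obtain L \<pi> where L: "is_limit J E F L \<pi>"
    using finite_limits unfolding has_finite_limits_def by blast
  have cone: "is_cone J E F L \<pi>" using L by (simp add: is_limit_def)
  have \<pi>: "\<pi> 0 \<in> Hom E L (src f)" "\<pi> 1 \<in> Hom E L (src g)" "f \<cdot> \<pi> 0 = \<pi> 2" "g \<cdot> \<pi> 1 = \<pi> 2"
    using cone by (auto simp: is_cone_def J_def F_def)
  have univ: "\<exists>!h. h \<in> Hom E X L \<and> \<pi> 0 \<cdot> h = u \<and> \<pi> 1 \<cdot> h = v"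
    if X: "obj X" and u: "u \<in> Hom E X (src f)" and v: "v \<in> Hom E X (src g)"
      and uv: "f \<cdot> u = g \<cdot> v" for X u v
  proof -
    \<comment> \<open>The leg at the vertex 2 is determined by the other two, so a cone amounts to a
      pair making the square commute.\<close>
    define \<xi> where "\<xi> j = (if j = 0 then u else if j = 1 then v else f \<cdot> u)" for j :: nat
    have "is_cone J E F X \<xi>"
      using that assms by (auto simp: is_cone_def J_def F_def \<xi>_def Hom_def)
    then have "\<exists>!h. h \<in> Hom E X L \<and> (\<forall>j \<in> Obj J. \<pi> j \<cdot> h = \<xi> j)"
      using L by (simp add: is_limit_def)
    moreover have "(\<forall>j \<in> Obj J. \<pi> j \<cdot> h = \<xi> j) \<longleftrightarrow> \<pi> 0 \<cdot> h = u \<and> \<pi> 1 \<cdot> h = v"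
      if h: "h \<in> Hom E X L" for h
    proof -
      have "\<pi> 2 \<cdot> h = f \<cdot> \<pi> 0 \<cdot> h"
        using \<pi>(1) h f assoc[of h "\<pi> 0" f] by (simp add: \<pi>(3)[symmetric] Hom_def)
      then show ?thesis by (auto simp: J_def \<xi>_def)
    qed
    ultimately show ?thesis by (smt (verit, best))
  qed
  have "is_pullback E f g (\<pi> 0) (\<pi> 1)"
    unfolding is_pullback_def
  proof (intro conjI ballI impI)
    show "\<exists>!h. h \<in> Hom E X (src (\<pi> 0)) \<and> \<pi> 0 \<cdot> h = u \<and> \<pi> 1 \<cdot> h = v"
      if "obj X" "u \<in> Hom E X (src f)" "v \<in> Hom E X (src g)" "f \<cdot> u = g \<cdot> v" for X u v
      using univ[OF that] \<pi>(1) by (simp add: Hom_def)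
  qed (use \<pi> assms in \<open>auto simp: Hom_def\<close>)
  then show ?thesis by blast
qed

section \<open>The chosen terminal object, pullbacks and products\<close>

lemma one_terminal: "is_terminal E (one E)"
  unfolding one_def using someI_ex[OF ex_terminal] .

lemma one_Obj [simp]: "obj (one E)"
  using one_terminal by (simp add: is_terminal_def)

lemma bang_simps [simp]:
  assumes "obj A"
  shows "arr (bang E A)" "src (bang E A) = A" "tgt (bang E A) = one E"
proof -
  have "bang E A \<in> Hom E A (one E)"
    unfolding bang_def by (rule theI') (use one_terminal assms in \<open>simp add: is_terminal_def\<close>)
  then show "arr (bang E A)" "src (bang E A) = A" "tgt (bang E A) = one E"
    by (auto simp: Hom_def)
qed

lemma one_ext:
  assumes "arr f" "arr g" "src f = src g" "tgt f = one E" "tgt g = one E"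
  shows "f = g"
  using one_terminal assms unfolding is_terminal_def Hom_def
  by (smt (verit, ccfv_threshold) Obj_simps(1) mem_Collect_eq)

lemma bang_Comp [simp]:
  assumes "arr f" "tgt f = A"
  shows "bang E A \<cdot> f = bang E (src f)"
  by (rule one_ext) (use assms in auto)

lemma chosen_pullback:
  assumes "arr f" "arr g" "tgt f = tgt g"
  shows "is_pullback E f g (pr1 E f g) (pr2 E f g)"
  using someI_ex[of "\<lambda>(p, q). is_pullback E f g p q"] ex_pullback[OF assms]
  by (auto simp: pr1_def pr2_def chosen_pullback_def split: prod.splits)

lemma pr_simps [simp]:
  assumes "arr f" "arr g" "tgt f = tgt g"
  shows "arr (pr1 E f g)" "src (pr1 E f g) = pb E f g" "tgt (pr1 E f g) = src f"
    "arr (pr2 E f g)" "src (pr2 E f g) = pb E f g" "tgt (pr2 E f g) = src g"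
    "obj (pb E f g)"
proof -
  have "pr1 E f g \<in> Hom E (pb E f g) (src f)" "pr2 E f g \<in> Hom E (pb E f g) (src g)"
    using chosen_pullback[OF assms] by (auto simp: is_pullback_def pb_def)
  then show "arr (pr1 E f g)" "src (pr1 E f g) = pb E f g" "tgt (pr1 E f g) = src f"
    "arr (pr2 E f g)" "src (pr2 E f g) = pb E f g" "tgt (pr2 E f g) = src g"
    by (auto simp: Hom_def)
  then show "obj (pb E f g)" using Obj_simps(1) by metis
qed

lemma pb_square:
  assumes "arr f" "arr g" "tgt f = tgt g"
  shows "f \<cdot> pr1 E f g = g \<cdot> pr2 E f g"
  using chosen_pullback[OF assms] by (simp add: is_pullback_def)

lemma pb_square_Comp:
  assumes "arr f" "arr g" "tgt f = tgt g" "arr w" "tgt w = pb E f g"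
  shows "f \<cdot> pr1 E f g \<cdot> w = g \<cdot> pr2 E f g \<cdot> w"
  using pb_square[OF assms(1-3)] assms assoc[of w "pr1 E f g" f] assoc[of w "pr2 E f g" g] by simp

lemma pb_ext:
  assumes "arr f" "arr g" "tgt f = tgt g"
    and "arr h" "arr h'" "src h = src h'" "tgt h = pb E f g" "tgt h' = pb E f g"
    and "pr1 E f g \<cdot> h = pr1 E f g \<cdot> h'" "pr2 E f g \<cdot> h = pr2 E f g \<cdot> h'"
  shows "h = h'"
proof -
  have "\<exists>!k. k \<in> Hom E (src h) (pb E f g) \<and> pr1 E f g \<cdot> k = pr1 E f g \<cdot> h \<and>
      pr2 E f g \<cdot> k = pr2 E f g \<cdot> h"
    using chosen_pullback[OF assms(1-3)] assms pb_square_Comp[OF assms(1-4,7)]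
    unfolding is_pullback_def by (auto simp: Hom_def)
  then show ?thesis using assms(4-) by (auto simp: Hom_def)
qed

lemma pb_pair_simps [simp]:
  assumes "arr f" "arr g" "arr u" "arr v"
    and "src u = src v" "tgt u = src f" "tgt v = src g" "f \<cdot> u = g \<cdot> v"
  shows "arr (pb_pair E f g u v)" "src (pb_pair E f g u v) = src u"
    "tgt (pb_pair E f g u v) = pb E f g"
    "pr1 E f g \<cdot> pb_pair E f g u v = u" "pr2 E f g \<cdot> pb_pair E f g u v = v"
proof -
  \<comment> \<open>The common target is read off from the equation
    \<open>f \<cdot> u = g \<cdot> v\<close>.\<close>
  have "tgt f = tgt g" using assms Comp_simps(3) by metis
  then have "\<exists>!h. h \<in> Hom E (src u) (pb E f g) \<and> pr1 E f g \<cdot> h = u \<and> pr2 E f g \<cdot> h = v"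
    using chosen_pullback[of f g] assms unfolding is_pullback_def by (auto simp: Hom_def)
  from theI'[OF this]
  show "arr (pb_pair E f g u v)" "src (pb_pair E f g u v) = src u"
    "tgt (pb_pair E f g u v) = pb E f g"
    "pr1 E f g \<cdot> pb_pair E f g u v = u" "pr2 E f g \<cdot> pb_pair E f g u v = v"
    unfolding pb_pair_def by (auto simp: Hom_def)
qed

text \<open>Uniqueness of the factorization through a pullback. As a simplification rule this
  transports a computation at the generic element to any stage \<open>w\<close>.\<close>

lemma pb_pair_Comp [simp]:
  assumes "arr f" "arr g" "arr u" "arr v"
    and "src u = src v" "tgt u = src f" "tgt v = src g" "f \<cdot> u = g \<cdot> v"
    and "arr w" "tgt w = src u"
  shows "pb_pair E f g u v \<cdot> w = pb_pair E f g (u \<cdot> w) (v \<cdot> w)"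
proof -
  have c: "tgt f = tgt g" using assms Comp_simps(3) by metis
  have e: "f \<cdot> u \<cdot> w = g \<cdot> v \<cdot> w" using assms assoc[of w u f] assoc[of w v g] by simp
  show ?thesis
    by (rule pb_ext[of f g])
      (use assms c e assoc[of w "pb_pair E f g u v" "pr1 E f g"]
        assoc[of w "pb_pair E f g u v" "pr2 E f g"] in auto)
qed

lemma pb_pair_eta:
  assumes "arr f" "arr g" "tgt f = tgt g" "arr h" "tgt h = pb E f g"
  shows "pb_pair E f g (pr1 E f g \<cdot> h) (pr2 E f g \<cdot> h) = h"
  by (rule pb_ext[of f g]) (use assms pb_square_Comp[OF assms] in auto)

lemma pb_pair_pr [simp]:
  assumes "arr f" "arr g" "tgt f = tgt g"
  shows "pb_pair E f g (pr1 E f g) (pr2 E f g) = Id E (pb E f g)"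
  using pb_pair_eta[OF assms, of "Id E (pb E f g)"] assms by simp

text \<open>A product is a pullback over the terminal object, where every square commutes.\<close>

lemma chosen_product:
  assumes "obj A" "obj B"
  shows "is_product E A B (prd1 E A B) (prd2 E A B)"
proof -
  let ?p = "pr1 E (bang E A) (bang E B)" and ?q = "pr2 E (bang E A) (bang E B)"
  have univ: "\<exists>!h. h \<in> Hom E X (pb E (bang E A) (bang E B)) \<and> ?p \<cdot> h = u \<and> ?q \<cdot> h = v"
    if "obj X" "u \<in> Hom E X A" "v \<in> Hom E X B" for X u v
    using chosen_pullback[of "bang E A" "bang E B"] assms that
    by (auto simp: is_pullback_def Hom_def)
  then have "is_product E A B ?p ?q"
    unfolding is_product_def
  proof (intro conjI ballI)
    show "\<exists>!h. h \<in> Hom E X (src ?p) \<and> ?p \<cdot> h = u \<and> ?q \<cdot> h = v"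
      if "obj X" "u \<in> Hom E X A" "v \<in> Hom E X B" for X u v
      using univ[OF that] assms by simp
  qed (use assms in \<open>auto simp: Hom_def\<close>)
  then show ?thesis
    using someI[of "\<lambda>(p, q). is_product E A B p q" "(?p, ?q)"]
    by (auto simp: prd1_def prd2_def chosen_product_def split: prod.splits)
qed

lemma prd_simps [simp]:
  assumes "obj A" "obj B"
  shows "arr (prd1 E A B)" "tgt (prd1 E A B) = A"
    "arr (prd2 E A B)" "src (prd2 E A B) = src (prd1 E A B)" "tgt (prd2 E A B) = B"
  using chosen_product[OF assms] by (auto simp: is_product_def Hom_def)

lemma prd_ext:
  assumes "obj A" "obj B" "arr h" "arr h'" "src h = src h'"
    and "tgt h = src (prd1 E A B)" "tgt h' = src (prd1 E A B)"
    and "prd1 E A B \<cdot> h = prd1 E A B \<cdot> h'" "prd2 E A B \<cdot> h = prd2 E A B \<cdot> h'"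
  shows "h = h'"
proof -
  have "\<exists>!k. k \<in> Hom E (src h) (src (prd1 E A B)) \<and> prd1 E A B \<cdot> k = prd1 E A B \<cdot> h \<and>
      prd2 E A B \<cdot> k = prd2 E A B \<cdot> h"
    using chosen_product[OF assms(1,2)] assms unfolding is_product_def by (auto simp: Hom_def)
  then show ?thesis using assms(3-) by (auto simp: Hom_def)
qed

lemma prd_pair_simps [simp]:
  assumes "arr u" "arr v" "src u = src v"
  shows "arr (prd_pair E u v)" "src (prd_pair E u v) = src u"
    "tgt (prd_pair E u v) = src (prd1 E (tgt u) (tgt v))"
    "tgt u = A \<Longrightarrow> tgt v = B \<Longrightarrow> prd1 E A B \<cdot> prd_pair E u v = u"
    "tgt u = A \<Longrightarrow> tgt v = B \<Longrightarrow> prd2 E A B \<cdot> prd_pair E u v = v"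
proof -
  let ?A = "tgt u" and ?B = "tgt v"
  have "\<exists>!h. h \<in> Hom E (src u) (src (prd1 E ?A ?B)) \<and> prd1 E ?A ?B \<cdot> h = u \<and>
      prd2 E ?A ?B \<cdot> h = v"
    using chosen_product[of ?A ?B] assms unfolding is_product_def by (auto simp: Hom_def)
  from theI'[OF this]
  show "arr (prd_pair E u v)" "src (prd_pair E u v) = src u"
    "tgt (prd_pair E u v) = src (prd1 E (tgt u) (tgt v))"
    "tgt u = A \<Longrightarrow> tgt v = B \<Longrightarrow> prd1 E A B \<cdot> prd_pair E u v = u"
    "tgt u = A \<Longrightarrow> tgt v = B \<Longrightarrow> prd2 E A B \<cdot> prd_pair E u v = v"
    unfolding prd_pair_def Let_def by (auto simp: Hom_def)
qed

section \<open>Polynomial functors on generalized elements\<close>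

lemma is_functor_Comp:
  assumes "is_functor C D F" "f \<in> Hom C X Y" "g \<in> Hom C Y Z"
  shows "FA F (g \<cdot>\<^bsub>C\<^esub> f) = FA F g \<cdot>\<^bsub>D\<^esub> FA F f"
  using assms by (simp add: is_functor_def Hom_def)

lemma slice_simps:
  "Obj (slice E A) = {f \<in> Arr E. tgt f = A}"
  "(f, h, g) \<in> Arr (slice E A) \<longleftrightarrow> arr f \<and> tgt f = A \<and> arr g \<and> tgt g = A \<and>
     h \<in> Hom E (src f) (src g) \<and> g \<cdot> h = f"
  "Dom (slice E A) (f, h, g) = f" "Cod (slice E A) (f, h, g) = g"
  "(g', k, l) \<cdot>\<^bsub>slice E A\<^esub> (f, h, g) = (f, k \<cdot> h, l)"
  "Id (slice E A) f = (f, Id E (src f), f)"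
  "slice_arrow (f, h, g) = h"
  by (auto simp: slice_def slice_arrow_def)

text \<open>The outer entries of a slice arrow are its endpoints, so membership in a hom-set lets
  the whole triple be rebuilt from its middle entry.\<close>

lemma slice_Hom:
  "t \<in> Hom (slice E A) f g \<longleftrightarrow> t = (f, slice_arrow t, g) \<and> arr (slice_arrow t) \<and>
    arr f \<and> tgt f = A \<and> arr g \<and> tgt g = A \<and>
    src (slice_arrow t) = src f \<and> tgt (slice_arrow t) = src g \<and> g \<cdot> slice_arrow t = f"
  by (cases t) (auto simp: Hom_def slice_simps)

lemma pullback_functor_simps:
  "FO (pullback_functor E f) a = pr2 E a f"
  "FA (pullback_functor E f) (a, h, b) =
    (pr2 E a f, pb_pair E b f (h \<cdot> pr1 E a f) (pr2 E a f), pr2 E b f)"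
  by (auto simp: pullback_functor_def)

lemma exponentiable_Arr [simp]: "exponentiable E p \<Longrightarrow> arr p"
  by (simp add: exponentiable_def)

section \<open>The adjunction between pullback along an exponentiable map and its right
  adjoint\<close>

lemma Pi_adjunction:
  assumes "exponentiable E p"
  shows "adjunction (slice E (tgt p)) (slice E (src p)) (pullback_functor E p)
    (Pi_functor E p) (Pi_unit E p) (Pi_counit E p)"
proof -
  obtain R h e where "adjunction (slice E (tgt p)) (slice E (src p)) (pullback_functor E p) R h e"
    using assms by (auto simp: exponentiable_def)
  then show ?thesis
    using someI[of "\<lambda>(R, h, e). adjunction (slice E (tgt p)) (slice E (src p))
      (pullback_functor E p) R h e" "(R, h, e)"]
    by (auto simp: Pi_functor_def Pi_unit_def Pi_counit_def chosen_adjunction_def split: prod.splits)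
qed

context
  fixes p
  assumes p [simp]: "exponentiable E p"
begin

abbreviation (input) "\<T> \<equiv> slice E (tgt p)"
abbreviation (input) "\<S> \<equiv> slice E (src p)"
abbreviation (input) "R \<equiv> Pi_functor E p"

lemma Pi_FO: "arr a \<Longrightarrow> tgt a = src p \<Longrightarrow>
    arr (FO R a) \<and> tgt (FO R a) = tgt p"
  using Pi_adjunction[OF p] by (auto simp: adjunction_def is_functor_def slice_simps)

lemma Pi_FA: "t \<in> Hom \<S> a b \<Longrightarrow>
    FA R t \<in> Hom \<T> (FO R a) (FO R b)"
  using Pi_adjunction[OF p] by (auto simp: adjunction_def is_functor_def Hom_def)

lemma Pi_FA_Comp: "t \<in> Hom \<S> a b \<Longrightarrow> t' \<in> Hom \<S> b b' \<Longrightarrow>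
    FA R (t' \<cdot>\<^bsub>\<S>\<^esub> t) =
    FA R t' \<cdot>\<^bsub>\<T>\<^esub> FA R t"
  using Pi_adjunction[OF p] is_functor_Comp by (auto simp: adjunction_def)

lemma Pi_unit_Hom: "arr x \<Longrightarrow> tgt x = tgt p \<Longrightarrow>
    Pi_unit E p x \<in> Hom \<T> x (FO R (pr2 E x p))"
  using Pi_adjunction[OF p]
  by (auto simp: adjunction_def nat_trans_def id_functor_def comp_functor_def
      pullback_functor_simps slice_simps(1))

lemma Pi_counit_Hom: "arr a \<Longrightarrow> tgt a = src p \<Longrightarrow>
    Pi_counit E p a \<in> Hom \<S> (pr2 E (FO R a) p) a"
  using Pi_adjunction[OF p]
  by (auto simp: adjunction_def nat_trans_def id_functor_def comp_functor_def
      pullback_functor_simps slice_simps(1))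

lemma Pi_unit_nat: "t \<in> Hom \<T> x x' \<Longrightarrow>
    Pi_unit E p x' \<cdot>\<^bsub>\<T>\<^esub> t =
    FA R (FA (pullback_functor E p) t) \<cdot>\<^bsub>\<T>\<^esub> Pi_unit E p x"
  using Pi_adjunction[OF p]
  by (auto simp: adjunction_def nat_trans_def id_functor_def comp_functor_def Hom_def)

lemma Pi_counit_nat: "t \<in> Hom \<S> a b \<Longrightarrow>
    Pi_counit E p b \<cdot>\<^bsub>\<S>\<^esub> FA (pullback_functor E p) (FA R t) =
    t \<cdot>\<^bsub>\<S>\<^esub> Pi_counit E p a"
  using Pi_adjunction[OF p]
  by (auto simp: adjunction_def nat_trans_def id_functor_def comp_functor_def Hom_def)

lemma Pi_triangle1: "arr x \<Longrightarrow> tgt x = tgt p \<Longrightarrow>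
    Pi_counit E p (pr2 E x p) \<cdot>\<^bsub>\<S>\<^esub> FA (pullback_functor E p) (Pi_unit E p x) =
    Id \<S> (pr2 E x p)"
  using Pi_adjunction[OF p] by (auto simp: adjunction_def slice_simps(1) pullback_functor_simps)

lemma Pi_triangle2: "arr a \<Longrightarrow> tgt a = src p \<Longrightarrow>
    FA R (Pi_counit E p a) \<cdot>\<^bsub>\<T>\<^esub> Pi_unit E p (FO R a) =
    Id \<T> (FO R a)"
  using Pi_adjunction[OF p] by (auto simp: adjunction_def slice_simps(1))

lemma pullback_functor_Hom: "t \<in> Hom \<T> x x' \<Longrightarrow>
    FA (pullback_functor E p) t \<in> Hom \<S> (pr2 E x p) (pr2 E x' p)"
  using Pi_adjunction[OF p]
  by (auto simp: adjunction_def is_functor_def Hom_def pullback_functor_simps)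

lemma pullback_functor_Comp: "t \<in> Hom \<T> x y \<Longrightarrow> t' \<in> Hom \<T> y z \<Longrightarrow>
    FA (pullback_functor E p) (t' \<cdot>\<^bsub>\<T>\<^esub> t) =
    FA (pullback_functor E p) t' \<cdot>\<^bsub>\<S>\<^esub> FA (pullback_functor E p) t"
  using Pi_adjunction[OF p] is_functor_Comp by (auto simp: adjunction_def)

lemma slice_category: "category \<T>" "category \<S>"
  using Pi_adjunction[OF p] by (auto simp: adjunction_def is_functor_def)

section \<open>Evaluation, transposition and extensionality for elements of polynomial
  functors\<close>

lemma PF_map_simps [simp]:
  assumes "obj A"
  shows "arr (PF_map E p A)" "src (PF_map E p A) = PF E p A" "tgt (PF_map E p A) = tgt p"
    "obj (PF E p A)"
  using Pi_FO[of "prd2 E A (src p)"] assms by (auto simp: PF_map_def PF_def)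

abbreviation (input) "ev A \<equiv> slice_arrow (Pi_counit E p (prd2 E A (src p)))"

text \<open>The counit is an arrow over the directions of \<open>p\<close>, so its second component
  is forced to be the pullback projection; all the information sits in the component
  \<open>PF_ev\<close> into \<open>A\<close>. The last fact presents the counit as a literal triple,
  ready for composition in the slice.\<close>

lemma ev_simps:
  assumes "obj A"
  shows "arr (ev A)" "src (ev A) = pb E (PF_map E p A) p"
    "tgt (ev A) = src (prd1 E A (src p))" "prd2 E A (src p) \<cdot> ev A = pr2 E (PF_map E p A) p"
    "Pi_counit E p (prd2 E A (src p)) = (pr2 E (PF_map E p A) p, ev A, prd2 E A (src p))"
  using Pi_counit_Hom[of "prd2 E A (src p)"] Pi_FO[of "prd2 E A (src p)"] assms
  by (auto simp: slice_Hom PF_map_def)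

lemma PF_ev_simps [simp]:
  assumes "obj A"
  shows "arr (PF_ev E p A)" "src (PF_ev E p A) = pb E (PF_map E p A) p"
    "tgt (PF_ev E p A) = A"
  using ev_simps[OF assms] assms by (auto simp: PF_ev_def)

lemma PF_at_simps [simp]:
  assumes "obj A" "arr u" "tgt u = PF E p A" "arr y" "src u = src y"
    "tgt y = src p" "PF_map E p A \<cdot> u = p \<cdot> y"
  shows "arr (PF_at E p A u y)" "src (PF_at E p A u y) = src y" "tgt (PF_at E p A u y) = A"
  using assms by (auto simp: PF_at_def)

lemma PF_at_Comp [simp]:
  assumes "obj A" "arr u" "tgt u = PF E p A" "arr y" "src u = src y"
    "tgt y = src p" "PF_map E p A \<cdot> u = p \<cdot> y" "arr w" "tgt w = src y"
  shows "PF_at E p A u y \<cdot> w = PF_at E p A (u \<cdot> w) (y \<cdot> w)"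
  using assms by (auto simp: PF_at_def)

text \<open>Beta rule. Evaluating a transpose means applying the counit to its pullback. Naturality
  of the counit and the first triangle identity collapse this to the original map over the
  directions, whose component in \<open>A\<close> is \<open>f\<close>.\<close>

lemma
  assumes "obj A" "arr x" "tgt x = tgt p" "arr f" "src f = pb E x p" "tgt f = A"
  shows PF_elem_simps [simp]: "arr (PF_elem E p A x f)" "src (PF_elem E p A x f) = src x"
    "tgt (PF_elem E p A x f) = PF E p A" "PF_map E p A \<cdot> PF_elem E p A x f = x"
    and PF_at_PF_elem_generic:
      "PF_at E p A (PF_elem E p A x f \<cdot> pr1 E x p) (pr2 E x p) = f"
proof -
  let ?a = "prd2 E A (src p)"
  define t where "t = (pr2 E x p, prd_pair E f (pr2 E x p), ?a)"
  have t: "t \<in> Hom \<S> (pr2 E x p) ?a"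
    using assms by (auto simp: t_def slice_Hom slice_simps)
  have u: "Pi_unit E p x \<in> Hom \<T> x (FO R (pr2 E x p))"
    using Pi_unit_Hom assms by simp
  define s where "s = FA R t \<cdot>\<^bsub>\<T>\<^esub> Pi_unit E p x"
  have s: "s \<in> Hom \<T> x (PF_map E p A)"
    unfolding s_def PF_map_def using category.Comp_in_Hom[OF slice_category(1) u Pi_FA[OF t]] .
  obtain a b where "FA R t = (FO R (pr2 E x p), a, PF_map E p A)"
    "Pi_unit E p x = (x, b, FO R (pr2 E x p))"
    using Pi_FA[OF t] u by (auto simp: slice_Hom PF_map_def)
  then have s_elem: "slice_arrow s = PF_elem E p A x f"
    using assms by (simp add: s_def PF_elem_def slice_simps t_def)
  then show *: "arr (PF_elem E p A x f)" "src (PF_elem E p A x f) = src x"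
    "tgt (PF_elem E p A x f) = PF E p A" "PF_map E p A \<cdot> PF_elem E p A x f = x"
    using s assms by (auto simp: slice_Hom)
  have s_eq: "s = (x, PF_elem E p A x f, PF_map E p A)"
    using s s_elem by (simp add: slice_Hom)
  let ?L = "FA (pullback_functor E p)"
  let ?e = "Pi_counit E p"
  have e: "?e ?a \<in> Hom \<S> (pr2 E (PF_map E p A) p) ?a"
    using Pi_counit_Hom[of ?a] assms by (simp add: PF_map_def)
  have px: "arr (pr2 E x p)" "tgt (pr2 E x p) = src p" using assms by simp_all
  have "?e ?a \<cdot>\<^bsub>\<S>\<^esub> ?L s = ?e ?a \<cdot>\<^bsub>\<S>\<^esub> ?L (FA R t) \<cdot>\<^bsub>\<S>\<^esub> ?L (Pi_unit E p x)"
    unfolding s_def using pullback_functor_Comp[OF u Pi_FA[OF t]] by simp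
  also have "\<dots> = (?e ?a \<cdot>\<^bsub>\<S>\<^esub> ?L (FA R t)) \<cdot>\<^bsub>\<S>\<^esub> ?L (Pi_unit E p x)"
    using category.Comp_assoc[OF slice_category(2) pullback_functor_Hom[OF u]
      pullback_functor_Hom[OF Pi_FA[OF t]] e[unfolded PF_map_def]] by simp
  also have "\<dots> = (t \<cdot>\<^bsub>\<S>\<^esub> ?e (pr2 E x p)) \<cdot>\<^bsub>\<S>\<^esub> ?L (Pi_unit E p x)"
    using Pi_counit_nat[OF t] by simp
  also have "\<dots> = t \<cdot>\<^bsub>\<S>\<^esub> ?e (pr2 E x p) \<cdot>\<^bsub>\<S>\<^esub> ?L (Pi_unit E p x)"
    using category.Comp_assoc[OF slice_category(2) pullback_functor_Hom[OF u] Pi_counit_Hom[OF px] t] .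
  also have "\<dots> = t"
    using Pi_triangle1[of x] category.Comp_Id[OF slice_category(2) t] assms by simp
  finally have "?e ?a \<cdot>\<^bsub>\<S>\<^esub> ?L s = t" .
  then have "ev A \<cdot> pb_pair E (PF_map E p A) p (PF_elem E p A x f \<cdot> pr1 E x p) (pr2 E x p) =
      prd_pair E f (pr2 E x p)"
    unfolding s_eq by (subst (asm) ev_simps(5)[OF assms(1)])
      (simp add: pullback_functor_simps slice_simps t_def)
  moreover have "PF_map E p A \<cdot> PF_elem E p A x f \<cdot> pr1 E x p = p \<cdot> pr2 E x p"
    using * assms Comp_cong1[of "PF_map E p A" "PF_elem E p A x f" x "pr1 E x p"] pb_square[of x p]
    by simp
  ultimately show "PF_at E p A (PF_elem E p A x f \<cdot> pr1 E x p) (pr2 E x p) = f"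
    using assms * ev_simps[of A] by (simp add: PF_at_def PF_ev_def)
qed

text \<open>Eta rule, dual to the beta rule. An element over \<open>x\<close> is a slice arrow into
  a value of the right adjoint; the second triangle identity and naturality of the unit exhibit it
  as the transpose of its own evaluation.\<close>

lemma PF_elem_eta:
  assumes A: "obj A" and u: "arr u" "tgt u = PF E p A"
    and x: "PF_map E p A \<cdot> u = x"
  shows "PF_elem E p A x (PF_at E p A (u \<cdot> pr1 E x p) (pr2 E x p)) = u"
proof -
  let ?a = "prd2 E A (src p)" and ?r = "PF_map E p A"
  let ?L = "FA (pullback_functor E p)" and ?R = "FA R"
  let ?e = "Pi_counit E p" and ?h = "Pi_unit E p"
  have xs: "arr x" "tgt x = tgt p" "src x = src u" using assms by auto
  define s where "s = (x, u, ?r)"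
  have s: "s \<in> Hom \<T> x ?r"
    using assms xs by (auto simp: s_def slice_Hom slice_simps)
  have e: "?e ?a \<in> Hom \<S> (pr2 E ?r p) ?a"
    using Pi_counit_Hom[of ?a] assms by (simp add: PF_map_def)
  have h: "?h ?r \<in> Hom \<T> ?r (FO R (pr2 E ?r p))"
    using Pi_unit_Hom[of ?r] assms by simp
  have hx: "?h x \<in> Hom \<T> x (FO R (pr2 E x p))"
    using Pi_unit_Hom xs by simp
  have "s = (?R (?e ?a) \<cdot>\<^bsub>\<T>\<^esub> ?h ?r) \<cdot>\<^bsub>\<T>\<^esub> s"
    using Pi_triangle2[of ?a] category.Id_Comp[OF slice_category(1) s] A
    by (simp add: PF_map_def)
  also have "\<dots> = ?R (?e ?a) \<cdot>\<^bsub>\<T>\<^esub> ?h ?r \<cdot>\<^bsub>\<T>\<^esub> s"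
    using category.Comp_assoc[OF slice_category(1) s h Pi_FA[OF e]] .
  also have "\<dots> = ?R (?e ?a) \<cdot>\<^bsub>\<T>\<^esub> ?R (?L s) \<cdot>\<^bsub>\<T>\<^esub> ?h x"
    using Pi_unit_nat[OF s] by simp
  also have "\<dots> = (?R (?e ?a) \<cdot>\<^bsub>\<T>\<^esub> ?R (?L s)) \<cdot>\<^bsub>\<T>\<^esub> ?h x"
    using category.Comp_assoc[OF slice_category(1) hx Pi_FA[OF pullback_functor_Hom[OF s]] Pi_FA[OF e]]
    by simp
  also have "?R (?e ?a) \<cdot>\<^bsub>\<T>\<^esub> ?R (?L s) = ?R (?e ?a \<cdot>\<^bsub>\<S>\<^esub> ?L s)"
    using Pi_FA_Comp[OF pullback_functor_Hom[OF s] e] by simp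
  also have "?e ?a \<cdot>\<^bsub>\<S>\<^esub> ?L s = (pr2 E x p, ev A \<cdot> pb_pair E ?r p (u \<cdot> pr1 E x p) (pr2 E x p), ?a)"
    by (subst ev_simps(5)[OF A]) (simp add: s_def pullback_functor_simps slice_simps)
  \<comment> \<open>Compared by projections: the first gives \<open>PF_at\<close> by definition, the
    second gives the direction itself because the counit is a slice arrow.\<close>
  also have "ev A \<cdot> pb_pair E ?r p (u \<cdot> pr1 E x p) (pr2 E x p) =
    prd_pair E (PF_at E p A (u \<cdot> pr1 E x p) (pr2 E x p)) (pr2 E x p)"
  proof -
    have sq: "?r \<cdot> u \<cdot> pr1 E x p = p \<cdot> pr2 E x p"
      using xs Comp_cong1[of ?r u x "pr1 E x p"] pb_square[of x p] assms by simp
    show ?thesis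
      by (rule prd_ext[of A "src p"])
        (use sq assms xs ev_simps[OF A]
          Comp_cong1[OF ev_simps(4)[OF A], of "pb_pair E ?r p (u \<cdot> pr1 E x p) (pr2 E x p)"]
          in \<open>auto simp: PF_at_def PF_ev_def\<close>)
  qed
  finally have s2: "s = ?R (pr2 E x p, prd_pair E (PF_at E p A (u \<cdot> pr1 E x p) (pr2 E x p)) (pr2 E x p), ?a)
    \<cdot>\<^bsub>\<T>\<^esub> ?h x" .
  show ?thesis
    using s2 unfolding s_def PF_elem_def
    by (cases "?R (pr2 E x p, prd_pair E (PF_at E p A (u \<cdot> pr1 E x p) (pr2 E x p)) (pr2 E x p), ?a)"; cases "?h x")
      (auto simp: slice_simps)
qed

text \<open>\<open>PF_arr p g\<close> is the right adjoint applied to the product of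
  \<open>g\<close> with the identity on directions, so naturality of the counit computes its
  evaluation.\<close>

lemma
  assumes g: "arr g" "src g = A" "tgt g = B"
  shows PF_arr_simps [simp]: "arr (PF_arr E p g)" "src (PF_arr E p g) = PF E p A" "tgt (PF_arr E p g) = PF E p B"
    "PF_map E p B \<cdot> PF_arr E p g = PF_map E p A"
    and PF_at_PF_arr_generic:
      "PF_at E p B (PF_arr E p g \<cdot> pr1 E (PF_map E p A) p) (pr2 E (PF_map E p A) p) = g \<cdot> PF_ev E p A"
proof -
  have A: "obj A" and B: "obj B" using g by auto
  let ?U = "src p"
  define t where "t = (prd2 E A ?U, prd_pair E (g \<cdot> prd1 E A ?U) (prd2 E A ?U), prd2 E B ?U)"
  have t: "t \<in> Hom (slice E ?U) (prd2 E A ?U) (prd2 E B ?U)"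
    using A B g by (auto simp: t_def slice_Hom slice_simps)
  have ar: "PF_arr E p g = slice_arrow (FA R t)"
    by (simp add: PF_arr_def t_def g Let_def)
  have R: "FA R t \<in> Hom \<T> (PF_map E p A) (PF_map E p B)"
    using Pi_FA[OF t] by (simp add: PF_map_def)
  show *: "arr (PF_arr E p g)" "src (PF_arr E p g) = PF E p A" "tgt (PF_arr E p g) = PF E p B"
    "PF_map E p B \<cdot> PF_arr E p g = PF_map E p A"
    using R A B by (auto simp: ar slice_Hom)
  have R_eq: "FA R t = (PF_map E p A, PF_arr E p g, PF_map E p B)"
    using R by (simp add: ar slice_Hom)
  have sq: "PF_map E p B \<cdot> PF_arr E p g \<cdot> pr1 E (PF_map E p A) p = p \<cdot> pr2 E (PF_map E p A) p"
    using Comp_cong1[OF *(4), of "pr1 E (PF_map E p A) p"] * A B pb_square[of "PF_map E p A" p] by simp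
  have "ev B \<cdot> pb_pair E (PF_map E p B) p (PF_arr E p g \<cdot> pr1 E (PF_map E p A) p) (pr2 E (PF_map E p A) p)
      = prd_pair E (g \<cdot> prd1 E A ?U) (prd2 E A ?U) \<cdot> ev A"
    using Pi_counit_nat[OF t] unfolding R_eq
    by (subst (asm) ev_simps(5)[OF A], subst (asm) ev_simps(5)[OF B])
      (simp add: t_def pullback_functor_simps slice_simps)
  then have "prd1 E B ?U \<cdot> ev B \<cdot> pb_pair E (PF_map E p B) p (PF_arr E p g \<cdot> pr1 E (PF_map E p A) p)
      (pr2 E (PF_map E p A) p) = (g \<cdot> prd1 E A ?U) \<cdot> ev A"
    using Comp_cong1[of "prd1 E B ?U" "prd_pair E (g \<cdot> prd1 E A ?U) (prd2 E A ?U)" "g \<cdot> prd1 E A ?U" "ev A"]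
      A B g ev_simps[of A] by simp
  then show "PF_at E p B (PF_arr E p g \<cdot> pr1 E (PF_map E p A) p) (pr2 E (PF_map E p A) p) = g \<cdot> PF_ev E p A"
    using A B g ev_simps[of A] ev_simps[of B] sq * by (simp add: PF_at_def PF_ev_def)
qed

text \<open>By the eta rule both elements are rebuilt from their values at the generic direction.
  The hypothesis \<open>at\<close> is phrased for all stages so that it can be discharged by the
  evaluation rules for arbitrary elements.\<close>

lemma PF_ext:
  assumes A: "obj A" and u: "arr u" "tgt u = PF E p A" and v: "arr v" "tgt v = PF E p A"
    and "src u = src v" and x: "PF_map E p A \<cdot> u = PF_map E p A \<cdot> v"
    and at: "\<And>a y. \<lbrakk>arr a; arr y; src y = src a; tgt a = src v; tgt y = src p;
      PF_map E p A \<cdot> u \<cdot> a = p \<cdot> y; PF_map E p A \<cdot> v \<cdot> a = p \<cdot> y\<rbrakk> \<Longrightarrow>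
      PF_at E p A (u \<cdot> a) y = PF_at E p A (v \<cdot> a) y"
  shows "u = v"
proof -
  obtain x where x: "PF_map E p A \<cdot> u = x" "PF_map E p A \<cdot> v = x" using x by simp
  have x': "arr x" "tgt x = tgt p" "src x = src u" using A u x(1) by auto
  have sq: "PF_map E p A \<cdot> u \<cdot> pr1 E x p = p \<cdot> pr2 E x p"
    "PF_map E p A \<cdot> v \<cdot> pr1 E x p = p \<cdot> pr2 E x p"
    using Comp_cong1[OF x(1), of "pr1 E x p"] Comp_cong1[OF x(2), of "pr1 E x p"]
      assms(1-6) x' pb_square[of x p] by simp_all
  have "PF_at E p A (u \<cdot> pr1 E x p) (pr2 E x p) = PF_at E p A (v \<cdot> pr1 E x p) (pr2 E x p)"
    by (rule at) (use assms(1-6) x' sq in auto)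
  then show ?thesis
    using PF_elem_eta[OF A u x(1)] PF_elem_eta[OF A v x(2)] by metis
qed

text \<open>The generic beta rule precomposed with the pair \<open>(a, y)\<close>.\<close>

lemma PF_at_PF_elem:
  assumes "obj A" "arr x" "tgt x = tgt p" "arr f" "src f = pb E x p" "tgt f = A"
    and "arr a" "arr y" "tgt a = src x" "tgt y = src p" "src y = src a" "x \<cdot> a = p \<cdot> y"
  shows "PF_at E p A (PF_elem E p A x f \<cdot> a) y = f \<cdot> pb_pair E x p a y"
proof -
  have 1: "PF_map E p A \<cdot> PF_elem E p A x f \<cdot> pr1 E x p = p \<cdot> pr2 E x p"
    using assms Comp_cong1[OF PF_elem_simps(4)[OF assms(1-6)], of "pr1 E x p"] pb_square[of x p] by simp
  show ?thesis
    using arg_cong[OF PF_at_PF_elem_generic[OF assms(1-6)], of "\<lambda>t. t \<cdot> pb_pair E x p a y"] assms 1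
    by simp
qed

lemma PF_at_PF_arr:
  assumes g: "arr g" "src g = A" "tgt g = B"
    and "arr u" "tgt u = PF E p A" "arr y" "src u = src y"
    "tgt y = src p" "PF_map E p A \<cdot> u = p \<cdot> y"
  shows "PF_at E p B (PF_arr E p g \<cdot> u) y = g \<cdot> PF_at E p A u y"
proof -
  have A: "obj A" and B: "obj B" using g by auto
  let ?x = "PF_map E p A"
  have 1: "PF_map E p B \<cdot> PF_arr E p g \<cdot> pr1 E ?x p = p \<cdot> pr2 E ?x p"
    using g A B Comp_cong1[OF PF_arr_simps(4)[OF g], of "pr1 E ?x p"] pb_square[of ?x p] by simp
  show ?thesis
    using arg_cong[OF PF_at_PF_arr_generic[OF g], of "\<lambda>t. t \<cdot> pb_pair E ?x p u y"] assms 1 A B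
    by (simp add: PF_at_def)
qed

end

lemma PF_map_PF_elem_Comp [simp]:
  assumes "exponentiable E p" "obj A" "arr x" "tgt x = tgt p" "arr f"
    "src f = pb E x p" "tgt f = A" "arr w" "tgt w = src x"
  shows "PF_map E p A \<cdot> PF_elem E p A x f \<cdot> w = x \<cdot> w"
  using Comp_cong1[OF PF_elem_simps(4)[OF assms(1-7)], of w] assms by simp

lemma PF_map_PF_arr_Comp [simp]:
  assumes "exponentiable E p" "arr g" "tgt g = B" "arr w" "tgt w = PF E p (src g)"
  shows "PF_map E p B \<cdot> PF_arr E p g \<cdot> w = PF_map E p (src g) \<cdot> w"
proof -
  have "obj B" using assms by auto
  then show ?thesis
    using Comp_cong1[OF PF_arr_simps(4)[OF assms(1,2) refl assms(3)], of w] assms by simp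
qed

section \<open>Morphisms of polynomials\<close>

lemma poly_mapD [simp]:
  assumes "poly_map \<phi>"
  shows "arr (pdom \<phi>)" "arr (pcod \<phi>)" "arr (pos \<phi>)"
    "src (pos \<phi>) = tgt (pdom \<phi>)" "tgt (pos \<phi>) = tgt (pcod \<phi>)"
    "arr (sharp \<phi>)" "src (sharp \<phi>) = pb E (pos \<phi>) (pcod \<phi>)" "tgt (sharp \<phi>) = src (pdom \<phi>)"
    "pdom \<phi> \<cdot> sharp \<phi> = pr1 E (pos \<phi>) (pcod \<phi>)"
  using assms by (auto simp: is_poly_map_def Hom_def)

lemma is_poly_mapI:
  assumes "arr p" "arr q" "arr h" "src h = tgt p" "tgt h = tgt q"
    "arr s" "src s = pb E h q" "tgt s = src p" "p \<cdot> s = pr1 E h q"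
  shows "poly_map \<lparr>pdom = p, pcod = q, pos = h, sharp = s\<rparr>"
  using assms by (simp add: is_poly_map_def Hom_def)

lemma sharp_at_simps [simp]:
  assumes "poly_map \<phi>" "arr x" "arr y" "src x = src y" "tgt x = tgt (pdom \<phi>)"
    "tgt y = src (pcod \<phi>)" "pos \<phi> \<cdot> x = pcod \<phi> \<cdot> y"
  shows "arr (sh \<phi> x y)" "src (sh \<phi> x y) = src y"
    "tgt (sh \<phi> x y) = src (pdom \<phi>)"
    "pdom \<phi> = p \<Longrightarrow> p \<cdot> sh \<phi> x y = x"
  using assms Comp_cong1[OF poly_mapD(9)[OF assms(1)], of "pb_pair E (pos \<phi>) (pcod \<phi>) x y"]
  by (auto simp: sharp_at_def)

lemma sharp_at_Comp [simp]:
  assumes "poly_map \<phi>" "arr x" "arr y" "src x = src y" "tgt x = tgt (pdom \<phi>)"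
    "tgt y = src (pcod \<phi>)" "pos \<phi> \<cdot> x = pcod \<phi> \<cdot> y" "arr w" "tgt w = src y"
  shows "sh \<phi> x y \<cdot> w = sh \<phi> (x \<cdot> w) (y \<cdot> w)"
  using assms by (simp add: sharp_at_def)

lemma sharp_at_pr:
  assumes "poly_map \<phi>"
  shows "sh \<phi> (pr1 E (pos \<phi>) (pcod \<phi>)) (pr2 E (pos \<phi>) (pcod \<phi>)) = sharp \<phi>"
  using assms by (simp add: sharp_at_def)

text \<open>A Yoneda argument: an operation \<open>T\<close> that commutes with change of stage is
  determined by its value at the generic pair, so a sharp map defined there computes as
  \<open>T\<close> everywhere. Products of morphisms, unitors, the associator and the cofunctor
  lifting a coalgebra homomorphism are all handled this way.\<close>

lemma poly_map_generic:
  assumes M: "M = \<lparr>pdom = p, pcod = q, pos = h, sharp = T (pr1 E h q) (pr2 E h q)\<rparr>"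
    and p: "arr p" and q: "arr q" and h: "arr h" "src h = tgt p" "tgt h = tgt q"
    and T: "\<And>u d. \<lbrakk>arr u; arr d; src u = src d; tgt u = tgt p; tgt d = src q;
        h \<cdot> u = q \<cdot> d\<rbrakk> \<Longrightarrow>
        arr (T u d) \<and> src (T u d) = src d \<and> tgt (T u d) = src p \<and> p \<cdot> T u d = u \<and>
        (\<forall>w. arr w \<longrightarrow> tgt w = src d \<longrightarrow> T u d \<cdot> w = T (u \<cdot> w) (d \<cdot> w))"
  shows "poly_map M"
    and "\<And>u d. \<lbrakk>arr u; arr d; src u = src d; tgt u = tgt p; tgt d = src q;
        h \<cdot> u = q \<cdot> d\<rbrakk> \<Longrightarrow> sh M u d = T u d"
proof -
  note T' = T[of "pr1 E h q" "pr2 E h q"]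
  show "poly_map M"
    unfolding M by (rule is_poly_mapI) (use T' p q h pb_square[of h q] in auto)
  show "sh M u d = T u d"
    if "arr u" "arr d" "src u = src d" "tgt u = tgt p" "tgt d = src q"
      "h \<cdot> u = q \<cdot> d" for u d
    using T' p q h pb_square[of h q] that by (simp add: M sharp_at_def)
qed

lemma poly_map_ext:
  assumes "poly_map \<phi>" "poly_map \<psi>"
    and "pdom \<phi> = pdom \<psi>" "pcod \<phi> = pcod \<psi>" "pos \<phi> = pos \<psi>"
    and "\<And>x y. \<lbrakk>arr x; arr y; src x = src y; tgt x = tgt (pdom \<psi>);
      tgt y = src (pcod \<psi>); pos \<psi> \<cdot> x = pcod \<psi> \<cdot> y\<rbrakk> \<Longrightarrow> sh \<phi> x y = sh \<psi> x y"
  shows "\<phi> = \<psi>"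
proof -
  let ?x = "pr1 E (pos \<psi>) (pcod \<psi>)" and ?y = "pr2 E (pos \<psi>) (pcod \<psi>)"
  have "sh \<phi> ?x ?y = sh \<psi> ?x ?y"
    by (rule assms(6)) (use assms(1,2) pb_square[of "pos \<psi>" "pcod \<psi>"] in auto)
  then have "sharp \<phi> = sharp \<psi>"
    using sharp_at_pr[OF assms(1)] sharp_at_pr[OF assms(2)] assms(3-5) by simp
  then show ?thesis using assms(3-5) by simp
qed

lemma poly_id_simps [simp]:
  "pdom (poly_id E p) = p" "pcod (poly_id E p) = p" "pos (poly_id E p) = Id E (tgt p)"
  by (simp_all add: poly_id_def)

lemma poly_id_poly_map [simp]: "arr p \<Longrightarrow> poly_map (poly_id E p)"
  unfolding poly_id_def using pb_square[of "Id E (tgt p)" p] by (intro is_poly_mapI) simp_all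

lemma sharp_at_poly_id [simp]:
  assumes "arr p" "arr y" "tgt y = src p" "x = p \<cdot> y"
  shows "sh (poly_id E p) x y = y"
  using assms by (simp add: sharp_at_def poly_id_def)

lemma poly_comp_simps [simp]:
  "pdom (poly_comp E \<psi> \<phi>) = pdom \<phi>" "pcod (poly_comp E \<psi> \<phi>) = pcod \<psi>"
  "pos (poly_comp E \<psi> \<phi>) = pos \<psi> \<cdot> pos \<phi>"
  by (simp_all add: poly_comp_def Let_def)

lemma poly_comp:
  assumes "poly_map \<phi>" "poly_map \<psi>" "pcod \<phi> = pdom \<psi>"
  shows poly_comp_poly_map [simp]: "poly_map (poly_comp E \<psi> \<phi>)"
    and sharp_at_poly_comp [simp]: "\<And>x z. \<lbrakk>arr x; arr z; src x = src z;
      tgt x = tgt (pdom \<phi>); tgt z = src (pcod \<psi>); pos \<psi> \<cdot> pos \<phi> \<cdot> x = pcod \<psi> \<cdot> z\<rbrakk> \<Longrightarrow>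
      sh (poly_comp E \<psi> \<phi>) x z = sh \<phi> x (sh \<psi> (pos \<phi> \<cdot> x) z)"
proof -
  let ?h = "pos \<psi> \<cdot> pos \<phi>"
  let ?x = "pr1 E ?h (pcod \<psi>)" and ?z = "pr2 E ?h (pcod \<psi>)"
  have sq: "pos \<psi> \<cdot> pos \<phi> \<cdot> ?x = pcod \<psi> \<cdot> ?z"
    using pb_square[of ?h "pcod \<psi>"] assms by simp
  show "poly_map (poly_comp E \<psi> \<phi>)"
    unfolding poly_comp_def Let_def by (rule is_poly_mapI) (use assms sq in auto)
  show "sh (poly_comp E \<psi> \<phi>) x z = sh \<phi> x (sh \<psi> (pos \<phi> \<cdot> x) z)"
    if "arr x" "arr z" "src x = src z" "tgt x = tgt (pdom \<phi>)"
      "tgt z = src (pcod \<psi>)" "pos \<psi> \<cdot> pos \<phi> \<cdot> x = pcod \<psi> \<cdot> z" for x z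
    unfolding sharp_at_def[of E "poly_comp E \<psi> \<phi>"] poly_comp_simps
    using that assms sq by (simp add: poly_comp_def Let_def)
qed

text \<open>The common shape of \<open>PF_trans \<phi> A\<close> and of the position map of
  \<open>tri_map \<phi> \<psi>\<close>: directions are pulled back along the sharp map of
  \<open>\<phi>\<close> and values are pushed forward along \<open>g\<close>. In the first case
  \<open>g\<close> is an identity, in the second it is \<open>pos \<psi>\<close>.\<close>

lemma PF_elem_reindex:
  assumes \<phi>: "poly_map \<phi>" "pdom \<phi> = p" "pcod \<phi> = q" and pq: "exponentiable E p" "exponentiable E q"
    and g: "arr g" "src g = A" "tgt g = B"
    and x: "x = pos \<phi> \<cdot> PF_map E p A"
    and h: "h = PF_elem E q B x
      (g \<cdot> PF_at E p A (pr1 E x q) (sh \<phi> (PF_map E p A \<cdot> pr1 E x q) (pr2 E x q)))"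
  shows "arr h" "src h = PF E p A" "tgt h = PF E q B"
    and "\<And>u. \<lbrakk>arr u; tgt u = PF E p A\<rbrakk> \<Longrightarrow> PF_map E q B \<cdot> h \<cdot> u = pos \<phi> \<cdot> PF_map E p A \<cdot> u"
    and "\<And>u y. \<lbrakk>arr u; tgt u = PF E p A; arr y; tgt y = src q; src y = src u;
      pos \<phi> \<cdot> PF_map E p A \<cdot> u = q \<cdot> y\<rbrakk> \<Longrightarrow>
      PF_at E q B (h \<cdot> u) y = g \<cdot> PF_at E p A u (sh \<phi> (PF_map E p A \<cdot> u) y)"
proof -
  note D = poly_mapD[OF \<phi>(1), unfolded \<phi>(2,3)]
  have A: "obj A" and B: "obj B" using g by auto
  have x': "arr x" "tgt x = tgt q" "src x = PF E p A" using A pq D by (simp_all add: x)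
  have x_Comp: "x \<cdot> u = pos \<phi> \<cdot> PF_map E p A \<cdot> u" if "arr u" "tgt u = PF E p A" for u
    using that A pq D by (simp add: x)
  define f where "f = g \<cdot> PF_at E p A (pr1 E x q) (sh \<phi> (PF_map E p A \<cdot> pr1 E x q) (pr2 E x q))"
  have sq: "pos \<phi> \<cdot> PF_map E p A \<cdot> pr1 E x q = q \<cdot> pr2 E x q"
    using pb_square[of x q] D x' by (simp add: x_Comp)
  have f: "arr f" "src f = pb E x q" "tgt f = B"
    using A pq \<phi> g D sq x' by (simp_all add: f_def)
  note h = h[folded f_def]
  show "arr h" "src h = PF E p A" "tgt h = PF E q B"
    using x' f pq B by (simp_all add: h)
  show "PF_map E q B \<cdot> h \<cdot> u = pos \<phi> \<cdot> PF_map E p A \<cdot> u" if "arr u" "tgt u = PF E p A" for u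
    using that x' f B pq(2) by (simp add: h x_Comp)
  show "PF_at E q B (h \<cdot> u) y = g \<cdot> PF_at E p A u (sh \<phi> (PF_map E p A \<cdot> u) y)"
    if u: "arr u" "tgt u = PF E p A" and y: "arr y" "tgt y = src q" "src y = src u"
      and uy: "pos \<phi> \<cdot> PF_map E p A \<cdot> u = q \<cdot> y" for u y
  proof -
    have xu: "x \<cdot> u = q \<cdot> y" using x_Comp u uy by simp
    then have "PF_at E q B (h \<cdot> u) y = f \<cdot> pb_pair E x q u y"
      unfolding h using u y x' f pq(2) B by (intro PF_at_PF_elem) simp_all
    also have "\<dots> = g \<cdot> PF_at E p A u (sh \<phi> (PF_map E p A \<cdot> u) y)"
      unfolding f_def using u y x' A pq \<phi> g D sq xu by simp
    finally show ?thesis .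
  qed
qed

lemma PF_trans:
  assumes "poly_map \<phi>" "pdom \<phi> = p" "pcod \<phi> = q" "exponentiable E p" "exponentiable E q"
    and A: "obj A"
  shows PF_trans_simps [simp]: "arr (PF_trans E \<phi> A)" "src (PF_trans E \<phi> A) = PF E p A"
      "tgt (PF_trans E \<phi> A) = PF E q A"
    and PF_map_PF_trans [simp]: "\<And>u. \<lbrakk>arr u; tgt u = PF E p A\<rbrakk> \<Longrightarrow>
      PF_map E q A \<cdot> PF_trans E \<phi> A \<cdot> u = pos \<phi> \<cdot> PF_map E p A \<cdot> u"
    and PF_at_PF_trans: "\<And>u y. \<lbrakk>arr u; tgt u = PF E p A; arr y; tgt y = src q;
      src y = src u; pos \<phi> \<cdot> PF_map E p A \<cdot> u = q \<cdot> y\<rbrakk> \<Longrightarrow>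
      PF_at E q A (PF_trans E \<phi> A \<cdot> u) y = PF_at E p A u (sh \<phi> (PF_map E p A \<cdot> u) y)"
proof -
  note D = poly_mapD[OF assms(1), unfolded assms(2,3)]
  let ?x = "pos \<phi> \<cdot> PF_map E p A"
  let ?f = "PF_at E p A (pr1 E ?x q) (sh \<phi> (PF_map E p A \<cdot> pr1 E ?x q) (pr2 E ?x q))"
  have sq: "pos \<phi> \<cdot> PF_map E p A \<cdot> pr1 E ?x q = q \<cdot> pr2 E ?x q"
    using pb_square[of ?x q] assms D by simp
  have "PF_trans E \<phi> A = PF_elem E q A ?x (Id E A \<cdot> ?f)"
    using assms D sq by (simp add: PF_trans_def Let_def)
  note R = PF_elem_reindex[OF assms(1-5) _ _ _ refl this]
  show "arr (PF_trans E \<phi> A)" "src (PF_trans E \<phi> A) = PF E p A"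
      "tgt (PF_trans E \<phi> A) = PF E q A"
    using R A by simp_all
  show "PF_map E q A \<cdot> PF_trans E \<phi> A \<cdot> u = pos \<phi> \<cdot> PF_map E p A \<cdot> u"
    if "arr u" "tgt u = PF E p A" for u
    using R(4) A that by simp
  show "PF_at E q A (PF_trans E \<phi> A \<cdot> u) y = PF_at E p A u (sh \<phi> (PF_map E p A \<cdot> u) y)"
    if "arr u" "tgt u = PF E p A" "arr y" "tgt y = src q"
      "src y = src u" "pos \<phi> \<cdot> PF_map E p A \<cdot> u = q \<cdot> y" for u y
    using R(5)[of u y] A that assms D by simp
qed

section \<open>The composition product\<close>

lemma tri_simps [simp]:
  assumes "exponentiable E p" "arr q"
  shows "arr (tri E p q)" "tgt (tri E p q) = PF E p (tgt q)"
    "arr (tri_fst E p q)" "src (tri_fst E p q) = src (tri E p q)" "tgt (tri_fst E p q) = src p"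
    "arr (tri_snd E p q)" "src (tri_snd E p q) = src (tri E p q)" "tgt (tri_snd E p q) = src q"
  using assms by (simp_all add: tri_def tri_fst_def tri_snd_def)

lemma Dom_tri: "exponentiable E p \<Longrightarrow> arr q \<Longrightarrow> src (tri E p q) = pb E (PF_ev E p (tgt q)) q"
  by (simp add: tri_def)

text \<open>The two pullback squares in the construction of \<open>p \<triangleleft> q\<close>: over
  a position \<open>(x, f)\<close>, the first component of a direction lies over \<open>x\<close>,
  and the second lies over the value of \<open>f\<close> at the first.\<close>

lemma tri_position:
  assumes "exponentiable E p" "arr q" "arr d" "tgt d = src (tri E p q)"
  shows "PF_map E p (tgt q) \<cdot> tri E p q \<cdot> d = p \<cdot> tri_fst E p q \<cdot> d"
    "PF_at E p (tgt q) (tri E p q \<cdot> d) (tri_fst E p q \<cdot> d) = q \<cdot> tri_snd E p q \<cdot> d"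
proof -
  let ?r = "PF_map E p (tgt q)" and ?e = "PF_ev E p (tgt q)"
  have d: "tgt d = pb E ?e q" using assms by (simp add: Dom_tri)
  show "?r \<cdot> tri E p q \<cdot> d = p \<cdot> tri_fst E p q \<cdot> d"
    using assms d pb_square_Comp[of ?r p "pr1 E ?e q \<cdot> d"] by (simp add: tri_def tri_fst_def)
  show "PF_at E p (tgt q) (tri E p q \<cdot> d) (tri_fst E p q \<cdot> d) = q \<cdot> tri_snd E p q \<cdot> d"
    using assms d pb_pair_eta[of ?r p "pr1 E ?e q \<cdot> d"] pb_square_Comp[of ?e q d]
    by (simp add: tri_def tri_fst_def tri_snd_def PF_at_def)
qed

lemma tri_dir_simps [simp]:
  assumes "exponentiable E p" "arr q" "arr u" "arr y" "arr z"
    "src u = src z" "src y = src z" "tgt u = PF E p (tgt q)" "tgt y = src p"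
    "tgt z = src q" "PF_map E p (tgt q) \<cdot> u = p \<cdot> y" "PF_at E p (tgt q) u y = q \<cdot> z"
  shows "arr (tri_dir E p q u y z)" "src (tri_dir E p q u y z) = src z"
    "tgt (tri_dir E p q u y z) = src (tri E p q)"
    "tri E p q \<cdot> tri_dir E p q u y z = u" "tri_fst E p q \<cdot> tri_dir E p q u y z = y"
    "tri_snd E p q \<cdot> tri_dir E p q u y z = z"
    "arr w \<Longrightarrow> tgt w = src z \<Longrightarrow>
      tri_dir E p q u y z \<cdot> w = tri_dir E p q (u \<cdot> w) (y \<cdot> w) (z \<cdot> w)"
proof -
  let ?r = "PF_map E p (tgt q)" and ?e = "PF_ev E p (tgt q)"
  have e: "?e \<cdot> pb_pair E ?r p u y = q \<cdot> z" using assms(12) by (simp add: PF_at_def)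
  show "arr (tri_dir E p q u y z)" "src (tri_dir E p q u y z) = src z"
    "tgt (tri_dir E p q u y z) = src (tri E p q)"
    "tri E p q \<cdot> tri_dir E p q u y z = u" "tri_fst E p q \<cdot> tri_dir E p q u y z = y"
    "tri_snd E p q \<cdot> tri_dir E p q u y z = z"
    using assms(1-11) e by (simp_all add: tri_dir_def tri_def tri_fst_def tri_snd_def)
  show "tri_dir E p q u y z \<cdot> w = tri_dir E p q (u \<cdot> w) (y \<cdot> w) (z \<cdot> w)"
    if "arr w" "tgt w = src z"
    unfolding tri_dir_def using assms(1-11) e that by simp
qed

text \<open>Positions are an instance of \<open>PF_elem_reindex\<close>. On directions the map is
  first written as an operation \<open>T\<close> on elements, so that
  \<open>poly_map_generic\<close> reduces the rest to typing and to stability under change of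
  stage.\<close>

lemma tri_map:
  assumes \<phi>: "poly_map \<phi>" "pdom \<phi> = p" "pcod \<phi> = p'" "exponentiable E p" "exponentiable E p'"
    and \<psi>: "poly_map \<psi>" "pdom \<psi> = q" "pcod \<psi> = q'"
  defines "h \<equiv> pos (tri_map E \<phi> \<psi>)"
  shows tri_map_simps: "pdom (tri_map E \<phi> \<psi>) = tri E p q" "pcod (tri_map E \<phi> \<psi>) = tri E p' q'"
    and tri_map_pos: "arr h" "src h = PF E p (tgt q)" "tgt h = PF E p' (tgt q')"
    and PF_map_tri_map: "\<And>u. \<lbrakk>arr u; tgt u = PF E p (tgt q)\<rbrakk> \<Longrightarrow>
      PF_map E p' (tgt q') \<cdot> h \<cdot> u = pos \<phi> \<cdot> PF_map E p (tgt q) \<cdot> u"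
    and PF_at_tri_map: "\<And>u y. \<lbrakk>arr u; tgt u = PF E p (tgt q); arr y;
      tgt y = src p'; src y = src u; pos \<phi> \<cdot> PF_map E p (tgt q) \<cdot> u = p' \<cdot> y\<rbrakk> \<Longrightarrow>
      PF_at E p' (tgt q') (h \<cdot> u) y =
      pos \<psi> \<cdot> PF_at E p (tgt q) u (sh \<phi> (PF_map E p (tgt q) \<cdot> u) y)"
    and tri_map_poly_map: "poly_map (tri_map E \<phi> \<psi>)"
    and sharp_at_tri_map: "\<And>u d y. \<lbrakk>arr u; tgt u = PF E p (tgt q); arr d;
      tgt d = src (tri E p' q'); src d = src u; h \<cdot> u = tri E p' q' \<cdot> d;
      y = sh \<phi> (PF_map E p (tgt q) \<cdot> u) (tri_fst E p' q' \<cdot> d)\<rbrakk> \<Longrightarrow>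
      sh (tri_map E \<phi> \<psi>) u d =
      tri_dir E p q u y (sh \<psi> (PF_at E p (tgt q) u y) (tri_snd E p' q' \<cdot> d))"
proof -
  note D = poly_mapD[OF \<phi>(1), unfolded \<phi>(2,3)] poly_mapD[OF \<psi>(1), unfolded \<psi>(2,3)]
  let ?Q = "tgt q" and ?Q' = "tgt q'"
  let ?r = "PF_map E p ?Q"
  have "h = PF_elem E p' ?Q' (pos \<phi> \<cdot> ?r) (pos \<psi> \<cdot> PF_at E p ?Q (pr1 E (pos \<phi> \<cdot> ?r) p')
      (sh \<phi> (?r \<cdot> pr1 E (pos \<phi> \<cdot> ?r) p') (pr2 E (pos \<phi> \<cdot> ?r) p')))"
    by (simp add: h_def tri_map_def Let_def \<phi> \<psi>)
  note R = PF_elem_reindex[OF \<phi> D(12-14) refl this]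
  show tm: "pdom (tri_map E \<phi> \<psi>) = tri E p q" "pcod (tri_map E \<phi> \<psi>) = tri E p' q'"
    by (simp_all add: tri_map_def Let_def \<phi> \<psi>)
  show h: "arr h" "src h = PF E p ?Q" "tgt h = PF E p' ?Q'"
    using R by simp_all
  show 1: "PF_map E p' ?Q' \<cdot> h \<cdot> u = pos \<phi> \<cdot> ?r \<cdot> u"
    if "arr u" "tgt u = PF E p ?Q" for u
    using R(4)[OF that] .
  show 2: "PF_at E p' ?Q' (h \<cdot> u) y = pos \<psi> \<cdot> PF_at E p ?Q u (sh \<phi> (?r \<cdot> u) y)"
    if "arr u" "tgt u = PF E p ?Q" "arr y" "tgt y = src p'"
      "src y = src u" "pos \<phi> \<cdot> ?r \<cdot> u = p' \<cdot> y" for u y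
    using R(5)[OF that] .
  define T where "T u d = (let y = sh \<phi> (?r \<cdot> u) (tri_fst E p' q' \<cdot> d) in
      tri_dir E p q u y (sh \<psi> (PF_at E p ?Q u y) (tri_snd E p' q' \<cdot> d)))" for u d
  have T: "arr (T u d) \<and> src (T u d) = src d \<and> tgt (T u d) = src (tri E p q) \<and>
      tri E p q \<cdot> T u d = u \<and>
      (\<forall>w. arr w \<longrightarrow> tgt w = src d \<longrightarrow> T u d \<cdot> w = T (u \<cdot> w) (d \<cdot> w))"
    if A: "arr u" "arr d" "src u = src d" "tgt u = tgt (tri E p q)"
        "tgt d = src (tri E p' q')"
      and hu: "h \<cdot> u = tri E p' q' \<cdot> d" for u d
  proof -
    have u: "arr u" "tgt u = PF E p ?Q"
      and d: "arr d" "tgt d = src (tri E p' q')" "src d = src u"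
      using A \<phi> D by simp_all
    define y' z' where "y' = tri_fst E p' q' \<cdot> d" and "z' = tri_snd E p' q' \<cdot> d"
    have y': "arr y'" "src y' = src u" "tgt y' = src p'"
      and z': "arr z'" "src z' = src u" "tgt z' = src q'"
      using d \<phi> D by (simp_all add: y'_def z'_def)
    \<comment> \<open>\<open>e1\<close> and \<open>e2\<close> say that \<open>y'\<close> and
      \<open>z'\<close> lie over the right positions, so that the sharp maps of
      \<open>\<phi>\<close> and then of \<open>\<psi>\<close> apply. Both come from reading
      \<open>h \<cdot> u = tri E p' q' \<cdot> d\<close> through
      \<open>tri_position\<close>.\<close>
    have e1: "pos \<phi> \<cdot> ?r \<cdot> u = p' \<cdot> y'"
      using 1[OF u] tri_position(1)[of p' q' d] d \<phi> D hu by (simp add: y'_def)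
    define y where "y = sh \<phi> (?r \<cdot> u) y'"
    have y: "arr y" "src y = src u" "tgt y = src p" "p \<cdot> y = ?r \<cdot> u"
      using e1 y' u \<phi> D by (simp_all add: y_def)
    have e2: "pos \<psi> \<cdot> PF_at E p ?Q u y = q' \<cdot> z'"
      using 2[OF u y'(1,3,2) e1] tri_position(2)[of p' q' d] d \<phi> D hu
      by (simp add: y_def y'_def z'_def)
    have at: "arr (PF_at E p ?Q u y)" "src (PF_at E p ?Q u y) = src u" "tgt (PF_at E p ?Q u y) = ?Q"
      using u y \<phi> D by simp_all
    define z where "z = sh \<psi> (PF_at E p ?Q u y) z'"
    have z: "arr z" "src z = src u" "tgt z = src q" "q \<cdot> z = PF_at E p ?Q u y"
      using e2 at z' u \<psi> D by (simp_all add: z_def)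
    have T_eq: "T u d = tri_dir E p q u y z" by (simp add: T_def Let_def y_def y'_def z_def z'_def)
    have "arr (T u d)" "src (T u d) = src u" "tgt (T u d) = src (tri E p q)"
      "tri E p q \<cdot> T u d = u"
      using u y z \<phi> D by (simp_all add: T_eq)
    moreover have "T u d \<cdot> w = T (u \<cdot> w) (d \<cdot> w)" if w: "arr w" "tgt w = src u" for w
    proof -
      have y'w: "y' \<cdot> w = tri_fst E p' q' \<cdot> d \<cdot> w" and z'w: "z' \<cdot> w = tri_snd E p' q' \<cdot> d \<cdot> w"
        using d w \<phi> D by (simp_all add: y'_def z'_def)
      have yw: "y \<cdot> w = sh \<phi> (?r \<cdot> u \<cdot> w) (tri_fst E p' q' \<cdot> d \<cdot> w)"
        using e1 y' u w \<phi> D by (simp add: y_def y'w)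
      have "PF_at E p ?Q u y \<cdot> w = PF_at E p ?Q (u \<cdot> w) (y \<cdot> w)"
        using w u y \<phi> D by simp
      then have zw: "z \<cdot> w = sh \<psi> (PF_at E p ?Q (u \<cdot> w) (y \<cdot> w)) (tri_snd E p' q' \<cdot> d \<cdot> w)"
        using e2 z' at w \<psi> D by (simp add: z_def z'w)
      have "T u d \<cdot> w = tri_dir E p q (u \<cdot> w) (y \<cdot> w) (z \<cdot> w)"
        unfolding T_eq by (rule tri_dir_simps(7)) (use u y z w \<phi> D in auto)
      then show ?thesis by (simp only: yw zw T_def Let_def)
    qed
    ultimately show ?thesis using d by simp
  qed
  let ?t = "tri E p' q'"
  have M: "tri_map E \<phi> \<psi> = \<lparr>pdom = tri E p q, pcod = ?t, pos = h, sharp = T (pr1 E h ?t) (pr2 E h ?t)\<rparr>"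
    unfolding h_def T_def by (simp add: tri_map_def Let_def \<phi> \<psi>)
  show "poly_map (tri_map E \<phi> \<psi>)"
    by (rule poly_map_generic(1)[OF M _ _ _ _ _ T]) (use h \<phi> D in simp_all)
  show "sh (tri_map E \<phi> \<psi>) u d =
      tri_dir E p q u y (sh \<psi> (PF_at E p ?Q u y) (tri_snd E p' q' \<cdot> d))"
    if ud: "arr u" "tgt u = PF E p ?Q" "arr d" "tgt d = src ?t" "src d = src u"
        "h \<cdot> u = ?t \<cdot> d"
      and y: "y = sh \<phi> (?r \<cdot> u) (tri_fst E p' q' \<cdot> d)" for u d y
  proof -
    have "sh (tri_map E \<phi> \<psi>) u d = T u d"
      by (rule poly_map_generic(2)[OF M _ _ _ _ _ T]) (use ud h \<phi> D in simp_all)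
    then show ?thesis using y by (simp add: T_def Let_def)
  qed
qed

section \<open>The unit polynomial and the unitors\<close>

lemma y_poly_simps [simp]:
  "arr (y_poly E)" "src (y_poly E) = one E" "tgt (y_poly E) = one E"
  "arr f \<Longrightarrow> tgt f = one E \<Longrightarrow> y_poly E \<cdot> f = f"
  by (simp_all add: y_poly_def)

text \<open>Maps into \<open>one\<close> are unique, so a position of the product is just its value
  at the only direction. The base condition on a direction holds automatically, and the value
  condition is the given equation \<open>h \<cdot> u = p \<cdot> z\<close>.\<close>

lemma unitor_l:
  assumes y: "exponentiable E (y_poly E)" and p: "arr p"
  defines "h \<equiv> pos (unitor_l E p)"
  shows unitor_l_simps [simp]: "pdom (unitor_l E p) = tri E (y_poly E) p" "pcod (unitor_l E p) = p"
    and unitor_l_pos: "\<And>u. \<lbrakk>arr u; tgt u = PF E (y_poly E) (tgt p)\<rbrakk> \<Longrightarrow>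
      h \<cdot> u = PF_at E (y_poly E) (tgt p) u (bang E (src u))"
    and unitor_l_poly_map [simp]: "poly_map (unitor_l E p)"
    and sharp_at_unitor_l: "\<And>u z. \<lbrakk>arr u; arr z; src u = src z;
      tgt u = PF E (y_poly E) (tgt p); tgt z = src p; h \<cdot> u = p \<cdot> z\<rbrakk> \<Longrightarrow>
      sh (unitor_l E p) u z = tri_dir E (y_poly E) p u (bang E (src z)) z"
proof -
  let ?y = "y_poly E" and ?P = "tgt p"
  let ?T = "PF E ?y ?P"
  have to_one: "f = g" if "arr f" "arr g" "src f = src g" "tgt f = one E" "tgt g = one E"
    for f g using one_ext that by blast
  have sq: "PF_map E ?y ?P \<cdot> u = bang E (src u)" if "arr u" "tgt u = ?T" for u
    using that y p by (intro to_one) simp_all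
  have h_eq: "h = PF_at E ?y ?P (Id E ?T) (bang E ?T)"
    by (simp add: h_def unitor_l_def Let_def)
  have h: "arr h" "src h = ?T" "tgt h = ?P"
    using sq[of "Id E ?T"] y p by (simp_all add: h_eq)
  show pos: "h \<cdot> u = PF_at E ?y ?P u (bang E (src u))" if "arr u" "tgt u = ?T" for u
    using sq[of "Id E ?T"] y p that by (simp add: h_eq)
  show "pdom (unitor_l E p) = tri E ?y p" "pcod (unitor_l E p) = p"
    by (simp_all add: unitor_l_def Let_def)
  define T where "T u z = tri_dir E ?y p u (bang E (src z)) z" for u z
  have pbh: "pb E h p = src (pr2 E h p)" using h p by simp
  have M: "unitor_l E p = \<lparr>pdom = tri E ?y p, pcod = p, pos = h, sharp = T (pr1 E h p) (pr2 E h p)\<rparr>"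
    unfolding unitor_l_def Let_def T_def h_eq[symmetric] by (simp add: pbh)
  have T: "arr (T u z) \<and> src (T u z) = src z \<and> tgt (T u z) = src (tri E ?y p) \<and>
      tri E ?y p \<cdot> T u z = u \<and>
      (\<forall>w. arr w \<longrightarrow> tgt w = src z \<longrightarrow> T u z \<cdot> w = T (u \<cdot> w) (z \<cdot> w))"
    if "arr u" "arr z" "src u = src z" "tgt u = tgt (tri E ?y p)" "tgt z = src p"
      "h \<cdot> u = p \<cdot> z" for u z
  proof -
    have "tgt u = ?T" using that y p by simp
    then show ?thesis using that y p sq[of u] pos[of u] by (simp add: T_def)
  qed
  show "poly_map (unitor_l E p)"
    by (rule poly_map_generic(1)[OF M _ _ _ _ _ T]) (use y p h in simp_all)
  show "sh (unitor_l E p) u z = tri_dir E ?y p u (bang E (src z)) z"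
    if "arr u" "arr z" "src u = src z" "tgt u = ?T" "tgt z = src p" "h \<cdot> u = p \<cdot> z"
    for u z
    unfolding T_def[symmetric]
    by (rule poly_map_generic(2)[OF M _ _ _ _ _ T]) (use that y p h in simp_all)
qed

text \<open>The roles are exchanged compared with the left unitor: now the value condition is an
  equation between maps into \<open>one\<close>, and the base condition is the given square.\<close>

lemma unitor_r:
  assumes p: "exponentiable E p"
  shows unitor_r_simps [simp]: "pdom (unitor_r E p) = tri E p (y_poly E)" "pcod (unitor_r E p) = p"
      "pos (unitor_r E p) = PF_map E p (one E)"
    and unitor_r_poly_map [simp]: "poly_map (unitor_r E p)"
    and sharp_at_unitor_r: "\<And>u z. \<lbrakk>arr u; arr z; src u = src z;
      tgt u = PF E p (one E); tgt z = src p; PF_map E p (one E) \<cdot> u = p \<cdot> z\<rbrakk> \<Longrightarrow>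
      sh (unitor_r E p) u z = tri_dir E p (y_poly E) u z (bang E (src z))"
proof -
  let ?y = "y_poly E"
  let ?h = "PF_map E p (one E)"
  show "pdom (unitor_r E p) = tri E p ?y" "pcod (unitor_r E p) = p" "pos (unitor_r E p) = ?h"
    by (simp_all add: unitor_r_def Let_def)
  define T where "T u z = tri_dir E p ?y u z (bang E (src z))" for u z
  have pbh: "pb E ?h p = src (pr2 E ?h p)" using p by simp
  have M: "unitor_r E p = \<lparr>pdom = tri E p ?y, pcod = p, pos = ?h, sharp = T (pr1 E ?h p) (pr2 E ?h p)\<rparr>"
    unfolding unitor_r_def Let_def T_def by (simp add: pbh)
  have T: "arr (T u z) \<and> src (T u z) = src z \<and> tgt (T u z) = src (tri E p ?y) \<and>
      tri E p ?y \<cdot> T u z = u \<and>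
      (\<forall>w. arr w \<longrightarrow> tgt w = src z \<longrightarrow> T u z \<cdot> w = T (u \<cdot> w) (z \<cdot> w))"
    if "arr u" "arr z" "src u = src z" "tgt u = tgt (tri E p ?y)" "tgt z = src p"
      "?h \<cdot> u = p \<cdot> z" for u z
  proof -
    have u: "tgt u = PF E p (one E)" using that p by simp
    have "PF_at E p (one E) u z = bang E (src z)"
      by (rule one_ext) (use that u p in simp_all)
    then show ?thesis using that u p by (simp add: T_def)
  qed
  show "poly_map (unitor_r E p)"
    by (rule poly_map_generic(1)[OF M _ _ _ _ _ T]) (use p in simp_all)
  show "sh (unitor_r E p) u z = tri_dir E p ?y u z (bang E (src z))"
    if "arr u" "arr z" "src u = src z" "tgt u = PF E p (one E)" "tgt z = src p"
      "?h \<cdot> u = p \<cdot> z"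
    for u z
    unfolding T_def[symmetric]
    by (rule poly_map_generic(2)[OF M _ _ _ _ _ T]) (use that p in simp_all)
qed

section \<open>Canonical maps between polynomial functors and the associator\<close>

lemma PF_y:
  assumes y: "exponentiable E (y_poly E)" and A: "obj A"
  shows PF_y_simps [simp]: "arr (PF_y E A)" "src (PF_y E A) = A" "tgt (PF_y E A) = PF E (y_poly E) A"
    and PF_at_PF_y: "\<And>a z. \<lbrakk>arr a; tgt a = A; arr z; src z = src a; tgt z = one E\<rbrakk> \<Longrightarrow>
      PF_at E (y_poly E) A (PF_y E A \<cdot> a) z = a"
proof -
  show "arr (PF_y E A)" "src (PF_y E A) = A" "tgt (PF_y E A) = PF E (y_poly E) A"
    using assms by (simp_all add: PF_y_def)
  show "PF_at E (y_poly E) A (PF_y E A \<cdot> a) z = a"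
    if "arr a" "tgt a = A" "arr z" "src z = src a" "tgt z = one E" for a z
  proof -
    have "bang E A \<cdot> a = z" by (rule one_ext) (use that A in simp_all)
    then show ?thesis using that assms by (simp add: PF_y_def PF_at_PF_elem)
  qed
qed

text \<open>Elements of \<open>PF p (PF q A)\<close> carry two layers of values, so the map is
  described by its position, the positions of its values and the values of its values. Each comes
  from the generic construction by precomposing with the pairing that classifies the given
  data.\<close>

lemma PF_tri:
  assumes p: "exponentiable E p" and q: "exponentiable E q" and pq: "exponentiable E (tri E p q)"
    and A: "obj A"
  defines "r \<equiv> PF_map E (tri E p q) A" and "Q \<equiv> tgt q"
  shows PF_tri_simps [simp]: "arr (PF_tri E p q A)" "src (PF_tri E p q A) = PF E (tri E p q) A"
      "tgt (PF_tri E p q A) = PF E p (PF E q A)"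
    and PF_map_PF_tri: "\<And>v. \<lbrakk>arr v; tgt v = PF E (tri E p q) A\<rbrakk> \<Longrightarrow>
      PF_map E p (PF E q A) \<cdot> PF_tri E p q A \<cdot> v = PF_map E p Q \<cdot> r \<cdot> v"
    and PF_map_PF_at_PF_tri: "\<And>v y. \<lbrakk>arr v; tgt v = PF E (tri E p q) A; arr y;
      tgt y = src p; src y = src v; PF_map E p Q \<cdot> r \<cdot> v = p \<cdot> y\<rbrakk> \<Longrightarrow>
      PF_map E q A \<cdot> PF_at E p (PF E q A) (PF_tri E p q A \<cdot> v) y = PF_at E p Q (r \<cdot> v) y"
    and PF_at_PF_at_PF_tri: "\<And>v y z. \<lbrakk>arr v; tgt v = PF E (tri E p q) A; arr y;
      tgt y = src p; src y = src v; PF_map E p Q \<cdot> r \<cdot> v = p \<cdot> y;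
      arr z; tgt z = src q; src z = src v; PF_at E p Q (r \<cdot> v) y = q \<cdot> z\<rbrakk> \<Longrightarrow>
      PF_at E q A (PF_at E p (PF E q A) (PF_tri E p q A \<cdot> v) y) z =
      PF_at E (tri E p q) A v (tri_dir E p q (r \<cdot> v) y z)"
proof -
  let ?M = "PF E (tri E p q) A"
  have Q: "obj Q" using q by (simp add: Q_def)
  have r: "arr r" "src r = ?M" "tgt r = PF E p Q" using pq A p q by (simp_all add: r_def Q_def)
  define x where "x = PF_map E p Q \<cdot> r"
  have x: "arr x" "src x = ?M" "tgt x = tgt p" using r p Q by (simp_all add: x_def)
  have x_Comp: "x \<cdot> v = PF_map E p Q \<cdot> r \<cdot> v" if "arr v" "tgt v = ?M" for v
    using that r p Q by (simp add: x_def)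
  \<comment> \<open>The names follow the stages of the definition: \<open>a\<close>,
    \<open>y\<close> form the generic direction of \<open>p\<close> over \<open>x\<close>, and
    further down \<open>w\<close>, \<open>z\<close> form the generic direction of \<open>q\<close>
    over the value \<open>b\<close>.\<close>
  define a y where "a = pr1 E x p" and "y = pr2 E x p"
  have ay: "arr a" "src a = pb E x p" "tgt a = ?M"
    "arr y" "src y = pb E x p" "tgt y = src p" using x p by (simp_all add: a_def y_def)
  have sq: "PF_map E p Q \<cdot> r \<cdot> a = p \<cdot> y"
    using pb_square[of x p] x p x_Comp[of a] ay by (simp add: a_def y_def)
  define b where "b = PF_at E p Q (r \<cdot> a) y"
  have b: "arr b" "src b = pb E x p" "tgt b = Q"
    using r ay sq p Q by (simp_all add: b_def)
  have b_at: "b \<cdot> pb_pair E x p v y' = PF_at E p Q (r \<cdot> v) y'"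
    if "arr v" "tgt v = ?M" "arr y'" "tgt y' = src p" "src y' = src v"
      "PF_map E p Q \<cdot> r \<cdot> v = p \<cdot> y'" for v y'
  proof -
    have "x \<cdot> v = p \<cdot> y'" using x_Comp that by simp
    then show ?thesis
      unfolding b_def using that r ay sq p Q x by (simp add: a_def y_def)
  qed
  define w z where "w = pr1 E b q" and "z = pr2 E b q"
  have wz: "arr w" "src w = pb E b q" "tgt w = pb E x p"
    "arr z" "src z = pb E b q" "tgt z = src q"
    using b q by (simp_all add: w_def z_def Q_def)
  have sq_w: "PF_map E p Q \<cdot> r \<cdot> a \<cdot> w = p \<cdot> y \<cdot> w"
    using Comp_cong1[OF sq, of w] wz ay r p Q by simp
  have bw: "PF_at E p Q (r \<cdot> a \<cdot> w) (y \<cdot> w) = q \<cdot> z"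
    using pb_square[of b q] b q wz r ay sq p Q by (simp add: w_def z_def Q_def b_def)
  define t where "t = tri_dir E p q (r \<cdot> a \<cdot> w) (y \<cdot> w) z"
  have t: "arr t" "src t = pb E b q" "tgt t = src (tri E p q)" "tri E p q \<cdot> t = r \<cdot> a \<cdot> w"
    using p q r ay wz sq_w bw by (simp_all add: t_def Q_def)
  define g where "g = PF_at E (tri E p q) A (a \<cdot> w) t"
  have g: "arr g" "src g = pb E b q" "tgt g = A"
    using pq A ay wz t by (simp_all add: g_def r_def)
  define k where "k = PF_elem E q A b g"
  have k: "arr k" "src k = pb E x p" "tgt k = PF E q A"
    using q A b g by (simp_all add: k_def Q_def)
  have eq: "PF_tri E p q A = PF_elem E p (PF E q A) x k"
    by (simp add: PF_tri_def Let_def k_def g_def t_def z_def w_def b_def a_def y_def x_def r_def Q_def)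
  have qA: "obj (PF E q A)" using q A by simp
  show "arr (PF_tri E p q A)" "src (PF_tri E p q A) = ?M" "tgt (PF_tri E p q A) = PF E p (PF E q A)"
    using p x k qA by (simp_all add: eq)
  show "PF_map E p (PF E q A) \<cdot> PF_tri E p q A \<cdot> v = PF_map E p Q \<cdot> r \<cdot> v"
    if "arr v" "tgt v = ?M" for v
    using p x k qA that x_Comp by (simp add: eq)
  have k_at: "PF_at E p (PF E q A) (PF_tri E p q A \<cdot> v) y' = k \<cdot> pb_pair E x p v y'"
    if "arr v" "tgt v = ?M" "arr y'" "tgt y' = src p" "src y' = src v"
      "PF_map E p Q \<cdot> r \<cdot> v = p \<cdot> y'" for v y'
    unfolding eq using that p x k qA x_Comp by (intro PF_at_PF_elem) simp_all
  show "PF_map E q A \<cdot> PF_at E p (PF E q A) (PF_tri E p q A \<cdot> v) y' = PF_at E p Q (r \<cdot> v) y'"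
    if v: "arr v" "tgt v = ?M" "arr y'" "tgt y' = src p" "src y' = src v"
      "PF_map E p Q \<cdot> r \<cdot> v = p \<cdot> y'" for v y'
  proof -
    have "x \<cdot> v = p \<cdot> y'" using x_Comp v by simp
    then have "PF_map E q A \<cdot> k \<cdot> pb_pair E x p v y' = b \<cdot> pb_pair E x p v y'"
      unfolding k_def using q A b g v x p by (intro PF_map_PF_elem_Comp) (simp_all add: Q_def)
    then show ?thesis using k_at[OF v] b_at[OF v] by simp
  qed
  show "PF_at E q A (PF_at E p (PF E q A) (PF_tri E p q A \<cdot> v) y') z' =
      PF_at E (tri E p q) A v (tri_dir E p q (r \<cdot> v) y' z')"
    if v: "arr v" "tgt v = ?M" "arr y'" "tgt y' = src p" "src y' = src v"
        "PF_map E p Q \<cdot> r \<cdot> v = p \<cdot> y'"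
      and z': "arr z'" "tgt z' = src q" "src z' = src v" "PF_at E p Q (r \<cdot> v) y' = q \<cdot> z'"
    for v y' z'
  proof -
    have xv: "x \<cdot> v = p \<cdot> y'" using x_Comp v by simp
    let ?vy = "pb_pair E x p v y'"
    have vy: "arr ?vy" "src ?vy = src v" "tgt ?vy = pb E x p" "a \<cdot> ?vy = v" "y \<cdot> ?vy = y'"
      using xv v x p by (simp_all add: a_def y_def)
    \<comment> \<open>\<open>?W\<close> classifies the triple \<open>(v, y', z')\<close>: first a
      direction of \<open>p\<close>, then a direction of \<open>q\<close> over the value
      there.\<close>
    let ?W = "pb_pair E b q ?vy z'"
    have bq: "b \<cdot> ?vy = q \<cdot> z'" using b_at[OF v] z' by simp
    then have W: "arr ?W" "src ?W = src v" "tgt ?W = pb E b q" "w \<cdot> ?W = ?vy" "z \<cdot> ?W = z'"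
      using vy z' b q by (simp_all add: w_def z_def)
    have "PF_at E q A (k \<cdot> ?vy) z' = g \<cdot> ?W"
      unfolding k_def using q A b g vy z' bq by (intro PF_at_PF_elem) (simp_all add: Q_def)
    also have "\<dots> = PF_at E (tri E p q) A (a \<cdot> w \<cdot> ?W) (t \<cdot> ?W)"
      unfolding g_def using pq A ay wz t W by (simp add: r_def)
    also have "t \<cdot> ?W = tri_dir E p q (r \<cdot> a \<cdot> w \<cdot> ?W) (y \<cdot> w \<cdot> ?W) (z \<cdot> ?W)"
      unfolding t_def using p q r ay wz sq_w bw W(1-3) by (simp add: Q_def)
    finally show ?thesis using k_at[OF v] by (simp add: W(4,5) vy(4,5))
  qed
qed

text \<open>A direction of the right-bracketed product unpacks to \<open>y\<close>,
  \<open>z\<close>, \<open>w\<close>. Matching \<open>tri_position\<close> for the outer and the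
  inner product against the evaluation rules for \<open>PF_tri\<close> shows that the same three
  elements form a direction of the left-bracketed product.\<close>

lemma associator:
  assumes p: "exponentiable E p" and q: "exponentiable E q" and pq: "exponentiable E (tri E p q)"
    and r: "arr r"
  shows associator_simps [simp]: "pdom (associator E p q r) = tri E (tri E p q) r"
      "pcod (associator E p q r) = tri E p (tri E q r)"
      "pos (associator E p q r) = PF_tri E p q (tgt r)"
    and associator_poly_map [simp]: "poly_map (associator E p q r)"
    and sharp_at_associator: "\<And>v d y e z w. \<lbrakk>arr v; arr d; src v = src d;
      tgt v = PF E (tri E p q) (tgt r); tgt d = src (tri E p (tri E q r));
      PF_tri E p q (tgt r) \<cdot> v = tri E p (tri E q r) \<cdot> d;
      y = tri_fst E p (tri E q r) \<cdot> d; e = tri_snd E p (tri E q r) \<cdot> d;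
      z = tri_fst E q r \<cdot> e; w = tri_snd E q r \<cdot> e\<rbrakk> \<Longrightarrow>
      sh (associator E p q r) v d =
      tri_dir E (tri E p q) r v (tri_dir E p q (PF_map E (tri E p q) (tgt r) \<cdot> v) y z) w"
proof -
  let ?R = "tgt r"
  let ?h = "PF_tri E p q ?R"
  let ?t = "tri E p (tri E q r)"
  let ?s = "tri E (tri E p q) r"
  show "pdom (associator E p q r) = ?s" "pcod (associator E p q r) = ?t"
      "pos (associator E p q r) = ?h"
    by (simp_all add: associator_def Let_def)
  define T where "T v d =
    (let y = tri_fst E p (tri E q r) \<cdot> d; e = tri_snd E p (tri E q r) \<cdot> d;
         z = tri_fst E q r \<cdot> e; w = tri_snd E q r \<cdot> e in
      tri_dir E (tri E p q) r v (tri_dir E p q (PF_map E (tri E p q) ?R \<cdot> v) y z) w)" for v d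
  have R: "obj ?R" using r by simp
  have h: "arr ?h" "src ?h = PF E (tri E p q) ?R" "tgt ?h = PF E p (PF E q ?R)"
    using p q pq R by simp_all
  have qr: "arr (tri E q r)" "tgt (tri E q r) = PF E q ?R" using q r by simp_all
  have M: "associator E p q r = \<lparr>pdom = ?s, pcod = ?t, pos = ?h, sharp = T (pr1 E ?h ?t) (pr2 E ?h ?t)\<rparr>"
    by (simp add: associator_def Let_def T_def)
  have T: "arr (T v d) \<and> src (T v d) = src d \<and> tgt (T v d) = src ?s \<and> ?s \<cdot> T v d = v \<and>
      (\<forall>f. arr f \<longrightarrow> tgt f = src d \<longrightarrow> T v d \<cdot> f = T (v \<cdot> f) (d \<cdot> f))"
    if v: "arr v" and d: "arr d" and vd: "src v = src d" "tgt v = tgt ?s"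
      "tgt d = src ?t" "?h \<cdot> v = ?t \<cdot> d" for v d
  proof -
    have Cv: "tgt v = PF E (tri E p q) ?R" using vd pq r by simp
    define y e where "y = tri_fst E p (tri E q r) \<cdot> d" and "e = tri_snd E p (tri E q r) \<cdot> d"
    have y: "arr y" "src y = src d" "tgt y = src p"
      and e: "arr e" "src e = src d" "tgt e = src (tri E q r)"
      using d vd p qr by (simp_all add: y_def e_def)
    define z w where "z = tri_fst E q r \<cdot> e" and "w = tri_snd E q r \<cdot> e"
    have z: "arr z" "src z = src d" "tgt z = src q"
      and w: "arr w" "src w = src d" "tgt w = src r"
      using e q r by (simp_all add: z_def w_def)
    define u where "u = PF_map E (tri E p q) ?R \<cdot> v"
    have u: "arr u" "src u = src d" "tgt u = PF E p (tgt q)"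
      using v vd(1) Cv pq R p q by (simp_all add: u_def)
    \<comment> \<open>The facts \<open>1\<close>, \<open>2\<close> and \<open>3\<close> are the
      incidence conditions: \<open>y\<close> lies over the base position, \<open>z\<close> over the
      value at \<open>y\<close>, and \<open>w\<close> over the value at the pair
      \<open>(y, z)\<close>.\<close>
    have 1: "PF_map E p (tgt q) \<cdot> u = p \<cdot> y"
      using PF_map_PF_tri[OF p q pq R v Cv] tri_position(1)[OF p qr(1) d vd(3)] vd(4)
      by (simp add: u_def y_def qr(2))
    have k: "PF_at E p (PF E q ?R) (?h \<cdot> v) y = tri E q r \<cdot> e"
      using tri_position(2)[OF p qr(1) d vd(3)] vd(4) by (simp add: qr(2) y_def e_def)
    have k1: "PF_map E q ?R \<cdot> tri E q r \<cdot> e = q \<cdot> z" "PF_at E q ?R (tri E q r \<cdot> e) z = r \<cdot> w"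
      using tri_position[OF q r e(1,3)] by (simp_all add: z_def w_def)
    have 2: "PF_at E p (tgt q) u y = q \<cdot> z"
      using PF_map_PF_at_PF_tri[OF p q pq R v Cv y(1,3)] y(2) vd(1) 1 k k1(1) by (simp add: u_def)
    define s where "s = tri_dir E p q u y z"
    have s: "arr s" "src s = src d" "tgt s = src (tri E p q)" "tri E p q \<cdot> s = u"
      using p q u y z 1 2 by (simp_all add: s_def)
    have 3: "PF_at E (tri E p q) ?R v s = r \<cdot> w"
      using PF_at_PF_at_PF_tri[OF p q pq R v Cv y(1,3) _ _ z(1,3)] y(2) z(2) vd(1) 1 2 k k1(2)
      by (simp add: u_def s_def)
    have T_eq: "T v d = tri_dir E (tri E p q) r v s w"
      by (simp add: T_def Let_def s_def u_def y_def z_def w_def e_def)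
    have "T v d \<cdot> f = T (v \<cdot> f) (d \<cdot> f)" if f: "arr f" "tgt f = src d" for f
    proof -
      have yf: "tri_fst E p (tri E q r) \<cdot> d \<cdot> f = y \<cdot> f" and ef: "tri_snd E p (tri E q r) \<cdot> d \<cdot> f = e \<cdot> f"
        using f d vd p qr by (simp_all add: y_def e_def)
      have zf: "tri_fst E q r \<cdot> e \<cdot> f = z \<cdot> f" and wf: "tri_snd E q r \<cdot> e \<cdot> f = w \<cdot> f"
        using f e q r by (simp_all add: z_def w_def)
      have uf: "PF_map E (tri E p q) ?R \<cdot> v \<cdot> f = u \<cdot> f"
        using f v vd(1) Cv pq R by (simp add: u_def)
      have sf: "s \<cdot> f = tri_dir E p q (u \<cdot> f) (y \<cdot> f) (z \<cdot> f)"
        using p q u y z 1 2 f by (simp add: s_def)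
      have "T v d \<cdot> f = tri_dir E (tri E p q) r (v \<cdot> f) (s \<cdot> f) (w \<cdot> f)"
        unfolding T_eq by (rule tri_dir_simps(7)) (use pq r v vd(1) Cv s w 3 f u_def in simp_all)
      then show ?thesis by (simp add: T_def Let_def yf ef zf wf uf sf)
    qed
    moreover have "arr (T v d) \<and> src (T v d) = src d \<and> tgt (T v d) = src ?s \<and> ?s \<cdot> T v d = v"
      unfolding T_eq using pq r v vd(1) Cv s w 3 by (simp add: u_def)
    ultimately show ?thesis by blast
  qed
  have t: "arr ?t" "tgt ?t = PF E p (PF E q ?R)" "arr ?s" "tgt ?s = PF E (tri E p q) ?R"
    using p qr pq r by simp_all
  show "poly_map (associator E p q r)"
    by (rule poly_map_generic(1)[OF M _ _ _ _ _ T]) (use t h in simp_all)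
  show "sh (associator E p q r) v d =
      tri_dir E (tri E p q) r v (tri_dir E p q (PF_map E (tri E p q) ?R \<cdot> v) y z) w"
    if v: "arr v" "arr d" "src v = src d" "tgt v = PF E (tri E p q) ?R"
        "tgt d = src ?t" "?h \<cdot> v = ?t \<cdot> d"
      and y: "y = tri_fst E p (tri E q r) \<cdot> d" "e = tri_snd E p (tri E q r) \<cdot> d"
      "z = tri_fst E q r \<cdot> e" "w = tri_snd E q r \<cdot> e" for v d y e z w
  proof -
    have "sh (associator E p q r) v d = T v d"
      by (rule poly_map_generic(2)[OF M _ _ _ _ _ T]) (use v t h in simp_all)
    then show ?thesis using y by (simp add: T_def Let_def)
  qed
qed

section \<open>Internal categories and cofunctors on generalized elements\<close>

lemma icomp_at_simps [simp]:
  assumes "arr (isrc D)" "arr (itgt D)" "src (itgt D) = src (isrc D)"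
    "arr (icomp D)" "src (icomp D) = pb E (itgt D) (isrc D)" "tgt (icomp D) = src (isrc D)"
    and "arr f" "arr g" "src f = src g" "tgt f = src (isrc D)"
    "tgt g = src (isrc D)" "itgt D \<cdot> f = isrc D \<cdot> g"
  shows "arr (icomp_at E D f g)" "src (icomp_at E D f g) = src g"
    "tgt (icomp_at E D f g) = src (isrc D)"
    "arr w \<Longrightarrow> tgt w = src g \<Longrightarrow> icomp_at E D f g \<cdot> w = icomp_at E D (f \<cdot> w) (g \<cdot> w)"
  using assms by (simp_all add: icomp_at_def)

lemma icomp_at_pr:
  assumes "arr (isrc D)" "arr (itgt D)" "tgt (itgt D) = tgt (isrc D)"
    "arr (icomp D)" "src (icomp D) = pb E (itgt D) (isrc D)"
  shows "icomp_at E D (pr1 E (itgt D) (isrc D)) (pr2 E (itgt D) (isrc D)) = icomp D"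
  using assms by (simp add: icomp_at_def)

lemma internal_cat_simps [simp]:
  assumes "is_internal_cat E D"
  shows "arr (isrc D)" "arr (itgt D)" "src (itgt D) = src (isrc D)" "tgt (itgt D) = tgt (isrc D)"
    "arr (iid D)" "src (iid D) = tgt (isrc D)" "tgt (iid D) = src (isrc D)"
    "arr (icomp D)" "src (icomp D) = pb E (itgt D) (isrc D)" "tgt (icomp D) = src (isrc D)"
  using assms by (simp_all add: is_internal_cat_def Let_def Hom_def)

text \<open>The axioms are stated at generic composable pairs and triples. Any composable family is
  classified by a map into the iterated pullback, and precomposing with that map yields the
  elementwise law.\<close>

lemma internal_cat_elements:
  assumes D: "is_internal_cat E D"
  shows "\<And>x. \<lbrakk>arr x; tgt x = tgt (isrc D)\<rbrakk> \<Longrightarrow> isrc D \<cdot> iid D \<cdot> x = x"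
    and "\<And>x. \<lbrakk>arr x; tgt x = tgt (isrc D)\<rbrakk> \<Longrightarrow> itgt D \<cdot> iid D \<cdot> x = x"
    and "\<And>f g. \<lbrakk>arr f; arr g; src f = src g; tgt f = src (isrc D);
      tgt g = src (isrc D); itgt D \<cdot> f = isrc D \<cdot> g\<rbrakk> \<Longrightarrow> isrc D \<cdot> icomp_at E D f g = isrc D \<cdot> f"
    and "\<And>f g. \<lbrakk>arr f; arr g; src f = src g; tgt f = src (isrc D);
      tgt g = src (isrc D); itgt D \<cdot> f = isrc D \<cdot> g\<rbrakk> \<Longrightarrow> itgt D \<cdot> icomp_at E D f g = itgt D \<cdot> g"
    and "\<And>f. \<lbrakk>arr f; tgt f = src (isrc D)\<rbrakk> \<Longrightarrow> icomp_at E D (iid D \<cdot> isrc D \<cdot> f) f = f"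
    and "\<And>f. \<lbrakk>arr f; tgt f = src (isrc D)\<rbrakk> \<Longrightarrow> icomp_at E D f (iid D \<cdot> itgt D \<cdot> f) = f"
    and "\<And>f g h. \<lbrakk>arr f; arr g; arr h; src f = src g; src g = src h;
      tgt f = src (isrc D); tgt g = src (isrc D); tgt h = src (isrc D);
      itgt D \<cdot> f = isrc D \<cdot> g; itgt D \<cdot> g = isrc D \<cdot> h\<rbrakk> \<Longrightarrow>
      icomp_at E D (icomp_at E D f g) h = icomp_at E D f (icomp_at E D g h)"
proof -
  let ?s = "isrc D" and ?t = "itgt D" and ?i = "iid D"
  let ?t2 = "?t \<cdot> pr2 E ?t ?s"
  let ?f = "pr1 E ?t ?s \<cdot> pr1 E ?t2 ?s" and ?g = "pr2 E ?t ?s \<cdot> pr1 E ?t2 ?s" and ?h = "pr2 E ?t2 ?s"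
  note simps = internal_cat_simps[OF D]
  have eqs: "?s \<cdot> ?i = Id E (tgt ?s)" "?t \<cdot> ?i = Id E (tgt ?s)"
    "?s \<cdot> icomp D = ?s \<cdot> pr1 E ?t ?s" "?t \<cdot> icomp D = ?t \<cdot> pr2 E ?t ?s"
    "icomp_at E D (?i \<cdot> ?s) (Id E (src ?s)) = Id E (src ?s)"
    "icomp_at E D (Id E (src ?s)) (?i \<cdot> ?t) = Id E (src ?s)"
    "icomp_at E D (icomp_at E D ?f ?g) ?h = icomp_at E D ?f (icomp_at E D ?g ?h)"
    using D by (simp_all add: is_internal_cat_def Let_def)
  show si: "?s \<cdot> ?i \<cdot> x = x" if "arr x" "tgt x = tgt ?s" for x
    using Comp_cong1[OF eqs(1), of x] simps that by simp
  show ti: "?t \<cdot> ?i \<cdot> x = x" if "arr x" "tgt x = tgt ?s" for x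
    using Comp_cong1[OF eqs(2), of x] simps that by simp
  show sk: "?s \<cdot> icomp_at E D f g = ?s \<cdot> f"
    if "arr f" "arr g" "src f = src g" "tgt f = src ?s"
      "tgt g = src ?s" "?t \<cdot> f = ?s \<cdot> g" for f g
  proof -
    have "?s \<cdot> icomp D \<cdot> pb_pair E ?t ?s f g = (?s \<cdot> pr1 E ?t ?s) \<cdot> pb_pair E ?t ?s f g"
      by (rule Comp_cong1[OF eqs(3)]) (use simps that in simp_all)
    then show ?thesis using simps that by (simp add: icomp_at_def)
  qed
  show tk: "?t \<cdot> icomp_at E D f g = ?t \<cdot> g"
    if "arr f" "arr g" "src f = src g" "tgt f = src ?s"
      "tgt g = src ?s" "?t \<cdot> f = ?s \<cdot> g" for f g
    using simps that Comp_cong1[OF eqs(4), of "pb_pair E ?t ?s f g"] by (simp add: icomp_at_def)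
  show "icomp_at E D (?i \<cdot> ?s \<cdot> f) f = f" if "arr f" "tgt f = src ?s" for f
    using arg_cong[OF eqs(5), of "\<lambda>g. g \<cdot> f"] simps that ti[of ?s] by simp
  show "icomp_at E D f (?i \<cdot> ?t \<cdot> f) = f" if "arr f" "tgt f = src ?s" for f
    using arg_cong[OF eqs(6), of "\<lambda>g. g \<cdot> f"] simps that si[of ?t] by simp
  show "icomp_at E D (icomp_at E D f g) h = icomp_at E D f (icomp_at E D g h)"
    if fgh: "arr f" "arr g" "arr h" "src f = src g" "src g = src h"
      "tgt f = src ?s" "tgt g = src ?s" "tgt h = src ?s"
      "?t \<cdot> f = ?s \<cdot> g" "?t \<cdot> g = ?s \<cdot> h" for f g h
  proof -
    define t2 where "t2 = ?t2"
    have t2: "arr t2" "src t2 = pb E ?t ?s" "tgt t2 = tgt ?s" using simps by (simp_all add: t2_def)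
    define F G H where "F = pr1 E ?t ?s \<cdot> pr1 E t2 ?s" and "G = pr2 E ?t ?s \<cdot> pr1 E t2 ?s" and "H = pr2 E t2 ?s"
    define w where "w = pb_pair E t2 ?s (pb_pair E ?t ?s f g) h"
    have FGH: "arr F" "arr G" "arr H" "src F = pb E t2 ?s" "src G = pb E t2 ?s"
      "src H = pb E t2 ?s" "tgt F = src ?s" "tgt G = src ?s" "tgt H = src ?s"
      using simps t2 by (simp_all add: F_def G_def H_def)
    have 1: "?t \<cdot> F = ?s \<cdot> G" "?t \<cdot> G = ?s \<cdot> H"
      using simps t2 pb_square_Comp[of ?t ?s "pr1 E t2 ?s"] pb_square[of t2 ?s]
      by (simp_all add: F_def G_def H_def t2_def)
    have fg: "t2 \<cdot> pb_pair E ?t ?s f g = ?s \<cdot> h" using simps fgh by (simp add: t2_def)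
    have w: "arr w" "src w = src h" "tgt w = pb E t2 ?s" "F \<cdot> w = f" "G \<cdot> w = g" "H \<cdot> w = h"
      using fg fgh simps t2 by (simp_all add: w_def F_def G_def H_def)
    have "icomp_at E D (icomp_at E D F G) H \<cdot> w = icomp_at E D F (icomp_at E D G H) \<cdot> w"
      using eqs(7) by (simp add: F_def G_def H_def t2_def)
    then show ?thesis
      using simps FGH 1 w sk[of G H] tk[of F G] by simp
  qed
qed

text \<open>Converse of \<open>internal_cat_elements\<close>: the elementwise laws are instantiated
  at identities and at the projections out of the pullbacks of composable pairs and triples.\<close>

lemma internal_catI:
  assumes s: "arr s" and t: "arr t" "src t = src s" "tgt t = tgt s"
    and i: "arr i" "src i = tgt s" "tgt i = src s"
    and k: "arr k" "src k = pb E t s" "tgt k = src s"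
    and D: "D = \<lparr>isrc = s, itgt = t, iid = i, icomp = k\<rparr>"
    and si: "s \<cdot> i = Id E (tgt s)" and ti: "t \<cdot> i = Id E (tgt s)"
    and sk: "\<And>f g. \<lbrakk>arr f; arr g; src f = src g; tgt f = src s; tgt g = src s;
      t \<cdot> f = s \<cdot> g\<rbrakk> \<Longrightarrow> s \<cdot> icomp_at E D f g = s \<cdot> f"
    and tk: "\<And>f g. \<lbrakk>arr f; arr g; src f = src g; tgt f = src s; tgt g = src s;
      t \<cdot> f = s \<cdot> g\<rbrakk> \<Longrightarrow> t \<cdot> icomp_at E D f g = t \<cdot> g"
    and unit_l: "\<And>f. \<lbrakk>arr f; tgt f = src s\<rbrakk> \<Longrightarrow> icomp_at E D (i \<cdot> s \<cdot> f) f = f"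
    and unit_r: "\<And>f. \<lbrakk>arr f; tgt f = src s\<rbrakk> \<Longrightarrow> icomp_at E D f (i \<cdot> t \<cdot> f) = f"
    and assoc: "\<And>f g h. \<lbrakk>arr f; arr g; arr h; src f = src g; src g = src h;
      tgt f = src s; tgt g = src s; tgt h = src s; t \<cdot> f = s \<cdot> g; t \<cdot> g = s \<cdot> h\<rbrakk> \<Longrightarrow>
      icomp_at E D (icomp_at E D f g) h = icomp_at E D f (icomp_at E D g h)"
  shows "is_internal_cat E D"
proof -
  define t2 where "t2 = t \<cdot> pr2 E t s"
  have t2: "arr t2" "src t2 = pb E t s" "tgt t2 = tgt s" using s t by (simp_all add: t2_def)
  define F G H where "F = pr1 E t s \<cdot> pr1 E t2 s" and "G = pr2 E t s \<cdot> pr1 E t2 s" and "H = pr2 E t2 s"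
  have FGH: "arr F" "arr G" "arr H" "src F = pb E t2 s" "src G = pb E t2 s"
    "src H = pb E t2 s" "tgt F = src s" "tgt G = src s" "tgt H = src s"
    using s t t2 by (simp_all add: F_def G_def H_def)
  have 1: "t \<cdot> F = s \<cdot> G" "t \<cdot> G = s \<cdot> H"
    using s t t2 pb_square_Comp[of t s "pr1 E t2 s"] pb_square[of t2 s]
    by (simp_all add: F_def G_def H_def t2_def)
  have gen: "icomp_at E D (pr1 E t s) (pr2 E t s) = k"
    using icomp_at_pr[of D] s t k by (simp add: D)
  have "s \<cdot> k = s \<cdot> pr1 E t s" "t \<cdot> k = t \<cdot> pr2 E t s"
    using sk[of "pr1 E t s" "pr2 E t s"] tk[of "pr1 E t s" "pr2 E t s"] pb_square[of t s] s t
    by (simp_all add: gen)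
  moreover have "icomp_at E D (i \<cdot> s) (Id E (src s)) = Id E (src s)"
    "icomp_at E D (Id E (src s)) (i \<cdot> t) = Id E (src s)"
    using unit_l[of "Id E (src s)"] unit_r[of "Id E (src s)"] s t by simp_all
  moreover have "icomp_at E D (icomp_at E D F G) H = icomp_at E D F (icomp_at E D G H)"
    using assoc[of F G H] FGH 1 by simp
  ultimately show ?thesis
    using s t i k si ti
    by (simp add: is_internal_cat_def Let_def Hom_def D F_def G_def H_def t2_def)
qed

section \<open>Cofunctor laws on generalized elements\<close>

lemma cofunctor_simps:
  assumes "is_cofunctor E D C \<phi>"
  shows "is_internal_cat E D" "is_internal_cat E C" "poly_map \<phi>" "pdom \<phi> = isrc D" "pcod \<phi> = isrc C"
  using assms by (simp_all add: is_cofunctor_def)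

text \<open>Again the generic laws are precomposed with classifying maps. For the composition law
  the map \<open>w\<close> classifies an object \<open>x\<close> together with composable arrows
  \<open>y\<close>, \<open>z\<close> that start at the image of \<open>x\<close>.\<close>

lemma cofunctor_elements:
  assumes \<phi>: "is_cofunctor E D C \<phi>"
  shows "\<And>x. \<lbrakk>arr x; tgt x = tgt (isrc D)\<rbrakk> \<Longrightarrow>
      sh \<phi> x (iid C \<cdot> pos \<phi> \<cdot> x) = iid D \<cdot> x"
    and "\<And>x y. \<lbrakk>arr x; arr y; src x = src y; tgt x = tgt (isrc D);
      tgt y = src (isrc C); pos \<phi> \<cdot> x = isrc C \<cdot> y\<rbrakk> \<Longrightarrow>
      pos \<phi> \<cdot> itgt D \<cdot> sh \<phi> x y = itgt C \<cdot> y"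
    and "\<And>x y z. \<lbrakk>arr x; arr y; arr z; src x = src y; src y = src z;
      tgt x = tgt (isrc D); tgt y = src (isrc C); tgt z = src (isrc C);
      pos \<phi> \<cdot> x = isrc C \<cdot> y; itgt C \<cdot> y = isrc C \<cdot> z\<rbrakk> \<Longrightarrow>
      sh \<phi> x (icomp_at E C y z) =
        icomp_at E D (sh \<phi> x y) (sh \<phi> (itgt D \<cdot> sh \<phi> x y) z)"
proof -
  note S = cofunctor_simps[OF \<phi>]
  note D = internal_cat_simps[OF S(1)] and C = internal_cat_simps[OF S(2)]
  note P = poly_mapD[OF S(3), unfolded S(4,5)]
  note CE = internal_cat_elements[OF S(2)]
  let ?h = "pos \<phi>" and ?s = "isrc C"
  define tc where "tc = itgt C \<cdot> pr2 E ?h ?s"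
  have tc: "arr tc" "src tc = pb E ?h ?s" "tgt tc = tgt ?s"
    using C P by (simp_all add: tc_def)
  define X Y Z where "X = pr1 E ?h ?s \<cdot> pr1 E tc ?s" and "Y = pr2 E ?h ?s \<cdot> pr1 E tc ?s" and "Z = pr2 E tc ?s"
  have eqs: "sh \<phi> (Id E (tgt (isrc D))) (iid C \<cdot> ?h) = iid D"
    "?h \<cdot> itgt D \<cdot> sharp \<phi> = tc"
    "sh \<phi> X (icomp_at E C Y Z) =
      icomp_at E D (sh \<phi> X Y) (sh \<phi> (itgt D \<cdot> sh \<phi> X Y) Z)"
    using \<phi> by (simp_all add: is_cofunctor_def Let_def tc_def X_def Y_def Z_def)
  show "sh \<phi> x (iid C \<cdot> ?h \<cdot> x) = iid D \<cdot> x" if "arr x" "tgt x = tgt (isrc D)" for x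
    using arg_cong[OF eqs(1), of "\<lambda>f. f \<cdot> x"] that S C D P CE(1)[of ?h] by simp
  show t: "?h \<cdot> itgt D \<cdot> sh \<phi> x y = itgt C \<cdot> y"
    if "arr x" "arr y" "src x = src y" "tgt x = tgt (isrc D)"
      "tgt y = src ?s" "?h \<cdot> x = ?s \<cdot> y" for x y
    using arg_cong[OF eqs(2), of "\<lambda>f. f \<cdot> pb_pair E ?h ?s x y"] that S C D P
    by (simp add: sharp_at_def tc_def)
  show "sh \<phi> x (icomp_at E C y z) =
        icomp_at E D (sh \<phi> x y) (sh \<phi> (itgt D \<cdot> sh \<phi> x y) z)"
    if xyz: "arr x" "arr y" "arr z" "src x = src y" "src y = src z"
      "tgt x = tgt (isrc D)" "tgt y = src ?s" "tgt z = src ?s"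
      "?h \<cdot> x = ?s \<cdot> y" "itgt C \<cdot> y = ?s \<cdot> z" for x y z
  proof -
    have XYZ: "arr X" "arr Y" "arr Z" "src X = pb E tc ?s" "src Y = pb E tc ?s"
      "src Z = pb E tc ?s" "tgt X = tgt (isrc D)" "tgt Y = src ?s" "tgt Z = src ?s"
      using C P tc by (simp_all add: X_def Y_def Z_def)
    have 1: "?h \<cdot> X = ?s \<cdot> Y" "itgt C \<cdot> Y = ?s \<cdot> Z"
      using C P tc pb_square_Comp[of ?h ?s "pr1 E tc ?s"] pb_square[of tc ?s]
      by (simp_all add: X_def Y_def Z_def tc_def)
    have xy: "tc \<cdot> pb_pair E ?h ?s x y = ?s \<cdot> z" using C P xyz by (simp add: tc_def)
    define w where "w = pb_pair E tc ?s (pb_pair E ?h ?s x y) z"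
    have w: "arr w" "src w = src z" "tgt w = pb E tc ?s" "X \<cdot> w = x" "Y \<cdot> w = y" "Z \<cdot> w = z"
      using xy xyz C P tc by (simp_all add: w_def X_def Y_def Z_def)
    have a: "arr (sh \<phi> X Y)" "src (sh \<phi> X Y) = pb E tc ?s"
      "tgt (sh \<phi> X Y) = src (isrc D)"
      "sh \<phi> X Y \<cdot> w = sh \<phi> x y"
      using S C D P XYZ 1 w by simp_all
    have ta: "?h \<cdot> itgt D \<cdot> sh \<phi> X Y = ?s \<cdot> Z" using t[of X Y] XYZ 1 by simp
    define b where "b = itgt D \<cdot> sh \<phi> X Y"
    have b: "arr b" "src b = pb E tc ?s" "tgt b = tgt (isrc D)" "?h \<cdot> b = ?s \<cdot> Z"
      "b \<cdot> w = itgt D \<cdot> sh \<phi> x y"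
      using a D ta w by (simp_all add: b_def)
    have c: "arr (sh \<phi> b Z)" "src (sh \<phi> b Z) = pb E tc ?s"
      "tgt (sh \<phi> b Z) = src (isrc D)" "isrc D \<cdot> sh \<phi> b Z = b"
      "sh \<phi> b Z \<cdot> w = sh \<phi> (itgt D \<cdot> sh \<phi> x y) z"
      using S C D P XYZ b w by simp_all
    have "icomp_at E D (sh \<phi> X Y) (sh \<phi> b Z) \<cdot> w =
        icomp_at E D (sh \<phi> x y) (sh \<phi> (itgt D \<cdot> sh \<phi> x y) z)"
      using a b_def c D w by simp
    moreover have "sh \<phi> X (icomp_at E C Y Z) \<cdot> w = sh \<phi> x (icomp_at E C y z)"
      using S C D P XYZ w 1 CE(3)[of Y Z] by simp
    ultimately show ?thesis using eqs(3) by (simp add: b_def)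
  qed
qed

lemma cofunctorI:
  assumes D: "is_internal_cat E D" and C: "is_internal_cat E C"
    and \<phi>: "poly_map \<phi>" "pdom \<phi> = isrc D" "pcod \<phi> = isrc C"
    and i: "\<And>x. \<lbrakk>arr x; tgt x = tgt (isrc D)\<rbrakk> \<Longrightarrow>
      sh \<phi> x (iid C \<cdot> pos \<phi> \<cdot> x) = iid D \<cdot> x"
    and t: "\<And>x y. \<lbrakk>arr x; arr y; src x = src y; tgt x = tgt (isrc D);
      tgt y = src (isrc C); pos \<phi> \<cdot> x = isrc C \<cdot> y\<rbrakk> \<Longrightarrow>
      pos \<phi> \<cdot> itgt D \<cdot> sh \<phi> x y = itgt C \<cdot> y"
    and k: "\<And>x y z. \<lbrakk>arr x; arr y; arr z; src x = src y; src y = src z;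
      tgt x = tgt (isrc D); tgt y = src (isrc C); tgt z = src (isrc C);
      pos \<phi> \<cdot> x = isrc C \<cdot> y; itgt C \<cdot> y = isrc C \<cdot> z\<rbrakk> \<Longrightarrow>
      sh \<phi> x (icomp_at E C y z) =
        icomp_at E D (sh \<phi> x y) (sh \<phi> (itgt D \<cdot> sh \<phi> x y) z)"
  shows "is_cofunctor E D C \<phi>"
proof -
  let ?h = "pos \<phi>" and ?s = "isrc C"
  note D' = internal_cat_simps[OF D] and C' = internal_cat_simps[OF C]
  note P = poly_mapD[OF \<phi>(1), unfolded \<phi>(2,3)]
  define tc where "tc = itgt C \<cdot> pr2 E ?h ?s"
  have tc: "arr tc" "src tc = pb E ?h ?s" "tgt tc = tgt ?s"
    using C' P by (simp_all add: tc_def)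
  define X Y Z where "X = pr1 E ?h ?s \<cdot> pr1 E tc ?s" and "Y = pr2 E ?h ?s \<cdot> pr1 E tc ?s" and "Z = pr2 E tc ?s"
  have XYZ: "arr X" "arr Y" "arr Z" "src X = pb E tc ?s" "src Y = pb E tc ?s"
    "src Z = pb E tc ?s" "tgt X = tgt (isrc D)" "tgt Y = src ?s" "tgt Z = src ?s"
    using C' P tc by (simp_all add: X_def Y_def Z_def)
  have 1: "?h \<cdot> X = ?s \<cdot> Y" "itgt C \<cdot> Y = ?s \<cdot> Z"
    using C' P tc pb_square_Comp[of ?h ?s "pr1 E tc ?s"] pb_square[of tc ?s]
    by (simp_all add: X_def Y_def Z_def tc_def)
  have "sh \<phi> (Id E (tgt (isrc D))) (iid C \<cdot> ?h) = iid D"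
    using i[of "Id E (tgt (isrc D))"] D' P by simp
  moreover have "?h \<cdot> itgt D \<cdot> sharp \<phi> = tc"
    using \<phi> P C' D' pb_square[of ?h ?s] sharp_at_pr[OF \<phi>(1)] t[of "pr1 E ?h ?s" "pr2 E ?h ?s"]
    by (simp add: tc_def)
  moreover have "sh \<phi> X (icomp_at E C Y Z) =
      icomp_at E D (sh \<phi> X Y) (sh \<phi> (itgt D \<cdot> sh \<phi> X Y) Z)"
    using k[of X Y Z] XYZ 1 by simp
  ultimately show ?thesis
    using assms(1-5) by (simp add: is_cofunctor_def Let_def tc_def X_def Y_def Z_def)
qed

section \<open>Cofunctors and copresheaves\<close>

lemma poly_comp_id_right [simp]:
  assumes "poly_map \<phi>" "pdom \<phi> = p"
  shows "poly_comp E \<phi> (poly_id E p) = \<phi>"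
proof -
  have "arr p" using assms by auto
  then show ?thesis
    by (intro poly_map_ext) (use assms in simp_all)
qed

lemma poly_comp_id_left [simp]:
  assumes "poly_map \<phi>" "pcod \<phi> = q"
  shows "poly_comp E (poly_id E q) \<phi> = \<phi>"
proof -
  have "arr q" using assms by auto
  then show ?thesis
    by (intro poly_map_ext) (use assms in simp_all)
qed

lemma poly_comp_assoc:
  assumes "poly_map \<phi>" "poly_map \<psi>" "poly_map \<chi>" "pcod \<phi> = pdom \<psi>" "pcod \<psi> = pdom \<chi>"
  shows "poly_comp E (poly_comp E \<chi> \<psi>) \<phi> = poly_comp E \<chi> (poly_comp E \<psi> \<phi>)"
  by (rule poly_map_ext) (use assms in simp_all)

lemma cofunctor_id:
  assumes D: "is_internal_cat E D"
  shows "is_cofunctor E D D (poly_id E (isrc D))"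
  by (rule cofunctorI)
    (use D in \<open>simp_all add: internal_cat_elements\<close>)

text \<open>Lifting along the composite is lifting twice: \<open>Y\<close> lifts \<open>y\<close> to
  the middle category and \<open>X\<close> lifts \<open>Y\<close> to \<open>D\<close>. Since the
  target of \<open>X\<close> lies over the target of \<open>Y\<close>, the second factor of a
  composite arrow is again lifted in two steps.\<close>

lemma cofunctor_comp:
  assumes \<phi>: "is_cofunctor E D D' \<phi>" and \<psi>: "is_cofunctor E D' D'' \<psi>"
  shows "is_cofunctor E D D'' (poly_comp E \<psi> \<phi>)"
proof -
  note S = cofunctor_simps[OF \<phi>] and S' = cofunctor_simps[OF \<psi>]
  note P = poly_mapD[OF S(3), unfolded S(4,5)] and P' = poly_mapD[OF S'(3), unfolded S'(4,5)]
  show ?thesis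
  proof (rule cofunctorI)
    show "is_internal_cat E D" "is_internal_cat E D''" "poly_map (poly_comp E \<psi> \<phi>)"
      "pdom (poly_comp E \<psi> \<phi>) = isrc D" "pcod (poly_comp E \<psi> \<phi>) = isrc D''"
      using S S' by simp_all
    show "sh (poly_comp E \<psi> \<phi>) x (iid D'' \<cdot> pos (poly_comp E \<psi> \<phi>) \<cdot> x) = iid D \<cdot> x"
      if x: "arr x" "tgt x = tgt (isrc D)" for x
      using S S' P P' x internal_cat_elements(1)[OF S'(2), of "pos \<psi> \<cdot> pos \<phi> \<cdot> x"]
        cofunctor_elements(1)[OF \<phi>, of x] cofunctor_elements(1)[OF \<psi>, of "pos \<phi> \<cdot> x"]
      by simp
    fix x y
    assume xy: "arr x" "arr y" "src x = src y" "tgt x = tgt (isrc D)"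
      "tgt y = src (isrc D'')" "pos (poly_comp E \<psi> \<phi>) \<cdot> x = isrc D'' \<cdot> y"
    define Y where "Y = sh \<psi> (pos \<phi> \<cdot> x) y"
    have \<psi>\<phi>x: "pos \<psi> \<cdot> pos \<phi> \<cdot> x = isrc D'' \<cdot> y" using xy P P' S S' by simp
    have Y: "arr Y" "src Y = src y" "tgt Y = src (isrc D')" "isrc D' \<cdot> Y = pos \<phi> \<cdot> x"
      unfolding Y_def using xy P P' S S' \<psi>\<phi>x by simp_all
    define X where "X = sh \<phi> x Y"
    have X: "arr X" "src X = src y" "tgt X = src (isrc D)" "isrc D \<cdot> X = x"
      unfolding X_def using xy(1-5) Y S P by (simp_all)
    have sh: "sh (poly_comp E \<psi> \<phi>) x y = X"
      using xy S S' P P' \<psi>\<phi>x by (simp add: X_def Y_def)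
    have tX: "pos \<phi> \<cdot> itgt D \<cdot> X = itgt D' \<cdot> Y"
      unfolding X_def using cofunctor_elements(2)[OF \<phi>, of x Y] xy Y by simp
    have tY: "pos \<psi> \<cdot> itgt D' \<cdot> Y = itgt D'' \<cdot> y"
      unfolding Y_def by (rule cofunctor_elements(2)[OF \<psi>]) (use xy \<psi>\<phi>x P S S' in simp_all)
    show "pos (poly_comp E \<psi> \<phi>) \<cdot> itgt D \<cdot> sh (poly_comp E \<psi> \<phi>) x y = itgt D'' \<cdot> y"
      unfolding sh using tX tY X Y P P' S S' by simp
    fix z
    assume z: "arr z" "src y = src z" "tgt z = src (isrc D'')" "itgt D'' \<cdot> y = isrc D'' \<cdot> z"
    define t where "t = itgt D \<cdot> X"
    have t: "arr t" "src t = src y" "tgt t = tgt (isrc D)" "pos \<phi> \<cdot> t = itgt D' \<cdot> Y"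
      using X S tX by (simp_all add: t_def)
    define Z where "Z = sh \<psi> (itgt D' \<cdot> Y) z"
    have Z: "arr Z" "src Z = src y" "tgt Z = src (isrc D')" "isrc D' \<cdot> Z = itgt D' \<cdot> Y"
      unfolding Z_def using z tY Y S S' by simp_all
    have "sh \<psi> (pos \<phi> \<cdot> x) (icomp_at E D'' y z) = icomp_at E D' Y Z"
      unfolding Y_def Z_def
      by (rule cofunctor_elements(3)[OF \<psi>]) (use xy z \<psi>\<phi>x P S S' in simp_all)
    moreover have "sh \<phi> x (icomp_at E D' Y Z) = icomp_at E D X (sh \<phi> t Z)"
      unfolding X_def t_def
      by (rule cofunctor_elements(3)[OF \<phi>]) (use xy Y Z in simp_all)
    moreover have "sh (poly_comp E \<psi> \<phi>) x (icomp_at E D'' y z) =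
        sh \<phi> x (sh \<psi> (pos \<phi> \<cdot> x) (icomp_at E D'' y z))"
      by (rule sharp_at_poly_comp)
        (use xy z \<psi>\<phi>x P P' S S' internal_cat_elements(3)[OF S'(2), of y z] in simp_all)
    moreover have "sh (poly_comp E \<psi> \<phi>) t z = sh \<phi> t Z"
    proof -
      have "sh (poly_comp E \<psi> \<phi>) t z = sh \<phi> t (sh \<psi> (pos \<phi> \<cdot> t) z)"
        by (rule sharp_at_poly_comp) (use t tY z P P' S S' in simp_all)
      then show ?thesis by (simp only: t(4) Z_def)
    qed
    ultimately show "sh (poly_comp E \<psi> \<phi>) x (icomp_at E D'' y z) =
        icomp_at E D (sh (poly_comp E \<psi> \<phi>) x y)
          (sh (poly_comp E \<psi> \<phi>) (itgt D \<cdot> sh (poly_comp E \<psi> \<phi>) x y) z)"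
      unfolding sh t_def[symmetric] by simp
  qed
qed

text \<open>An invertible sharp map identifies the directions of \<open>p\<close> with the pullback
  of \<open>q\<close> along \<open>pos \<phi>\<close>; \<open>l\<close> is the second projection of
  its inverse. So each direction \<open>e\<close> is the lift of \<open>l \<cdot> e\<close> at
  \<open>p \<cdot> e\<close>, and \<open>l\<close> recovers what was lifted.\<close>

lemma cartesian_lift:
  assumes "cartesian E \<phi>" "pdom \<phi> = p" "pcod \<phi> = q"
  obtains l where "arr l" "src l = src p" "tgt l = src q"
    and "\<And>e. \<lbrakk>arr e; tgt e = src p\<rbrakk> \<Longrightarrow> pos \<phi> \<cdot> p \<cdot> e = q \<cdot> l \<cdot> e"
    and "\<And>e. \<lbrakk>arr e; tgt e = src p\<rbrakk> \<Longrightarrow> sh \<phi> (p \<cdot> e) (l \<cdot> e) = e"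
    and "\<And>x z. \<lbrakk>arr x; arr z; src x = src z; tgt x = tgt p;
      tgt z = src q; pos \<phi> \<cdot> x = q \<cdot> z\<rbrakk> \<Longrightarrow> l \<cdot> sh \<phi> x z = z"
proof -
  have \<phi>: "poly_map \<phi>" using assms by (simp add: cartesian_def)
  note P = poly_mapD[OF \<phi>, unfolded assms(2,3)]
  let ?h = "pos \<phi>" and ?s = "sharp \<phi>"
  obtain j where j: "arr j" "src j = src p" "tgt j = pb E ?h q"
    and sj: "j \<cdot> ?s = Id E (pb E ?h q)" "?s \<cdot> j = Id E (src p)"
    using assms(1) P unfolding cartesian_def is_iso_def by (auto simp: Hom_def)
  have pj: "pr1 E ?h q \<cdot> j = p"
    using Comp_cong1[OF P(9), of j] j P sj(2) by simp
  define l where "l = pr2 E ?h q \<cdot> j"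
  have l: "arr l" "src l = src p" "tgt l = src q"
    using j P by (simp_all add: l_def)
  have hp: "?h \<cdot> p = q \<cdot> l"
    using pb_square_Comp[of ?h q j] j P pj by (simp add: l_def)
  have 1: "?h \<cdot> p \<cdot> e = q \<cdot> l \<cdot> e" if "arr e" "tgt e = src p" for e
    using Comp_cong1[OF hp, of e] that l P by simp
  have 2: "sh \<phi> (p \<cdot> e) (l \<cdot> e) = e" if e: "arr e" "tgt e = src p" for e
  proof -
    have "p \<cdot> e = pr1 E ?h q \<cdot> j \<cdot> e" "l \<cdot> e = pr2 E ?h q \<cdot> j \<cdot> e"
      using Comp_cong1[OF pj, of e] e j P by (simp_all add: l_def)
    then have "pb_pair E ?h q (p \<cdot> e) (l \<cdot> e) = j \<cdot> e"
      using pb_pair_eta[of ?h q "j \<cdot> e"] e j P by simp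
    then show ?thesis
      using Comp_cong1[OF sj(2), of e] e j P by (simp add: sharp_at_def assms)
  qed
  have 3: "l \<cdot> sh \<phi> x z = z"
    if xz: "arr x" "arr z" "src x = src z" "tgt x = tgt p"
      "tgt z = src q" "?h \<cdot> x = q \<cdot> z" for x z
  proof -
    have "j \<cdot> ?s \<cdot> pb_pair E ?h q x z = Id E (pb E ?h q) \<cdot> pb_pair E ?h q x z"
      by (rule Comp_cong1[OF sj(1)]) (use xz P j in simp_all)
    then show ?thesis using xz P j by (simp add: sharp_at_def assms l_def)
  qed
  show ?thesis using that[OF l 1 2 3] .
qed

end

section \<open>The internal category of a comonoid\<close>

locale comonoid = finitely_complete_category E for E :: "('o, 'm) category" (structure) +
  fixes c :: 'm and \<epsilon> \<delta> :: "'m poly_map"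
  assumes comonoid: "is_comonoid E c \<epsilon> \<delta>"
begin

abbreviation "C \<equiv> tgt c"
abbreviation "\<delta>1 \<equiv> pos \<delta>"
abbreviation "cc \<equiv> tri E c c"
abbreviation "y \<equiv> y_poly E"
abbreviation "CC \<equiv> comonoid_cat E c \<epsilon> \<delta>"
abbreviation "t \<equiv> itgt CC"
abbreviation "i \<equiv> iid CC"
abbreviation "k \<equiv> icomp_at E CC"

section \<open>Source, target, identities and composition of the category of a comonoid\<close>

lemma comonoid_simps [simp]:
  "exponentiable E c" "exponentiable E y" "exponentiable E cc"
  "poly_map \<epsilon>" "pdom \<epsilon> = c" "pcod \<epsilon> = y" "poly_map \<delta>" "pdom \<delta> = c" "pcod \<delta> = cc"
  using comonoid by (auto simp: is_comonoid_def Poly_def Hom_def)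

lemma comonoid_eqs:
  "poly_comp E (unitor_l E c) (poly_comp E (tri_map E \<epsilon> (poly_id E c)) \<delta>) = poly_id E c"
  "poly_comp E (unitor_r E c) (poly_comp E (tri_map E (poly_id E c) \<epsilon>) \<delta>) = poly_id E c"
  "poly_comp E (associator E c c c) (poly_comp E (tri_map E \<delta> (poly_id E c)) \<delta>) =
    poly_comp E (tri_map E (poly_id E c) \<delta>) \<delta>"
  using comonoid by (auto simp: is_comonoid_def Poly_def)

lemma c_Arr [simp]: "arr c" and C_Obj [simp]: "obj C"
  by simp_all

lemma pos_simps [simp]:
  "arr \<delta>1" "src \<delta>1 = C" "tgt \<delta>1 = PF E c C" "arr (pos \<epsilon>)" "src (pos \<epsilon>) = C" "tgt (pos \<epsilon>) = one E"
  using poly_mapD[of \<delta>] poly_mapD[of \<epsilon>] by simp_all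

text \<open>The four products of morphisms that occur in the comonoid equations, simplified with the
  typing of the comonoid.\<close>

lemmas tri_map_\<epsilon>_id = tri_map[of \<epsilon> c y "poly_id E c" c c, simplified]
  and tri_map_id_\<epsilon> = tri_map[of "poly_id E c" c c \<epsilon> c y, simplified]
  and tri_map_\<delta>_id = tri_map[of \<delta> c cc "poly_id E c" c c, simplified]
  and tri_map_id_\<delta> = tri_map[of "poly_id E c" c c \<delta> c cc, simplified]

text \<open>The right counit law on positions: discarding the values of
  \<open>\<delta>1 \<cdot> x\<close> must give back \<open>x\<close>. This is the first component of
  \<open>\<delta>\<^sub>1 = (id, t)\<close>.\<close>

lemma PF_map_\<delta> [simp]:
  assumes x: "arr x" "tgt x = C"
  shows "PF_map E c C \<cdot> \<delta>1 \<cdot> x = x"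
proof -
  let ?h = "pos (tri_map E (poly_id E c) \<epsilon>)"
  have h: "arr ?h" "src ?h = PF E c C" "tgt ?h = PF E c (one E)"
    using tri_map_id_\<epsilon> by simp_all
  have "PF_map E c (one E) \<cdot> ?h \<cdot> \<delta>1 = Id E C"
    using arg_cong[OF comonoid_eqs(2), of pos] by simp
  from Comp_cong1[OF this, of x] have "PF_map E c (one E) \<cdot> ?h \<cdot> \<delta>1 \<cdot> x = x"
    using x h by simp
  moreover have "PF_map E c (one E) \<cdot> ?h \<cdot> \<delta>1 \<cdot> x = Id E C \<cdot> PF_map E c C \<cdot> \<delta>1 \<cdot> x"
    using x tri_map_id_\<epsilon>(6)[of "\<delta>1 \<cdot> x"] by simp
  ultimately show ?thesis using x by simp
qed

lemma isrc_CC [simp]: "isrc CC = c"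
  by (simp add: comonoid_cat_def Let_def)

lemma t_simps [simp]: "arr t" "src t = src c" "tgt t = C"
  by (simp_all add: comonoid_cat_def Let_def)

text \<open>The second component of \<open>\<delta>\<^sub>1 = (id, t)\<close>, which is how
  \<open>t\<close> is defined. The separate variable \<open>x\<close> keeps the rule applicable when
  \<open>c \<cdot> f\<close> appears in another form.\<close>

lemma PF_at_\<delta>:
  assumes "arr f" "tgt f = src c" "x = c \<cdot> f"
  shows "PF_at E c C (\<delta>1 \<cdot> x) f = t \<cdot> f"
  using assms by (simp add: comonoid_cat_def Let_def)

lemma pos_\<epsilon> [simp]: "arr x \<Longrightarrow> tgt x = C \<Longrightarrow> pos \<epsilon> \<cdot> x = bang E (src x)"
  by (rule one_ext) simp_all

lemma pos_\<epsilon>_eq: "pos \<epsilon> = bang E C"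
  by (rule one_ext) simp_all

lemma i_simps [simp]: "arr i" "src i = C" "tgt i = src c" "c \<cdot> i = Id E C"
  by (simp_all add: comonoid_cat_def Let_def pos_\<epsilon>_eq)

lemma c_i [simp]: "arr x \<Longrightarrow> tgt x = C \<Longrightarrow> c \<cdot> i \<cdot> x = x"
  using Comp_cong1[OF i_simps(4), of x] by simp

lemma sharp_at_\<epsilon>:
  assumes "arr x" "tgt x = C" "arr z" "src z = src x" "tgt z = one E"
  shows "sh \<epsilon> x z = i \<cdot> x"
proof -
  have "z = bang E (src x)" by (rule one_ext) (use assms in simp_all)
  then show ?thesis using assms by (simp add: comonoid_cat_def Let_def pos_\<epsilon>_eq)
qed

text \<open>The left counit law on positions: evaluating \<open>\<delta>1 \<cdot> x\<close> at the
  direction selected by the counit, which is \<open>i \<cdot> x\<close>, returns \<open>x\<close>;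
  by \<open>PF_at_\<delta>\<close> this value is the target of \<open>i \<cdot> x\<close>.\<close>

lemma t_i [simp]:
  assumes x: "arr x" "tgt x = C"
  shows "t \<cdot> i \<cdot> x = x"
proof -
  let ?h = "pos (tri_map E \<epsilon> (poly_id E c))"
  have h: "arr ?h" "src ?h = PF E c C" "tgt ?h = PF E y C"
    using tri_map_\<epsilon>_id by simp_all
  let ?b = "bang E (src x)"
  have "pos (unitor_l E c) \<cdot> ?h \<cdot> \<delta>1 \<cdot> x = x"
  proof -
    have 1: "pos (unitor_l E c) \<cdot> ?h \<cdot> \<delta>1 = Id E C"
      using arg_cong[OF comonoid_eqs(1), of pos] by simp
    have "arr (pos (unitor_l E c))" "src (pos (unitor_l E c)) = PF E y C"
      using poly_mapD[of "unitor_l E c"] by simp_all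
    then show ?thesis using x h Comp_cong1[OF 1, of x] by simp
  qed
  then have "PF_at E y C (?h \<cdot> \<delta>1 \<cdot> x) ?b = x"
    using unitor_l_pos[of c "?h \<cdot> \<delta>1 \<cdot> x"] x h by simp
  moreover have "PF_at E y C (?h \<cdot> \<delta>1 \<cdot> x) ?b = Id E C \<cdot> PF_at E c C (\<delta>1 \<cdot> x) (sh \<epsilon> x ?b)"
    using tri_map_\<epsilon>_id(7)[of "\<delta>1 \<cdot> x" ?b] x by simp
  ultimately show ?thesis
    using x by (simp add: sharp_at_\<epsilon> PF_at_\<delta>)
qed

text \<open>Composition at arbitrary elements, the form in which the comonoid laws deliver it;
  \<open>k_eq\<close> identifies it with \<open>k\<close>, which goes through the generic composable
  pair.\<close>

definition \<delta>_at where "\<delta>_at f g = sh \<delta> (c \<cdot> f) (tri_dir E c c (\<delta>1 \<cdot> c \<cdot> f) f g)"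

lemma \<delta>_at_simps [simp]:
  assumes "arr f" "arr g" "src f = src g" "tgt f = src c" "tgt g = src c"
    "t \<cdot> f = c \<cdot> g"
  shows "arr (\<delta>_at f g)" "src (\<delta>_at f g) = src g" "tgt (\<delta>_at f g) = src c"
    "c \<cdot> \<delta>_at f g = c \<cdot> f"
    "arr w \<Longrightarrow> tgt w = src g \<Longrightarrow> \<delta>_at f g \<cdot> w = \<delta>_at (f \<cdot> w) (g \<cdot> w)"
  using assms by (simp_all add: \<delta>_at_def PF_at_\<delta>)

lemma CC_eq: "CC = \<lparr>isrc = c, itgt = t, iid = i, icomp = \<delta>_at (pr1 E t c) (pr2 E t c)\<rparr>"
  by (simp add: comonoid_cat_def Let_def \<delta>_at_def)

lemma icomp_CC_simps: "arr (icomp CC)" "src (icomp CC) = pb E t c" "tgt (icomp CC) = src c"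
proof -
  have "t \<cdot> pr1 E t c = c \<cdot> pr2 E t c" by (rule pb_square) simp_all
  then show "arr (icomp CC)" "src (icomp CC) = pb E t c" "tgt (icomp CC) = src c"
    by (subst CC_eq, simp)+
qed

lemma k_eq:
  assumes "arr f" "arr g" "src f = src g" "tgt f = src c" "tgt g = src c"
    "t \<cdot> f = c \<cdot> g"
  shows "k f g = \<delta>_at f g"
proof -
  have 1: "t \<cdot> pr1 E t c = c \<cdot> pr2 E t c" by (rule pb_square) simp_all
  have "icomp CC = \<delta>_at (pr1 E t c) (pr2 E t c)"
    by (subst CC_eq) simp
  then show ?thesis using assms 1 by (simp add: icomp_at_def)
qed

text \<open>The left counit law on directions, traced backwards from \<open>f\<close>: the unitor
  sends \<open>f\<close> to the pair of the unique direction and \<open>f\<close>, the counit turns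
  the former into the identity at \<open>c \<cdot> f\<close>, and the sharp map of
  \<open>\<delta>\<close> composes the resulting pair.\<close>

lemma \<delta>_at_unit_l:
  assumes f: "arr f" "tgt f = src c"
  shows "\<delta>_at (i \<cdot> c \<cdot> f) f = f"
proof -
  let ?x = "c \<cdot> f"
  let ?b = "bang E (src f)"
  let ?m = "tri_map E \<epsilon> (poly_id E c)"
  let ?h = "pos ?m"
  let ?u = "?h \<cdot> \<delta>1 \<cdot> ?x"
  have h: "arr ?h" "src ?h = PF E c C" "tgt ?h = PF E y C" and m: "poly_map ?m"
    "pdom ?m = cc" "pcod ?m = tri E y c"
    using tri_map_\<epsilon>_id by simp_all
  have u: "arr ?u" "src ?u = src f" "tgt ?u = PF E y C" using h f by simp_all
  have at: "PF_at E y C ?u ?b = c \<cdot> f"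
    using tri_map_\<epsilon>_id(7)[of "\<delta>1 \<cdot> ?x" ?b] f by (simp add: sharp_at_\<epsilon> PF_at_\<delta>)
  have lu: "pos (unitor_l E c) \<cdot> ?u = c \<cdot> f"
    using unitor_l_pos[of c ?u] u at by simp
  define d where "d = tri_dir E y c ?u ?b f"
  have PFu: "PF_map E y C \<cdot> ?u = ?b" by (rule one_ext) (use u f in simp_all)
  have d: "arr d" "src d = src f" "tgt d = src (tri E y c)" "tri E y c \<cdot> d = ?u"
    "tri_fst E y c \<cdot> d = ?b" "tri_snd E y c \<cdot> d = f"
    unfolding d_def using u f at PFu by (simp_all del: bang_Comp)
  have 1: "sh (unitor_l E c) ?u f = d"
    unfolding d_def by (rule sharp_at_unitor_l) (use u f lu in simp_all)
  have e: "sh ?m (\<delta>1 \<cdot> ?x) d = tri_dir E c c (\<delta>1 \<cdot> ?x) (i \<cdot> ?x) f"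
    using tri_map_\<epsilon>_id(9)[of "\<delta>1 \<cdot> ?x" d "i \<cdot> ?x"] f d by (simp add: sharp_at_\<epsilon> PF_at_\<delta>)
  have "f = sh (poly_comp E (unitor_l E c) (poly_comp E ?m \<delta>)) ?x f"
    unfolding comonoid_eqs(1) using f by simp
  also have "\<dots> = sh \<delta> ?x (sh ?m (\<delta>1 \<cdot> ?x) (sh (unitor_l E c) ?u f))"
  proof -
    have p: "poly_map (poly_comp E ?m \<delta>)" using m by simp
    have "sh (poly_comp E (unitor_l E c) (poly_comp E ?m \<delta>)) ?x f =
        sh (poly_comp E ?m \<delta>) ?x (sh (unitor_l E c) (pos (poly_comp E ?m \<delta>) \<cdot> ?x) f)"
      by (rule sharp_at_poly_comp) (use f m h lu p in simp_all)
    also have "\<dots> = sh (poly_comp E ?m \<delta>) ?x d"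
      using f h 1 by simp
    also have "\<dots> = sh \<delta> ?x (sh ?m (\<delta>1 \<cdot> ?x) d)"
      by (rule sharp_at_poly_comp) (use f m h d in simp_all)
    finally show ?thesis using 1 by simp
  qed
  finally show ?thesis using f by (simp add: 1 e \<delta>_at_def)
qed

text \<open>The right counit law on directions. Here the unique direction is the second entry, and
  the counit acts at the value of \<open>\<delta>1 \<cdot> c \<cdot> f\<close> at \<open>f\<close>,
  so the identity inserted is the one at \<open>t \<cdot> f\<close>.\<close>

lemma \<delta>_at_unit_r:
  assumes f: "arr f" "tgt f = src c"
  shows "\<delta>_at f (i \<cdot> t \<cdot> f) = f"
proof -
  let ?x = "c \<cdot> f"
  let ?b = "bang E (src f)"
  let ?m = "tri_map E (poly_id E c) \<epsilon>"
  let ?h = "pos ?m"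
  let ?u = "?h \<cdot> \<delta>1 \<cdot> ?x"
  have h: "arr ?h" "src ?h = PF E c C" "tgt ?h = PF E c (one E)" and m: "poly_map ?m"
    "pdom ?m = cc" "pcod ?m = tri E c y"
    using tri_map_id_\<epsilon> by simp_all
  have u: "arr ?u" "src ?u = src f" "tgt ?u = PF E c (one E)" using h f by simp_all
  have PFu: "PF_map E c (one E) \<cdot> ?u = ?x"
    using tri_map_id_\<epsilon>(6)[of "\<delta>1 \<cdot> ?x"] f by simp
  have at: "PF_at E c (one E) ?u f = ?b"
    by (rule one_ext) (use u f PFu in simp_all)
  define d where "d = tri_dir E c y ?u f ?b"
  have d: "arr d" "src d = src f" "tgt d = src (tri E c y)" "tri E c y \<cdot> d = ?u"
    "tri_fst E c y \<cdot> d = f" "tri_snd E c y \<cdot> d = ?b"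
    unfolding d_def using u f at PFu by (simp_all del: bang_Comp)
  have 1: "sh (unitor_r E c) ?u f = d"
    unfolding d_def by (rule sharp_at_unitor_r) (use u f PFu in simp_all)
  have e: "sh ?m (\<delta>1 \<cdot> ?x) d = tri_dir E c c (\<delta>1 \<cdot> ?x) f (i \<cdot> t \<cdot> f)"
    using tri_map_id_\<epsilon>(9)[of "\<delta>1 \<cdot> ?x" d f] f d by (simp add: sharp_at_\<epsilon> PF_at_\<delta>)
  have p: "poly_map (poly_comp E ?m \<delta>)" using m by simp
  have "f = sh (poly_comp E (unitor_r E c) (poly_comp E ?m \<delta>)) ?x f"
    unfolding comonoid_eqs(2) using f by simp
  also have "\<dots> = sh (poly_comp E ?m \<delta>) ?x (sh (unitor_r E c) (pos (poly_comp E ?m \<delta>) \<cdot> ?x) f)"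
    by (rule sharp_at_poly_comp) (use f m h PFu p in simp_all)
  also have "\<dots> = sh (poly_comp E ?m \<delta>) ?x d"
    using f h 1 by simp
  also have "\<dots> = sh \<delta> ?x (sh ?m (\<delta>1 \<cdot> ?x) d)"
    by (rule sharp_at_poly_comp) (use f m h d in simp_all)
  finally show ?thesis using f by (simp add: e \<delta>_at_def)
qed

text \<open>Coassociativity on positions gives the target law, on directions associativity. They are
  proved together because the target law is what makes the composite of \<open>f\<close> and
  \<open>g\<close> composable with \<open>h\<close>.\<close>

lemma coassoc:
  assumes f: "arr f" "tgt f = src c" and g: "arr g" "tgt g = src c" "src g = src f"
    and fg: "t \<cdot> f = c \<cdot> g"
  shows t_\<delta>_at [simp]: "t \<cdot> \<delta>_at f g = t \<cdot> g"
    and \<delta>_at_assoc: "\<And>h. \<lbrakk>arr h; tgt h = src c; src h = src f; t \<cdot> g = c \<cdot> h\<rbrakk> \<Longrightarrow>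
      \<delta>_at (\<delta>_at f g) h = \<delta>_at f (\<delta>_at g h)"
proof -
  let ?x = "c \<cdot> f"
  let ?m = "tri_map E \<delta> (poly_id E c)" and ?n = "tri_map E (poly_id E c) \<delta>"
  let ?P = "PF E c C"
  let ?a = "associator E c c c"
  have P: "obj ?P" by simp
  have m: "poly_map ?m" "pdom ?m = cc" "pcod ?m = tri E cc c"
    "arr (pos ?m)" "src (pos ?m) = ?P" "tgt (pos ?m) = PF E cc C"
    using tri_map_\<delta>_id by simp_all
  have n: "poly_map ?n" "pdom ?n = cc" "pcod ?n = tri E c cc"
    "arr (pos ?n)" "src (pos ?n) = ?P" "tgt (pos ?n) = PF E c ?P"
    using tri_map_id_\<delta> by simp_all
  have a: "poly_map ?a" "pdom ?a = tri E cc c" "pcod ?a = tri E c cc" "pos ?a = PF_tri E c c C"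
    using associator_poly_map[of c c c] associator_simps[of c c c] by simp_all
  \<comment> \<open>The images of \<open>c \<cdot> f\<close> under the position maps of the two
    composites in the coassociativity equation; the fact \<open>vu\<close> matches them through the
    associator.\<close>
  let ?v = "pos ?m \<cdot> \<delta>1 \<cdot> ?x" and ?u = "pos ?n \<cdot> \<delta>1 \<cdot> ?x"
  have v: "arr ?v" "src ?v = src f" "tgt ?v = PF E cc C" using m f by simp_all
  have u: "arr ?u" "src ?u = src f" "tgt ?u = PF E c ?P" using n f by simp_all
  have vu: "PF_tri E c c C \<cdot> ?v = ?u"
  proof -
    have 1: "PF_tri E c c C \<cdot> pos ?m \<cdot> \<delta>1 = pos ?n \<cdot> \<delta>1"
      using arg_cong[OF comonoid_eqs(3), of pos] a by simp
    show ?thesis using f m n Comp_cong1[OF 1, of ?x] by simp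
  qed
  have PFu: "PF_map E c ?P \<cdot> ?u = ?x"
    using tri_map_id_\<delta>(6)[of "\<delta>1 \<cdot> ?x"] f by simp
  have PFv: "PF_map E cc C \<cdot> ?v = \<delta>1 \<cdot> ?x"
    using tri_map_\<delta>_id(6)[of "\<delta>1 \<cdot> ?x"] f by simp
  have at_u: "PF_at E c ?P ?u f = \<delta>1 \<cdot> t \<cdot> f"
    using tri_map_id_\<delta>(7)[of "\<delta>1 \<cdot> ?x" f] f by (simp add: PF_at_\<delta>)
  define d where "d = tri_dir E c c (\<delta>1 \<cdot> ?x) f g"
  have d: "arr d" "src d = src f" "tgt d = src cc" "cc \<cdot> d = \<delta>1 \<cdot> ?x"
    unfolding d_def using f g fg by (simp_all add: PF_at_\<delta>)
  have \<delta>d: "sh \<delta> ?x d = \<delta>_at f g" by (simp add: d_def \<delta>_at_def)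
  have at_v: "PF_at E cc C ?v d = t \<cdot> \<delta>_at f g"
    using tri_map_\<delta>_id(7)[of "\<delta>1 \<cdot> ?x" d] f g fg d \<delta>d by (simp add: PF_at_\<delta>)
  \<comment> \<open>One nested value computed twice: at \<open>f\<close> and then \<open>g\<close>
    it is the target of \<open>g\<close>, while at the pair \<open>(f, g)\<close> it is the target
    of the composite.\<close>
  have "PF_at E c C (PF_at E c ?P ?u f) g = PF_at E cc C ?v d"
    using PF_at_PF_at_PF_tri[of c c C ?v f g] f g fg v PFv vu by (simp add: d_def PF_at_\<delta>)
  then show tk: "t \<cdot> \<delta>_at f g = t \<cdot> g"
    using at_u at_v fg g by (simp add: PF_at_\<delta>)
  show "\<delta>_at (\<delta>_at f g) h = \<delta>_at f (\<delta>_at g h)"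
    if h: "arr h" "tgt h = src c" "src h = src f" and gh: "t \<cdot> g = c \<cdot> h" for h
  proof -
    \<comment> \<open>The test direction is \<open>b\<close>, standing for
      \<open>(f, (g, h))\<close> with inner pair \<open>e\<close>; its rebracketing
      \<open>((f, g), h)\<close> is \<open>d'\<close>. The two sides of coassociativity send
      \<open>b\<close> to the two bracketings of the triple composite.\<close>
    define e where "e = tri_dir E c c (\<delta>1 \<cdot> t \<cdot> f) g h"
    have e: "arr e" "src e = src f" "tgt e = src cc" "cc \<cdot> e = \<delta>1 \<cdot> t \<cdot> f"
      "tri_fst E c c \<cdot> e = g" "tri_snd E c c \<cdot> e = h"
      unfolding e_def using f g fg h gh by (simp_all add: PF_at_\<delta>)
    define b where "b = tri_dir E c cc ?u f e"
    have b: "arr b" "src b = src f" "tgt b = src (tri E c cc)" "tri E c cc \<cdot> b = ?u"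
      "tri_fst E c cc \<cdot> b = f" "tri_snd E c cc \<cdot> b = e"
      unfolding b_def using u f e PFu at_u by simp_all
    define d' where "d' = tri_dir E cc c ?v d h"
    have d': "arr d'" "src d' = src f" "tgt d' = src (tri E cc c)" "tri E cc c \<cdot> d' = ?v"
      "tri_fst E cc c \<cdot> d' = d" "tri_snd E cc c \<cdot> d' = h"
      unfolding d'_def using v d h PFv at_v tk gh by simp_all
    have 1: "sh ?a ?v b = d'"
    proof -
      have "sh ?a ?v b = tri_dir E cc c ?v (tri_dir E c c (PF_map E cc C \<cdot> ?v) f g) h"
        by (rule sharp_at_associator[where e = e]) (use b e v vu in simp_all)
      then show ?thesis by (simp only: PFv d_def d'_def)
    qed
    have 2: "sh ?m (\<delta>1 \<cdot> ?x) d' = tri_dir E c c (\<delta>1 \<cdot> ?x) (\<delta>_at f g) h"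
      using tri_map_\<delta>_id(9)[of "\<delta>1 \<cdot> ?x" d' "\<delta>_at f g"] f g h fg gh d' tk \<delta>d by (simp add: PF_at_\<delta>)
    have 3: "sh ?n (\<delta>1 \<cdot> ?x) b = tri_dir E c c (\<delta>1 \<cdot> ?x) f (\<delta>_at g h)"
      using tri_map_id_\<delta>(9)[of "\<delta>1 \<cdot> ?x" b f] f b e fg by (simp add: PF_at_\<delta> \<delta>_at_def e_def)
    have "sh (poly_comp E ?a (poly_comp E ?m \<delta>)) ?x b =
        sh (poly_comp E ?m \<delta>) ?x (sh ?a (pos (poly_comp E ?m \<delta>) \<cdot> ?x) b)"
      by (rule sharp_at_poly_comp) (use f m a b vu in simp_all)
    also have "\<dots> = sh (poly_comp E ?m \<delta>) ?x d'"
      using f m 1 by simp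
    also have "\<dots> = sh \<delta> ?x (sh ?m (\<delta>1 \<cdot> ?x) d')"
      by (rule sharp_at_poly_comp) (use f m d' in simp_all)
    finally have L: "sh (poly_comp E ?a (poly_comp E ?m \<delta>)) ?x b = \<delta>_at (\<delta>_at f g) h"
      using f g fg by (simp add: 2 \<delta>_at_def[of "\<delta>_at f g"])
    have "sh (poly_comp E ?n \<delta>) ?x b = sh \<delta> ?x (sh ?n (\<delta>1 \<cdot> ?x) b)"
      by (rule sharp_at_poly_comp) (use f n b in simp_all)
    then have "sh (poly_comp E ?n \<delta>) ?x b = \<delta>_at f (\<delta>_at g h)"
      by (simp add: 3 \<delta>_at_def[of f])
    then show ?thesis using L comonoid_eqs(3) by simp
  qed
qed

lemma internal_cat_CC [simp]: "is_internal_cat E CC"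
proof (rule internal_catI)
  show "CC = \<lparr>isrc = c, itgt = t, iid = i, icomp = icomp CC\<rparr>"
    by (rule internal_cat.equality) simp_all
  show "t \<cdot> i = Id E C" using t_i[of "Id E C"] by simp
qed (use icomp_CC_simps in \<open>simp_all add: k_eq \<delta>_at_unit_l \<delta>_at_unit_r \<delta>_at_assoc\<close>)

section \<open>Coalgebras on generalized elements\<close>

text \<open>Both sides of both coalgebra equations evaluated at elements, shared by
  \<open>coalgebraI\<close> and \<open>coalgebraD\<close>. Elements of \<open>PF c (PF c S)\<close>
  are examined in layers: the position, the positions of the values, and the values of the
  values.\<close>

lemma coalgebra_computations:
  assumes S: "obj S" and \<kappa>: "arr \<kappa>" "src \<kappa> = S" "tgt \<kappa> = PF E c S"
    and x: "PF_map E c S \<cdot> \<kappa> = x"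
    and a: "arr a" "tgt a = S"
  shows "PF_map E c S \<cdot> \<kappa> \<cdot> a = x \<cdot> a"
    and "\<And>z. \<lbrakk>arr z; src z = src a; tgt z = one E\<rbrakk> \<Longrightarrow>
      PF_at E y S (PF_trans E \<epsilon> S \<cdot> \<kappa> \<cdot> a) z = PF_at E c S (\<kappa> \<cdot> a) (i \<cdot> x \<cdot> a)"
    and "PF_map E c (PF E c S) \<cdot> PF_tri E c c S \<cdot> PF_trans E \<delta> S \<cdot> \<kappa> \<cdot> a = x \<cdot> a"
    and "PF_map E c (PF E c S) \<cdot> PF_arr E c \<kappa> \<cdot> \<kappa> \<cdot> a = x \<cdot> a"
    and "\<And>f. \<lbrakk>arr f; tgt f = src c; src f = src a; x \<cdot> a = c \<cdot> f\<rbrakk> \<Longrightarrow>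
      PF_map E c S \<cdot> PF_at E c (PF E c S) (PF_tri E c c S \<cdot> PF_trans E \<delta> S \<cdot> \<kappa> \<cdot> a) f = t \<cdot> f"
    and "\<And>f g. \<lbrakk>arr f; tgt f = src c; src f = src a; x \<cdot> a = c \<cdot> f;
      arr g; tgt g = src c; src g = src a; t \<cdot> f = c \<cdot> g\<rbrakk> \<Longrightarrow>
      PF_at E c S (PF_at E c (PF E c S) (PF_tri E c c S \<cdot> PF_trans E \<delta> S \<cdot> \<kappa> \<cdot> a) f) g =
      PF_at E c S (\<kappa> \<cdot> a) (k f g)"
    and "\<And>f. \<lbrakk>arr f; tgt f = src c; src f = src a; x \<cdot> a = c \<cdot> f\<rbrakk> \<Longrightarrow>
      PF_at E c (PF E c S) (PF_arr E c \<kappa> \<cdot> \<kappa> \<cdot> a) f = \<kappa> \<cdot> PF_at E c S (\<kappa> \<cdot> a) f"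
proof -
  have xs: "arr x" "src x = S" "tgt x = C" using S \<kappa> x by auto
  show xa: "PF_map E c S \<cdot> \<kappa> \<cdot> a = x \<cdot> a"
    by (rule Comp_cong1[OF x]) (use S \<kappa> a in simp_all)
  show "PF_at E y S (PF_trans E \<epsilon> S \<cdot> \<kappa> \<cdot> a) z = PF_at E c S (\<kappa> \<cdot> a) (i \<cdot> x \<cdot> a)"
    if z: "arr z" "src z = src a" "tgt z = one E" for z
  proof -
    have "pos \<epsilon> \<cdot> x \<cdot> a = y \<cdot> z"
      by (rule one_ext) (use z xs a in simp_all)
    then have "PF_at E y S (PF_trans E \<epsilon> S \<cdot> \<kappa> \<cdot> a) z =
        PF_at E c S (\<kappa> \<cdot> a) (sh \<epsilon> (PF_map E c S \<cdot> \<kappa> \<cdot> a) z)"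
      by (intro PF_at_PF_trans) (use S \<kappa> a z xa in simp_all)
    then show ?thesis using z xs a by (simp add: xa sharp_at_\<epsilon>)
  qed
  define v where "v = PF_trans E \<delta> S \<cdot> \<kappa> \<cdot> a"
  have v: "arr v" "src v = src a" "tgt v = PF E cc S"
    using S \<kappa> a by (simp_all add: v_def)
  have PFv: "PF_map E cc S \<cdot> v = \<delta>1 \<cdot> x \<cdot> a"
    unfolding v_def using S \<kappa> a xa by simp
  show "PF_map E c (PF E c S) \<cdot> PF_tri E c c S \<cdot> PF_trans E \<delta> S \<cdot> \<kappa> \<cdot> a = x \<cdot> a"
    unfolding v_def[symmetric] using PF_map_PF_tri[of c c S v] S v PFv xs a by simp
  show "PF_map E c (PF E c S) \<cdot> PF_arr E c \<kappa> \<cdot> \<kappa> \<cdot> a = x \<cdot> a"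
    using S \<kappa> a xa by simp
  show "PF_map E c S \<cdot> PF_at E c (PF E c S) (PF_tri E c c S \<cdot> PF_trans E \<delta> S \<cdot> \<kappa> \<cdot> a) f = t \<cdot> f"
    if f: "arr f" "tgt f = src c" "src f = src a" "x \<cdot> a = c \<cdot> f" for f
  proof -
    have "PF_map E c S \<cdot> PF_at E c (PF E c S) (PF_tri E c c S \<cdot> v) f = PF_at E c C (PF_map E cc S \<cdot> v) f"
      by (rule PF_map_PF_at_PF_tri) (use S v PFv xs a f in simp_all)
    also have "\<dots> = t \<cdot> f"
      unfolding PFv by (rule PF_at_\<delta>) (use f in simp_all)
    finally show ?thesis by (simp only: v_def)
  qed
  show "PF_at E c S (PF_at E c (PF E c S) (PF_tri E c c S \<cdot> PF_trans E \<delta> S \<cdot> \<kappa> \<cdot> a) f) g =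
      PF_at E c S (\<kappa> \<cdot> a) (k f g)"
    if f: "arr f" "tgt f = src c" "src f = src a" "x \<cdot> a = c \<cdot> f"
      and g: "arr g" "tgt g = src c" "src g = src a" "t \<cdot> f = c \<cdot> g" for f g
  proof -
    define d where "d = tri_dir E c c (\<delta>1 \<cdot> c \<cdot> f) f g"
    have d: "arr d" "src d = src a" "tgt d = src cc" "cc \<cdot> d = \<delta>1 \<cdot> c \<cdot> f"
      unfolding d_def using f g by (simp_all add: PF_at_\<delta>)
    have "PF_at E c S (PF_at E c (PF E c S) (PF_tri E c c S \<cdot> v) f) g =
        PF_at E cc S v (tri_dir E c c (PF_map E cc S \<cdot> v) f g)"
      by (rule PF_at_PF_at_PF_tri) (use S v PFv xs a f g in \<open>simp_all add: PF_at_\<delta>\<close>)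
    also have "\<dots> = PF_at E cc S (PF_trans E \<delta> S \<cdot> \<kappa> \<cdot> a) d"
      by (simp only: PFv f(4) d_def v_def[symmetric])
    also have "\<dots> = PF_at E c S (\<kappa> \<cdot> a) (sh \<delta> (PF_map E c S \<cdot> \<kappa> \<cdot> a) d)"
      by (rule PF_at_PF_trans) (use S \<kappa> a d xa f in simp_all)
    finally show ?thesis using f g by (simp add: v_def xa d_def k_eq \<delta>_at_def)
  qed
  show "PF_at E c (PF E c S) (PF_arr E c \<kappa> \<cdot> \<kappa> \<cdot> a) f = \<kappa> \<cdot> PF_at E c S (\<kappa> \<cdot> a) f"
    if f: "arr f" "tgt f = src c" "src f = src a" "x \<cdot> a = c \<cdot> f" for f
    by (rule PF_at_PF_arr) (use S \<kappa> a f xa in simp_all)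
qed

text \<open>The premises \<open>u\<close>, \<open>t\<close>, \<open>k\<close> are the laws of an
  action of the internal category on \<open>S\<close> over \<open>C\<close>. Extensionality is
  applied once for the counit equation and twice, nested, for the comultiplication equation.\<close>

lemma coalgebraI:
  assumes S: "obj S" and \<kappa>: "arr \<kappa>" "src \<kappa> = S" "tgt \<kappa> = PF E c S"
    and x: "PF_map E c S \<cdot> \<kappa> = x"
    and u: "\<And>a. \<lbrakk>arr a; tgt a = S\<rbrakk> \<Longrightarrow> PF_at E c S (\<kappa> \<cdot> a) (i \<cdot> x \<cdot> a) = a"
    and t: "\<And>a f. \<lbrakk>arr a; tgt a = S; arr f; tgt f = src c; src f = src a;
      x \<cdot> a = c \<cdot> f\<rbrakk> \<Longrightarrow> x \<cdot> PF_at E c S (\<kappa> \<cdot> a) f = t \<cdot> f"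
    and k: "\<And>a f g. \<lbrakk>arr a; tgt a = S; arr f; tgt f = src c; src f = src a;
      x \<cdot> a = c \<cdot> f; arr g; tgt g = src c; src g = src a; t \<cdot> f = c \<cdot> g\<rbrakk> \<Longrightarrow>
      PF_at E c S (\<kappa> \<cdot> a) (k f g) = PF_at E c S (\<kappa> \<cdot> PF_at E c S (\<kappa> \<cdot> a) f) g"
  shows "is_coalgebra E c \<epsilon> \<delta> (S, \<kappa>)"
proof -
  note comp = coalgebra_computations[OF S \<kappa> x]
  have xs: "arr x" "src x = S" "tgt x = C" using S \<kappa> x by auto
  have 1: "PF_trans E \<epsilon> S \<cdot> \<kappa> = PF_y E S"
  proof (rule PF_ext[of y S])
    show "PF_map E y S \<cdot> PF_trans E \<epsilon> S \<cdot> \<kappa> = PF_map E y S \<cdot> PF_y E S"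
      by (rule one_ext) (use S \<kappa> in simp_all)
    fix a z
    assume a: "arr a" "arr z" "src z = src a" "tgt a = src (PF_y E S)" "tgt z = src y"
    then show "PF_at E y S ((PF_trans E \<epsilon> S \<cdot> \<kappa>) \<cdot> a) z = PF_at E y S (PF_y E S \<cdot> a) z"
      using S \<kappa> comp(2)[of a z] u[of a] PF_at_PF_y[of S a z] by simp
  qed (use S \<kappa> in simp_all)
  have 2: "PF_tri E c c S \<cdot> PF_trans E \<delta> S \<cdot> \<kappa> = PF_arr E c \<kappa> \<cdot> \<kappa>"
  proof (rule PF_ext[of c "PF E c S"])
    show "PF_map E c (PF E c S) \<cdot> PF_tri E c c S \<cdot> PF_trans E \<delta> S \<cdot> \<kappa> =
        PF_map E c (PF E c S) \<cdot> PF_arr E c \<kappa> \<cdot> \<kappa>"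
      using comp(3,4)[of "Id E S"] S \<kappa> by simp
    fix a f
    assume "arr a" "arr f" "src f = src a" "tgt a = src (PF_arr E c \<kappa> \<cdot> \<kappa>)"
      "tgt f = src c" and sq: "PF_map E c (PF E c S) \<cdot> (PF_arr E c \<kappa> \<cdot> \<kappa>) \<cdot> a = c \<cdot> f"
    then have a: "arr a" "tgt a = S" and f: "arr f" "tgt f = src c" "src f = src a"
      using S \<kappa> by simp_all
    have xa: "x \<cdot> a = c \<cdot> f" using sq comp(4)[OF a] a S \<kappa> by simp
    have LHS: "(PF_tri E c c S \<cdot> PF_trans E \<delta> S \<cdot> \<kappa>) \<cdot> b = PF_tri E c c S \<cdot> PF_trans E \<delta> S \<cdot> \<kappa> \<cdot> b"
      if "arr b" "tgt b = S" for b using S \<kappa> that by simp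
    define L where "L = PF_at E c (PF E c S) (PF_tri E c c S \<cdot> PF_trans E \<delta> S \<cdot> \<kappa> \<cdot> a) f"
    define R where "R = PF_at E c S (\<kappa> \<cdot> a) f"
    have R: "arr R" "src R = src a" "tgt R = S"
      unfolding R_def using S \<kappa> a f xa comp(1)[OF a] by simp_all
    have L: "arr L" "src L = src a" "tgt L = PF E c S"
      unfolding L_def using S \<kappa> a f xa comp(3)[OF a] by simp_all
    have "L = \<kappa> \<cdot> R"
    proof (rule PF_ext[of c S])
      show "PF_map E c S \<cdot> L = PF_map E c S \<cdot> \<kappa> \<cdot> R"
        using comp(5)[OF a f xa] comp(1)[OF R(1,3)] t[OF a f xa] by (simp add: L_def R_def)
      fix b g
      assume "arr b" "arr g" "src g = src b" "tgt b = src (\<kappa> \<cdot> R)" "tgt g = src c"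
        and sq: "PF_map E c S \<cdot> L \<cdot> b = c \<cdot> g"
      then have b: "arr b" "tgt b = src a" and g: "arr g" "tgt g = src c" "src g = src b"
        using R \<kappa> by simp_all
      \<comment> \<open>The inner extensionality tests at a further stage \<open>b\<close>, so the
        outer data are restricted along \<open>b\<close> before the action laws are applied.\<close>
      have ab: "arr (a \<cdot> b)" "tgt (a \<cdot> b) = S" and fb: "arr (f \<cdot> b)" "tgt (f \<cdot> b) = src c"
          "src (f \<cdot> b) = src (a \<cdot> b)" and xab: "x \<cdot> a \<cdot> b = c \<cdot> f \<cdot> b"
        using a b f Comp_cong1[OF xa, of b] xs by simp_all
      have Lb: "L \<cdot> b = PF_at E c (PF E c S) (PF_tri E c c S \<cdot> PF_trans E \<delta> S \<cdot> \<kappa> \<cdot> a \<cdot> b) (f \<cdot> b)"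
        unfolding L_def using S \<kappa> a f b xa comp(3)[OF a] by simp
      have Rb: "R \<cdot> b = PF_at E c S (\<kappa> \<cdot> a \<cdot> b) (f \<cdot> b)"
        unfolding R_def using S \<kappa> a f b xa comp(1)[OF a] by simp
      have tfb: "t \<cdot> f \<cdot> b = c \<cdot> g"
        using sq comp(5)[OF ab fb xab] by (simp add: Lb)
      have gd: "src g = src (a \<cdot> b)" using g a b by simp
      have "PF_at E c S (L \<cdot> b) g = PF_at E c S (\<kappa> \<cdot> R \<cdot> b) g"
        unfolding Lb Rb comp(6)[OF ab fb xab g(1,2) gd tfb] k[OF ab fb xab g(1,2) gd tfb] ..
      then show "PF_at E c S (L \<cdot> b) g = PF_at E c S ((\<kappa> \<cdot> R) \<cdot> b) g"
        using \<kappa> R b by simp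
    qed (use L R S \<kappa> in simp_all)
    then show "PF_at E c (PF E c S) ((PF_tri E c c S \<cdot> PF_trans E \<delta> S \<cdot> \<kappa>) \<cdot> a) f =
        PF_at E c (PF E c S) ((PF_arr E c \<kappa> \<cdot> \<kappa>) \<cdot> a) f"
      using comp(7)[OF a f xa] \<kappa> a by (simp add: LHS L_def R_def)
  qed (use S \<kappa> in simp_all)
  show ?thesis
    using 1 2 S \<kappa> by (simp add: is_coalgebra_def Hom_def)
qed

text \<open>The same evaluations read backwards: the unit law comes from the counit equation, and
  the target and composition laws come from \<open>eq\<close>, the comultiplication equation
  evaluated at one direction.\<close>

lemma coalgebraD:
  assumes "is_coalgebra E c \<epsilon> \<delta> (S, \<kappa>)"
  defines "x \<equiv> PF_map E c S \<cdot> \<kappa>"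
  shows "obj S" "arr \<kappa>" "src \<kappa> = S" "tgt \<kappa> = PF E c S"
    and "arr x" "src x = S" "tgt x = C"
    and "\<And>a. \<lbrakk>arr a; tgt a = S\<rbrakk> \<Longrightarrow> PF_map E c S \<cdot> \<kappa> \<cdot> a = x \<cdot> a"
    and "\<And>a. \<lbrakk>arr a; tgt a = S\<rbrakk> \<Longrightarrow> PF_at E c S (\<kappa> \<cdot> a) (i \<cdot> x \<cdot> a) = a"
    and "\<And>a f. \<lbrakk>arr a; tgt a = S; arr f; tgt f = src c; src f = src a;
      x \<cdot> a = c \<cdot> f\<rbrakk> \<Longrightarrow> x \<cdot> PF_at E c S (\<kappa> \<cdot> a) f = t \<cdot> f"
    and "\<And>a f g. \<lbrakk>arr a; tgt a = S; arr f; tgt f = src c; src f = src a;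
      x \<cdot> a = c \<cdot> f; arr g; tgt g = src c; src g = src a; t \<cdot> f = c \<cdot> g\<rbrakk> \<Longrightarrow>
      PF_at E c S (\<kappa> \<cdot> a) (k f g) = PF_at E c S (\<kappa> \<cdot> PF_at E c S (\<kappa> \<cdot> a) f) g"
proof -
  show S: "obj S" and \<kappa>: "arr \<kappa>" "src \<kappa> = S" "tgt \<kappa> = PF E c S"
    using assms by (auto simp: is_coalgebra_def Hom_def)
  show xs: "arr x" "src x = S" "tgt x = C" using S \<kappa> by (simp_all add: x_def)
  have x: "PF_map E c S \<cdot> \<kappa> = x" by (simp add: x_def)
  note comp = coalgebra_computations[OF S \<kappa> x]
  have 1: "PF_trans E \<epsilon> S \<cdot> \<kappa> = PF_y E S"
    and 2: "PF_tri E c c S \<cdot> PF_trans E \<delta> S \<cdot> \<kappa> = PF_arr E c \<kappa> \<cdot> \<kappa>"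
    using assms by (auto simp: is_coalgebra_def)
  show "PF_map E c S \<cdot> \<kappa> \<cdot> a = x \<cdot> a" if "arr a" "tgt a = S" for a
    using comp(1)[OF that] .
  show "PF_at E c S (\<kappa> \<cdot> a) (i \<cdot> x \<cdot> a) = a" if a: "arr a" "tgt a = S" for a
  proof -
    have "PF_trans E \<epsilon> S \<cdot> \<kappa> \<cdot> a = PF_y E S \<cdot> a"
      by (rule Comp_cong1[OF 1]) (use S \<kappa> a in simp_all)
    then show ?thesis
      using comp(2)[OF a, of "bang E (src a)"] PF_at_PF_y[of S a "bang E (src a)"] S a by simp
  qed
  have eq: "\<kappa> \<cdot> PF_at E c S (\<kappa> \<cdot> a) f =
      PF_at E c (PF E c S) (PF_tri E c c S \<cdot> PF_trans E \<delta> S \<cdot> \<kappa> \<cdot> a) f"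
    if a: "arr a" "tgt a = S" and f: "arr f" "tgt f = src c" "src f = src a" "x \<cdot> a = c \<cdot> f"
    for a f
  proof -
    have "(PF_tri E c c S \<cdot> PF_trans E \<delta> S \<cdot> \<kappa>) \<cdot> a = (PF_arr E c \<kappa> \<cdot> \<kappa>) \<cdot> a"
      using 2 by simp
    then have "PF_tri E c c S \<cdot> PF_trans E \<delta> S \<cdot> \<kappa> \<cdot> a = PF_arr E c \<kappa> \<cdot> \<kappa> \<cdot> a"
      using S \<kappa> a by simp
    then show ?thesis using comp(7)[OF a f] by simp
  qed
  show "x \<cdot> PF_at E c S (\<kappa> \<cdot> a) f = t \<cdot> f"
    if a: "arr a" "tgt a = S" and f: "arr f" "tgt f = src c" "src f = src a" "x \<cdot> a = c \<cdot> f"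
    for a f
  proof -
    have "arr (PF_at E c S (\<kappa> \<cdot> a) f)" "tgt (PF_at E c S (\<kappa> \<cdot> a) f) = S"
      using S \<kappa> a f comp(1)[OF a] by simp_all
    then have "x \<cdot> PF_at E c S (\<kappa> \<cdot> a) f = PF_map E c S \<cdot> \<kappa> \<cdot> PF_at E c S (\<kappa> \<cdot> a) f"
      using comp(1) by simp
    then show ?thesis unfolding eq[OF a f] comp(5)[OF a f] .
  qed
  show "PF_at E c S (\<kappa> \<cdot> a) (k f g) = PF_at E c S (\<kappa> \<cdot> PF_at E c S (\<kappa> \<cdot> a) f) g"
    if a: "arr a" "tgt a = S" and f: "arr f" "tgt f = src c" "src f = src a" "x \<cdot> a = c \<cdot> f"
      and g: "arr g" "tgt g = src c" "src g = src a" "t \<cdot> f = c \<cdot> g" for a f g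
    unfolding eq[OF a f] comp(6)[OF a f g] ..
qed

text \<open>Comparing positions and values on the two sides of the homomorphism equation leaves the
  maps over \<open>C\<close> that respect the action.\<close>

lemma coalgebra_hom_iff:
  assumes S: "is_coalgebra E c \<epsilon> \<delta> (S, \<kappa>)" and S': "is_coalgebra E c \<epsilon> \<delta> (S', \<kappa>')"
  defines "x \<equiv> PF_map E c S \<cdot> \<kappa>" and "x' \<equiv> PF_map E c S' \<cdot> \<kappa>'"
  shows "is_coalgebra_hom E c (S, \<kappa>) \<psi> (S', \<kappa>') \<longleftrightarrow>
    arr \<psi> \<and> src \<psi> = S \<and> tgt \<psi> = S' \<and> x' \<cdot> \<psi> = x \<and>
    (\<forall>a f. arr a \<and> tgt a = S \<and> arr f \<and> tgt f = src c \<and> src f = src a \<and>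
      x \<cdot> a = c \<cdot> f \<longrightarrow> PF_at E c S' (\<kappa>' \<cdot> \<psi> \<cdot> a) f = \<psi> \<cdot> PF_at E c S (\<kappa> \<cdot> a) f)"
    (is "?hom \<longleftrightarrow> ?\<psi> \<and> ?D \<and> ?C \<and> ?x \<and> ?at")
proof -
  note D = coalgebraD[OF S, folded x_def] and D' = coalgebraD[OF S', folded x'_def]
  show ?thesis
  proof (cases "?\<psi> \<and> ?D \<and> ?C")
    case False
    then show ?thesis by (auto simp: is_coalgebra_hom_def Hom_def)
  next
    case True
    then have \<psi>: "arr \<psi>" "src \<psi> = S" "tgt \<psi> = S'" by auto
    have arr: "PF_at E c S' (PF_arr E c \<psi> \<cdot> \<kappa> \<cdot> a) f = \<psi> \<cdot> PF_at E c S (\<kappa> \<cdot> a) f"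
      if "arr a" "tgt a = S" "arr f" "tgt f = src c" "src f = src a" "x \<cdot> a = c \<cdot> f" for a f
      by (rule PF_at_PF_arr) (use D(1-4) \<psi> that D(8)[of a] in simp_all)
    have pos: "PF_map E c S' \<cdot> PF_arr E c \<psi> \<cdot> \<kappa> = x"
      using D(1-4) \<psi> by (simp add: x_def)
    have "\<kappa>' \<cdot> \<psi> = PF_arr E c \<psi> \<cdot> \<kappa>" if x: ?x and at: ?at
    proof (rule PF_ext[of c S'])
      show "PF_map E c S' \<cdot> \<kappa>' \<cdot> \<psi> = PF_map E c S' \<cdot> PF_arr E c \<psi> \<cdot> \<kappa>"
        using pos x D'(8)[of \<psi>] \<psi> by simp
      fix a f
      assume "arr a" "arr f" "src f = src a" "tgt a = src (PF_arr E c \<psi> \<cdot> \<kappa>)"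
        "tgt f = src c" and sq: "PF_map E c S' \<cdot> (\<kappa>' \<cdot> \<psi>) \<cdot> a = c \<cdot> f"
      then have a: "arr a" "tgt a = S" and f: "arr f" "tgt f = src c" "src f = src a"
        using D(1-4) \<psi> by simp_all
      have "x \<cdot> a = x' \<cdot> \<psi> \<cdot> a"
        using Comp_cong1[OF x, of a] a \<psi> D'(5-7) by simp
      then have xa: "x \<cdot> a = c \<cdot> f" using sq D'(1-4) D'(8)[of "\<psi> \<cdot> a"] a \<psi> by simp
      then show "PF_at E c S' ((\<kappa>' \<cdot> \<psi>) \<cdot> a) f = PF_at E c S' ((PF_arr E c \<psi> \<cdot> \<kappa>) \<cdot> a) f"
        using arr[OF a f] at a f D(1-4) D'(1-4) \<psi> by simp
    qed (use D(1-4) D'(1-4) \<psi> in simp_all)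
    moreover have ?x ?at if eq: "\<kappa>' \<cdot> \<psi> = PF_arr E c \<psi> \<cdot> \<kappa>"
    proof -
      show ?x using pos D'(8)[of \<psi>] \<psi> by (simp add: eq)
      show ?at
      proof (intro allI impI)
        fix a f
        assume af: "arr a \<and> tgt a = S \<and> arr f \<and> tgt f = src c \<and> src f = src a \<and> x \<cdot> a = c \<cdot> f"
        then have "\<kappa>' \<cdot> \<psi> \<cdot> a = PF_arr E c \<psi> \<cdot> \<kappa> \<cdot> a"
          using arg_cong[OF eq, of "\<lambda>g. g \<cdot> a"] D(1-4) D'(1-4) \<psi> by simp
        then show "PF_at E c S' (\<kappa>' \<cdot> \<psi> \<cdot> a) f = \<psi> \<cdot> PF_at E c S (\<kappa> \<cdot> a) f"
          using arr af by simp
      qed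
    qed
    ultimately show ?thesis
      using \<psi> by (auto simp: is_coalgebra_hom_def Hom_def)
  qed
qed

section \<open>From copresheaves to coalgebras\<close>

text \<open>Closure under composition is checked on maps over \<open>C\<close> that respect the
  action; the unit and associativity laws are those of \<open>E\<close>.\<close>

lemma category_Coalg: "category (Coalg E c \<epsilon> \<delta>)"
  unfolding Coalg_def
proof (rule category_triples)
  fix X assume X: "is_coalgebra E c \<epsilon> \<delta> X"
  obtain S \<kappa> where X_eq: "X = (S, \<kappa>)" by (cases X)
  note D = coalgebraD[OF X[unfolded X_eq]]
  show "is_coalgebra_hom E c X (Id E (fst X)) X"
    unfolding X_eq fst_conv coalgebra_hom_iff[OF X[unfolded X_eq] X[unfolded X_eq]]
    using D(1-4) by auto
next
  fix X Y Z f g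
  assume X: "is_coalgebra E c \<epsilon> \<delta> X" and Y: "is_coalgebra E c \<epsilon> \<delta> Y" and Z: "is_coalgebra E c \<epsilon> \<delta> Z"
    and f: "is_coalgebra_hom E c X f Y" and g: "is_coalgebra_hom E c Y g Z"
  obtain S \<kappa> S' \<kappa>' S'' \<kappa>'' where eqs: "X = (S, \<kappa>)" "Y = (S', \<kappa>')" "Z = (S'', \<kappa>'')"
    by (cases X, cases Y, cases Z)
  note X = X[unfolded eqs] and Y = Y[unfolded eqs] and Z = Z[unfolded eqs]
  note D = coalgebraD[OF X] coalgebraD[OF Y] coalgebraD[OF Z]
  note f = f[unfolded eqs coalgebra_hom_iff[OF X Y]] and g = g[unfolded eqs coalgebra_hom_iff[OF Y Z]]
  define x x' x'' where "x = PF_map E c S \<cdot> \<kappa>" and "x' = PF_map E c S' \<cdot> \<kappa>'" and "x'' = PF_map E c S'' \<cdot> \<kappa>''"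
  have xs: "arr x" "src x = S" "arr x'" "src x' = S'" "arr x''" "src x'' = S''"
    using D by (simp_all add: x_def x'_def x''_def)
  have fs: "arr f" "src f = S" "tgt f = S'" "x' \<cdot> f = x"
    and gs: "arr g" "src g = S'" "tgt g = S''" "x'' \<cdot> g = x'"
    using f g by (simp_all add: x_def x'_def x''_def)
  have f_at: "PF_at E c S' (\<kappa>' \<cdot> f \<cdot> a) z = f \<cdot> PF_at E c S (\<kappa> \<cdot> a) z"
    if "arr a" "tgt a = S" "arr z" "tgt z = src c" "src z = src a" "x \<cdot> a = c \<cdot> z" for a z
    using f that unfolding x_def by blast
  have g_at: "PF_at E c S'' (\<kappa>'' \<cdot> g \<cdot> a) z = g \<cdot> PF_at E c S' (\<kappa>' \<cdot> a) z"
    if "arr a" "tgt a = S'" "arr z" "tgt z = src c" "src z = src a" "x' \<cdot> a = c \<cdot> z" for a z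
    using g that unfolding x'_def by blast
  have pos: "x'' \<cdot> g \<cdot> f = x" using Comp_cong1[OF gs(4), of f] fs gs xs by simp
  have at: "PF_at E c S'' (\<kappa>'' \<cdot> (g \<cdot> f) \<cdot> a) z = (g \<cdot> f) \<cdot> PF_at E c S (\<kappa> \<cdot> a) z"
    if a: "arr a" "tgt a = S" and z: "arr z" "tgt z = src c" "src z = src a" "x \<cdot> a = c \<cdot> z"
    for a z
  proof -
    \<comment> \<open>The image \<open>f \<cdot> a\<close> lies over the same object as
      \<open>a\<close>, so the law for \<open>g\<close> applies to it with the same direction
      \<open>z\<close>.\<close>
    have 1: "x' \<cdot> f \<cdot> a = c \<cdot> z" using Comp_cong1[OF fs(4), of a] fs xs a z by simp
    have 2: "arr (PF_at E c S (\<kappa> \<cdot> a) z)" "tgt (PF_at E c S (\<kappa> \<cdot> a) z) = S"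
      using D(1-4) D(8)[OF a] a z by (simp_all add: x_def)
    have "PF_at E c S'' (\<kappa>'' \<cdot> g \<cdot> f \<cdot> a) z = g \<cdot> PF_at E c S' (\<kappa>' \<cdot> f \<cdot> a) z"
      by (rule g_at) (use 1 fs a z in simp_all)
    then show ?thesis using f_at[OF a z] fs gs a 2 by simp
  qed
  show "is_coalgebra_hom E c X (g \<cdot> f) Z"
    unfolding eqs coalgebra_hom_iff[OF X Z]
    using fs gs pos at by (simp add: x_def x''_def)
next
  show "f \<cdot> Id E (fst X) = f" if "is_coalgebra_hom E c X f Y" for X Y f
    using that by (cases X; cases Y) (simp add: is_coalgebra_hom_def Hom_def)
  show "Id E (fst Y) \<cdot> f = f" if "is_coalgebra_hom E c X f Y" for X Y f
    using that by (cases X; cases Y) (simp add: is_coalgebra_hom_def Hom_def)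
  show "(h \<cdot> g) \<cdot> f = h \<cdot> g \<cdot> f"
    if "is_coalgebra_hom E c X f Y" "is_coalgebra_hom E c Y g Z" "is_coalgebra_hom E c Z h W" for X Y Z W f g h
    using that by (cases X; cases Y; cases Z; cases W) (simp add: is_coalgebra_hom_def Hom_def)
qed

section \<open>The functor from copresheaves to coalgebras\<close>

lemma copresheafD:
  assumes "is_copresheaf E CC (D, \<phi>)"
  shows "is_cofunctor E D CC \<phi>" "cartesian E \<phi>" "is_internal_cat E D" "poly_map \<phi>"
    "pdom \<phi> = isrc D" "pcod \<phi> = c"
  using assms cofunctor_simps[of D CC \<phi>] by (auto simp: is_copresheaf_def)

lemma copresheaf_homD:
  assumes "is_copresheaf_hom E (D, \<phi>) \<psi> (D', \<phi>')"
  shows "is_cofunctor E D D' \<psi>" "poly_comp E \<phi>' \<psi> = \<phi>" "poly_map \<psi>" "pdom \<psi> = isrc D" "pcod \<psi> = isrc D'"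
  using assms cofunctor_simps[of D D' \<psi>] by (auto simp: is_copresheaf_hom_def)

lemma category_Copresheaves: "category (Copresheaves E CC)"
  unfolding Copresheaves_def
proof (rule category_triples)
  show "is_copresheaf_hom E X (poly_id E (isrc (fst X))) X" if "is_copresheaf E CC X" for X
    using that copresheafD[of "fst X" "snd X"] cofunctor_id[of "fst X"]
    by (cases X) (simp add: is_copresheaf_hom_def)
  show "is_copresheaf_hom E X (poly_comp E g f) Z"
    if "is_copresheaf E CC Z" "is_copresheaf_hom E X f Y" "is_copresheaf_hom E Y g Z" for X Y Z f g
  proof -
    obtain D \<phi> D' \<phi>' D'' \<phi>'' where eqs: "X = (D, \<phi>)" "Y = (D', \<phi>')" "Z = (D'', \<phi>'')"
      by (cases X, cases Y, cases Z)
    note f = copresheaf_homD[OF that(2)[unfolded eqs]] and g = copresheaf_homD[OF that(3)[unfolded eqs]]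
      and Z = copresheafD[OF that(1)[unfolded eqs]]
    have "poly_comp E \<phi>'' (poly_comp E g f) = poly_comp E (poly_comp E \<phi>'' g) f"
      by (rule poly_comp_assoc[symmetric]) (use f g Z in simp_all)
    then show ?thesis
      unfolding eqs using cofunctor_comp[OF f(1) g(1)] f(2) g(2) by (simp add: is_copresheaf_hom_def)
  qed
  show "poly_comp E f (poly_id E (isrc (fst X))) = f" if "is_copresheaf_hom E X f Y" for X Y f
    using that copresheaf_homD[of "fst X" "snd X" f "fst Y" "snd Y"] by simp
  show "poly_comp E (poly_id E (isrc (fst Y))) f = f" if "is_copresheaf_hom E X f Y" for X Y f
    using that copresheaf_homD[of "fst X" "snd X" f "fst Y" "snd Y"] by simp
  show "poly_comp E (poly_comp E h g) f = poly_comp E h (poly_comp E g f)"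
    if "is_copresheaf_hom E X f Y" "is_copresheaf_hom E Y g Z" "is_copresheaf_hom E Z h W" for X Y Z W f g h
    by (rule poly_comp_assoc)
      (use that copresheaf_homD[of "fst X" "snd X" f "fst Y" "snd Y"]
        copresheaf_homD[of "fst Y" "snd Y" g "fst Z" "snd Z"]
        copresheaf_homD[of "fst Z" "snd Z" h "fst W" "snd W"] in simp_all)
qed

definition coalg_map where
  "coalg_map D \<phi> = PF_elem E c (tgt (isrc D)) (pos \<phi>) (itgt D \<cdot> sharp \<phi>)"

lemma coalg_map:
  assumes \<phi>: "is_cofunctor E D CC \<phi>"
  shows "arr (coalg_map D \<phi>)" "src (coalg_map D \<phi>) = tgt (isrc D)"
    "tgt (coalg_map D \<phi>) = PF E c (tgt (isrc D))"
    "PF_map E c (tgt (isrc D)) \<cdot> coalg_map D \<phi> = pos \<phi>"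
    and "\<And>a z. \<lbrakk>arr a; tgt a = tgt (isrc D); arr z; tgt z = src c; src z = src a;
      pos \<phi> \<cdot> a = c \<cdot> z\<rbrakk> \<Longrightarrow>
      PF_at E c (tgt (isrc D)) (coalg_map D \<phi> \<cdot> a) z = itgt D \<cdot> sh \<phi> a z"
proof -
  note S = cofunctor_simps[OF \<phi>] and D = internal_cat_simps[OF cofunctor_simps(1)[OF \<phi>]]
  note P = poly_mapD[OF S(3), unfolded S(4,5) isrc_CC]
  define f where "f = itgt D \<cdot> sharp \<phi>"
  have f: "arr f" "src f = pb E (pos \<phi>) c" "tgt f = tgt (isrc D)"
    using D P by (simp_all add: f_def)
  show "arr (coalg_map D \<phi>)" "src (coalg_map D \<phi>) = tgt (isrc D)"
    "tgt (coalg_map D \<phi>) = PF E c (tgt (isrc D))"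
    "PF_map E c (tgt (isrc D)) \<cdot> coalg_map D \<phi> = pos \<phi>"
    using D P f by (simp_all add: coalg_map_def f_def[symmetric])
  show "PF_at E c (tgt (isrc D)) (coalg_map D \<phi> \<cdot> a) z = itgt D \<cdot> sh \<phi> a z"
    if "arr a" "tgt a = tgt (isrc D)" "arr z" "tgt z = src c" "src z = src a"
      "pos \<phi> \<cdot> a = c \<cdot> z" for a z
  proof -
    have "PF_at E c (tgt (isrc D)) (coalg_map D \<phi> \<cdot> a) z = f \<cdot> pb_pair E (pos \<phi>) c a z"
      unfolding coalg_map_def f_def[symmetric]
      by (rule PF_at_PF_elem) (use that D P f in simp_all)
    also have "\<dots> = itgt D \<cdot> sharp \<phi> \<cdot> pb_pair E (pos \<phi>) c a z"
      unfolding f_def using that D P by simp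
    finally show ?thesis by (simp add: sharp_at_def S)
  qed
qed

text \<open>Acting on \<open>a\<close> by \<open>z\<close> means taking the target of the lift of
  \<open>z\<close> at \<open>a\<close>. Lifts of identities are identities, the target of a lift
  lies over the target below, and the lift of a composite is the composite of lifts, which ends
  where its second factor ends.\<close>

lemma coalg_map_coalgebra:
  assumes \<phi>: "is_cofunctor E D CC \<phi>"
  shows "is_coalgebra E c \<epsilon> \<delta> (tgt (isrc D), coalg_map D \<phi>)"
proof (rule coalgebraI)
  note S = cofunctor_simps[OF \<phi>] and D = internal_cat_simps[OF cofunctor_simps(1)[OF \<phi>]]
  note P = poly_mapD[OF S(3), unfolded S(4,5) isrc_CC]
  note m = coalg_map[OF \<phi>]
  note el = cofunctor_elements[OF \<phi>, unfolded isrc_CC] and elD = internal_cat_elements[OF S(1)]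
  let ?S = "tgt (isrc D)" and ?\<kappa> = "coalg_map D \<phi>"
  show "obj ?S" using D by simp
  show "arr ?\<kappa>" "src ?\<kappa> = ?S" "tgt ?\<kappa> = PF E c ?S" "PF_map E c ?S \<cdot> ?\<kappa> = pos \<phi>"
    using m by simp_all
  show "PF_at E c ?S (?\<kappa> \<cdot> a) (i \<cdot> pos \<phi> \<cdot> a) = a" if a: "arr a" "tgt a = ?S" for a
  proof -
    have "PF_at E c ?S (?\<kappa> \<cdot> a) (i \<cdot> pos \<phi> \<cdot> a) = itgt D \<cdot> sh \<phi> a (i \<cdot> pos \<phi> \<cdot> a)"
      by (rule m(5)) (use a P in simp_all)
    then show ?thesis using el(1)[OF a] elD(2)[OF a] by simp
  qed
  fix a f
  assume a: "arr a" "tgt a = ?S" and f: "arr f" "tgt f = src c" "src f = src a"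
    "pos \<phi> \<cdot> a = c \<cdot> f"
  show 1: "pos \<phi> \<cdot> PF_at E c ?S (?\<kappa> \<cdot> a) f = t \<cdot> f"
    using el(2)[of a f] m(5)[OF a f] a f by simp
  fix g
  assume g: "arr g" "tgt g = src c" "src g = src a" "t \<cdot> f = c \<cdot> g"
  have ck: "arr (k f g)" "tgt (k f g) = src c" "src (k f g) = src a" "pos \<phi> \<cdot> a = c \<cdot> k f g"
    using f g by (simp_all add: k_eq)
  define b where "b = sh \<phi> a f"
  have b: "arr b" "src b = src a" "tgt b = src (isrc D)"
    unfolding b_def using a f S by simp_all
  have tb: "pos \<phi> \<cdot> itgt D \<cdot> b = c \<cdot> g" unfolding b_def using el(2)[of a f] a f g by simp
  define d where "d = sh \<phi> (itgt D \<cdot> b) g"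
  have d: "arr d" "src d = src a" "tgt d = src (isrc D)" "isrc D \<cdot> d = itgt D \<cdot> b"
    unfolding d_def using b g tb S D by simp_all
  have "PF_at E c ?S (?\<kappa> \<cdot> a) (k f g) = itgt D \<cdot> sh \<phi> a (k f g)"
    using m(5)[OF a ck] .
  also have "\<dots> = itgt D \<cdot> icomp_at E D b d"
    using el(3)[of a f g] a f g by (simp add: b_def d_def)
  also have "\<dots> = itgt D \<cdot> d"
    by (rule elD(4)) (use b d in simp_all)
  also have "\<dots> = PF_at E c ?S (?\<kappa> \<cdot> itgt D \<cdot> b) g"
    unfolding d_def by (rule m(5)[symmetric]) (use b g tb D in simp_all)
  also have "itgt D \<cdot> b = PF_at E c ?S (?\<kappa> \<cdot> a) f"
    using m(5)[OF a f] by (simp add: b_def)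
  finally show "PF_at E c ?S (?\<kappa> \<cdot> a) (k f g) = PF_at E c ?S (?\<kappa> \<cdot> PF_at E c ?S (?\<kappa> \<cdot> a) f) g" .
qed

text \<open>The values of \<open>coalg_map\<close> are targets of lifts, so respecting the action
  becomes a condition on targets of lifts alone.\<close>

lemma coalg_map_hom_iff:
  assumes \<phi>: "is_cofunctor E D CC \<phi>" and \<phi>': "is_cofunctor E D' CC \<phi>'"
  shows "is_coalgebra_hom E c (tgt (isrc D), coalg_map D \<phi>) h (tgt (isrc D'), coalg_map D' \<phi>') \<longleftrightarrow>
    arr h \<and> src h = tgt (isrc D) \<and> tgt h = tgt (isrc D') \<and> pos \<phi>' \<cdot> h = pos \<phi> \<and>
    (\<forall>a z. arr a \<and> tgt a = tgt (isrc D) \<and> arr z \<and> tgt z = src c \<and> src z = src a \<and>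
      pos \<phi> \<cdot> a = c \<cdot> z \<longrightarrow> itgt D' \<cdot> sh \<phi>' (h \<cdot> a) z = h \<cdot> itgt D \<cdot> sh \<phi> a z)"
proof -
  note m = coalg_map[OF \<phi>] and m' = coalg_map[OF \<phi>']
  have P': "arr (pos \<phi>')" "src (pos \<phi>') = tgt (isrc D')"
    using cofunctor_simps[OF \<phi>'] by simp_all
  have "PF_at E c (tgt (isrc D')) (coalg_map D' \<phi>' \<cdot> h \<cdot> a) z = itgt D' \<cdot> sh \<phi>' (h \<cdot> a) z"
    if "arr h" "src h = tgt (isrc D)" "tgt h = tgt (isrc D')" "pos \<phi>' \<cdot> h = pos \<phi>"
      "arr a" "tgt a = tgt (isrc D)" "arr z" "tgt z = src c" "src z = src a"
      "pos \<phi> \<cdot> a = c \<cdot> z" for a z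
  proof (rule m'(5))
    show "pos \<phi>' \<cdot> h \<cdot> a = c \<cdot> z" using Comp_cong1[OF that(4), of a] that P' by simp
  qed (use that in simp_all)
  then show ?thesis
    unfolding coalgebra_hom_iff[OF coalg_map_coalgebra[OF \<phi>] coalg_map_coalgebra[OF \<phi>']] m(4) m'(4)
    using m(5) by (smt (verit, ccfv_threshold))
qed

definition coalg_obj where
  "coalg_obj X = (tgt (isrc (fst X)), coalg_map (fst X) (snd X))"

definition coalg_functor where
  "coalg_functor = \<lparr>FO = coalg_obj, FA = (\<lambda>(X, \<psi>, Y). (coalg_obj X, pos \<psi>, coalg_obj Y))\<rparr>"

text \<open>The triangle over \<open>c\<close> factors the lift along \<open>\<phi>\<close> as the
  lift along \<open>\<psi>\<close> of a lift along \<open>\<phi>'\<close>; the target law of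
  \<open>\<psi>\<close> then carries the target across.\<close>

lemma coalg_hom_pos:
  assumes X: "is_copresheaf E CC (D, \<phi>)" and Y: "is_copresheaf E CC (D', \<phi>')"
    and \<psi>: "is_copresheaf_hom E (D, \<phi>) \<psi> (D', \<phi>')"
  shows "is_coalgebra_hom E c (coalg_obj (D, \<phi>)) (pos \<psi>) (coalg_obj (D', \<phi>'))"
proof -
  note X = copresheafD[OF X] and Y = copresheafD[OF Y] and \<psi> = copresheaf_homD[OF \<psi>]
  note P = poly_mapD[OF \<psi>(3), unfolded \<psi>(4,5)] and P' = poly_mapD[OF Y(4), unfolded Y(5,6)]
  have pos: "pos \<phi>' \<cdot> pos \<psi> = pos \<phi>" using arg_cong[OF \<psi>(2), of pos] by simp
  have "itgt D' \<cdot> sh \<phi>' (pos \<psi> \<cdot> a) z = pos \<psi> \<cdot> itgt D \<cdot> sh \<phi> a z"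
    if a: "arr a" "tgt a = tgt (isrc D)" and z: "arr z" "tgt z = src c" "src z = src a"
      "pos \<phi> \<cdot> a = c \<cdot> z" for a z
  proof -
    have 1: "pos \<phi>' \<cdot> pos \<psi> \<cdot> a = c \<cdot> z" using Comp_cong1[OF pos, of a] a z P P' by simp
    define b where "b = sh \<phi>' (pos \<psi> \<cdot> a) z"
    have b: "arr b" "src b = src a" "tgt b = src (isrc D')" "isrc D' \<cdot> b = pos \<psi> \<cdot> a"
      unfolding b_def using a z P Y 1 by simp_all
    have "sh \<phi> a z = sh (poly_comp E \<phi>' \<psi>) a z" by (simp only: \<psi>(2))
    also have "\<dots> = sh \<psi> a b"
      unfolding b_def by (rule sharp_at_poly_comp) (use a z 1 \<psi> Y in simp_all)
    finally have "sh \<phi> a z = sh \<psi> a b" .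
    moreover have "pos \<psi> \<cdot> itgt D \<cdot> sh \<psi> a b = itgt D' \<cdot> b"
      by (rule cofunctor_elements(2)[OF \<psi>(1)]) (use a b in simp_all)
    ultimately show ?thesis by (simp add: b_def)
  qed
  then show ?thesis
    unfolding coalg_obj_def fst_conv snd_conv coalg_map_hom_iff[OF X(1) Y(1)]
    using P pos by simp
qed

lemma coalg_functor: "is_functor (Copresheaves E CC) (Coalg E c \<epsilon> \<delta>) coalg_functor"
proof -
  have ob: "is_coalgebra E c \<epsilon> \<delta> (coalg_obj X)" if "is_copresheaf E CC X" for X
    using that coalg_map_coalgebra copresheafD(1)[of "fst X" "snd X"] by (simp add: coalg_obj_def)
  have hom: "is_coalgebra_hom E c (coalg_obj X) (pos \<psi>) (coalg_obj Y)"
    if "is_copresheaf E CC X" "is_copresheaf E CC Y" "is_copresheaf_hom E X \<psi> Y" for X Y \<psi>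
    using coalg_hom_pos[of "fst X" "snd X" "fst Y" "snd Y" \<psi>] that by simp
  show ?thesis
    unfolding is_functor_def
    using category_Coalg category_Copresheaves ob hom
    by (auto simp: Copresheaves_def Coalg_def coalg_functor_def Hom_def coalg_obj_def)
qed

section \<open>Full faithfulness on copresheaves\<close>

text \<open>Over a cartesian \<open>\<phi>'\<close> every direction \<open>e\<close> is \<open>\<phi>'\<^sup>\<sharp>(s e, l e)\<close> for a unique \<open>l e\<close>, so a
  morphism \<open>\<psi>\<close> from \<open>\<phi>\<close> to \<open>\<phi>'\<close> is forced to satisfy \<open>\<psi>\<^sup>\<sharp>(x, e) = \<phi>\<^sup>\<sharp>(x, l e)\<close>.\<close>

lemma coalg_functor_faithful:
  assumes X: "is_copresheaf E CC (D, \<phi>)" and Y: "is_copresheaf E CC (D', \<phi>')"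
    and \<psi>: "is_copresheaf_hom E (D, \<phi>) \<psi> (D', \<phi>')" and \<chi>: "is_copresheaf_hom E (D, \<phi>) \<chi> (D', \<phi>')"
    and pos: "pos \<psi> = pos \<chi>"
  shows "\<psi> = \<chi>"
proof -
  note X = copresheafD[OF X] and Y = copresheafD[OF Y]
  note P' = poly_mapD[OF Y(4), unfolded Y(5,6)] and D' = internal_cat_simps[OF Y(3)]
  obtain l where l: "arr l" "src l = src (isrc D')" "tgt l = src c"
    and l1: "\<And>e. \<lbrakk>arr e; tgt e = src (isrc D')\<rbrakk> \<Longrightarrow> pos \<phi>' \<cdot> isrc D' \<cdot> e = c \<cdot> l \<cdot> e"
    and l2: "\<And>e. \<lbrakk>arr e; tgt e = src (isrc D')\<rbrakk> \<Longrightarrow> sh \<phi>' (isrc D' \<cdot> e) (l \<cdot> e) = e"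
    and l3: "\<And>x z. \<lbrakk>arr x; arr z; src x = src z; tgt x = tgt (isrc D');
      tgt z = src c; pos \<phi>' \<cdot> x = c \<cdot> z\<rbrakk> \<Longrightarrow> l \<cdot> sh \<phi>' x z = z"
    by (rule cartesian_lift[OF Y(2,5,6)]) (rule that; blast)
  have sharp: "sh \<omega> x e = sh \<phi> x (l \<cdot> e)"
    if \<omega>: "is_copresheaf_hom E (D, \<phi>) \<omega> (D', \<phi>')"
      and xe: "arr x" "arr e" "src x = src e" "tgt x = tgt (isrc D)"
        "tgt e = src (isrc D')" "pos \<omega> \<cdot> x = isrc D' \<cdot> e" for \<omega> x e
  proof -
    note \<omega> = copresheaf_homD[OF \<omega>]
    have "sh \<phi> x (l \<cdot> e) = sh (poly_comp E \<phi>' \<omega>) x (l \<cdot> e)" by (simp only: \<omega>(2))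
    also have "\<dots> = sh \<omega> x (sh \<phi>' (pos \<omega> \<cdot> x) (l \<cdot> e))"
      by (rule sharp_at_poly_comp) (use \<omega> Y l l1 xe in simp_all)
    finally show ?thesis using l2 xe by simp
  qed
  note \<psi>' = copresheaf_homD[OF \<psi>] and \<chi>' = copresheaf_homD[OF \<chi>]
  show ?thesis
  proof (rule poly_map_ext)
    fix x e
    assume "arr x" "arr e" "src x = src e" "tgt x = tgt (pdom \<chi>)"
      "tgt e = src (pcod \<chi>)" "pos \<chi> \<cdot> x = pcod \<chi> \<cdot> e"
    then show "sh \<psi> x e = sh \<chi> x e"
      using sharp[OF \<psi>, of x e] sharp[OF \<chi>, of x e] \<chi>' pos by simp
  qed (use \<psi>' \<chi>' pos in simp_all)
qed

text \<open>The formula forced on the sharp map of \<open>\<psi>\<close> is taken as its definition.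
  The target law is the compatibility of \<open>h\<close> with the actions. The identity and
  composition laws hold because \<open>l\<close> is functorial: it carries identities and composites
  of \<open>D'\<close> to those of \<open>CC\<close>, since arrows lift uniquely along
  \<open>\<phi>'\<close>.\<close>

lemma coalg_functor_full:
  assumes X: "is_copresheaf E CC (D, \<phi>)" and Y: "is_copresheaf E CC (D', \<phi>')"
    and h: "is_coalgebra_hom E c (coalg_obj (D, \<phi>)) h (coalg_obj (D', \<phi>'))"
  shows "\<exists>\<psi>. is_copresheaf_hom E (D, \<phi>) \<psi> (D', \<phi>') \<and> pos \<psi> = h"
proof -
  note X = copresheafD[OF X] and Y = copresheafD[OF Y]
  note P = poly_mapD[OF X(4), unfolded X(5,6)] and D = internal_cat_simps[OF X(3)]
  note P' = poly_mapD[OF Y(4), unfolded Y(5,6)] and D' = internal_cat_simps[OF Y(3)]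
  note el = cofunctor_elements[OF X(1), unfolded isrc_CC]
    and el' = cofunctor_elements[OF Y(1), unfolded isrc_CC]
    and elD' = internal_cat_elements[OF Y(3)]
  obtain l where l: "arr l" "src l = src (isrc D')" "tgt l = src c"
    and l1: "\<And>e. \<lbrakk>arr e; tgt e = src (isrc D')\<rbrakk> \<Longrightarrow> pos \<phi>' \<cdot> isrc D' \<cdot> e = c \<cdot> l \<cdot> e"
    and l2: "\<And>e. \<lbrakk>arr e; tgt e = src (isrc D')\<rbrakk> \<Longrightarrow> sh \<phi>' (isrc D' \<cdot> e) (l \<cdot> e) = e"
    and l3: "\<And>x z. \<lbrakk>arr x; arr z; src x = src z; tgt x = tgt (isrc D');
      tgt z = src c; pos \<phi>' \<cdot> x = c \<cdot> z\<rbrakk> \<Longrightarrow> l \<cdot> sh \<phi>' x z = z"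
    by (rule cartesian_lift[OF Y(2,5,6)]) (rule that; blast)
  have hs: "arr h" "src h = tgt (isrc D)" "tgt h = tgt (isrc D')" "pos \<phi>' \<cdot> h = pos \<phi>"
    and h_at: "\<And>a z. \<lbrakk>arr a; tgt a = tgt (isrc D); arr z; tgt z = src c; src z = src a;
      pos \<phi> \<cdot> a = c \<cdot> z\<rbrakk> \<Longrightarrow> itgt D' \<cdot> sh \<phi>' (h \<cdot> a) z = h \<cdot> itgt D \<cdot> sh \<phi> a z"
    using h unfolding coalg_obj_def fst_conv snd_conv coalg_map_hom_iff[OF X(1) Y(1)] by blast+
  have ph: "pos \<phi>' \<cdot> h \<cdot> x = pos \<phi> \<cdot> x" if "arr x" "tgt x = tgt (isrc D)" for x
    using Comp_cong1[OF hs(4), of x] that hs P' by simp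
  have le: "arr (l \<cdot> e)" "src (l \<cdot> e) = src e" "tgt (l \<cdot> e) = src c"
    if "arr e" "tgt e = src (isrc D')" for e
    using that l by simp_all
  have base: "pos \<phi> \<cdot> x = c \<cdot> l \<cdot> e"
    if "arr x" "tgt x = tgt (isrc D)" "arr e" "tgt e = src (isrc D')" "h \<cdot> x = isrc D' \<cdot> e"
    for x e using ph[OF that(1,2)] l1[OF that(3,4)] that(5) by simp
  define T where "T x e = sh \<phi> x (l \<cdot> e)" for x e
  define \<psi> where "\<psi> = \<lparr>pdom = isrc D, pcod = isrc D', pos = h,
    sharp = T (pr1 E h (isrc D')) (pr2 E h (isrc D'))\<rparr>"
  have \<psi>_simps: "pdom \<psi> = isrc D" "pcod \<psi> = isrc D'" "pos \<psi> = h" by (simp_all add: \<psi>_def)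
  have T: "arr (T x e) \<and> src (T x e) = src e \<and> tgt (T x e) = src (isrc D) \<and>
      isrc D \<cdot> T x e = x \<and> (\<forall>w. arr w \<longrightarrow> tgt w = src e \<longrightarrow> T x e \<cdot> w = T (x \<cdot> w) (e \<cdot> w))"
    if "arr x" "arr e" "src x = src e" "tgt x = tgt (isrc D)" "tgt e = src (isrc D')"
      "h \<cdot> x = isrc D' \<cdot> e" for x e
    using that base[of x e] X l by (simp add: T_def)
  have \<psi>: "poly_map \<psi>"
    by (rule poly_map_generic(1)[OF \<psi>_def _ _ _ _ _ T]) (use D D' hs in simp_all)
  have sharp: "sh \<psi> x e = sh \<phi> x (l \<cdot> e)"
    if "arr x" "arr e" "src x = src e" "tgt x = tgt (isrc D)" "tgt e = src (isrc D')"
      "h \<cdot> x = isrc D' \<cdot> e" for x e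
    unfolding T_def[symmetric]
    by (rule poly_map_generic(2)[OF \<psi>_def _ _ _ _ _ T]) (use that D D' hs in simp_all)
  have t: "h \<cdot> itgt D \<cdot> sh \<phi> x (l \<cdot> e) = itgt D' \<cdot> e"
    if "arr x" "arr e" "src x = src e" "tgt x = tgt (isrc D)" "tgt e = src (isrc D')"
      "h \<cdot> x = isrc D' \<cdot> e" for x e
    using h_at[of x "l \<cdot> e"] that base[of x e] le[of e] l2[of e] by simp
  have "is_cofunctor E D D' \<psi>"
  proof (rule cofunctorI)
    show "is_internal_cat E D" "is_internal_cat E D'" "poly_map \<psi>" "pdom \<psi> = isrc D" "pcod \<psi> = isrc D'"
      using X Y \<psi> \<psi>_simps by simp_all
    show "sh \<psi> x (iid D' \<cdot> pos \<psi> \<cdot> x) = iid D \<cdot> x" if x: "arr x" "tgt x = tgt (isrc D)" for x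
    proof -
      \<comment> \<open>The identity of \<open>D'\<close> at \<open>h \<cdot> x\<close> is the lift
        of the identity below it, so \<open>l\<close> sends it back to that identity.\<close>
      have "sh \<phi>' (h \<cdot> x) (i \<cdot> pos \<phi> \<cdot> x) = iid D' \<cdot> h \<cdot> x"
        using el'(1)[of "h \<cdot> x"] ph[OF x] x hs by simp
      moreover have "l \<cdot> sh \<phi>' (h \<cdot> x) (i \<cdot> pos \<phi> \<cdot> x) = i \<cdot> pos \<phi> \<cdot> x"
        by (rule l3) (use x hs ph[OF x] P in simp_all)
      ultimately have "l \<cdot> iid D' \<cdot> h \<cdot> x = i \<cdot> pos \<phi> \<cdot> x" by simp
      then show ?thesis
        using sharp[of x "iid D' \<cdot> h \<cdot> x"] el(1)[OF x] elD'(1)[of "h \<cdot> x"] x hs D' by (simp add: \<psi>_simps)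
    qed
    fix x e
    assume "arr x" "arr e" "src x = src e" "tgt x = tgt (isrc D)"
      "tgt e = src (isrc D')" "pos \<psi> \<cdot> x = isrc D' \<cdot> e"
    then have xe: "arr x" "arr e" "src x = src e" "tgt x = tgt (isrc D)"
      "tgt e = src (isrc D')" "h \<cdot> x = isrc D' \<cdot> e" by (simp_all add: \<psi>_simps)
    show "pos \<psi> \<cdot> itgt D \<cdot> sh \<psi> x e = itgt D' \<cdot> e"
      using t[OF xe] sharp[OF xe] by (simp add: \<psi>_simps)
    fix e'
    assume e': "arr e'" "src e = src e'" "tgt e' = src (isrc D')" "itgt D' \<cdot> e = isrc D' \<cdot> e'"
    have b: "pos \<phi> \<cdot> x = c \<cdot> l \<cdot> e" using base xe by simp
    define b where "b = sh \<phi> x (l \<cdot> e)"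
    have bs: "arr b" "src b = src e" "tgt b = src (isrc D)"
      unfolding b_def using X xe b le[of e] by simp_all
    \<comment> \<open>Since \<open>e\<close> is the lift of \<open>l \<cdot> e\<close>, its target
      lies over the target of \<open>l \<cdot> e\<close>; hence \<open>l \<cdot> e\<close> and
      \<open>l \<cdot> e'\<close> are composable.\<close>
    have le_t: "t \<cdot> l \<cdot> e = c \<cdot> l \<cdot> e'"
    proof -
      have "pos \<phi>' \<cdot> itgt D' \<cdot> sh \<phi>' (isrc D' \<cdot> e) (l \<cdot> e) = t \<cdot> l \<cdot> e"
        by (rule el'(2)) (use xe l1[of e] le[of e] D' in simp_all)
      then show ?thesis using l2[of e] l1[of e'] xe e' by simp
    qed
    \<comment> \<open>The composite of \<open>e\<close> and \<open>e'\<close> is the lift of the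
      composite of their images, and \<open>l\<close> undoes the lift.\<close>
    have kk: "l \<cdot> icomp_at E D' e e' = k (l \<cdot> e) (l \<cdot> e')"
    proof -
      have "sh \<phi>' (isrc D' \<cdot> e) (k (l \<cdot> e) (l \<cdot> e')) =
          icomp_at E D' (sh \<phi>' (isrc D' \<cdot> e) (l \<cdot> e))
            (sh \<phi>' (itgt D' \<cdot> sh \<phi>' (isrc D' \<cdot> e) (l \<cdot> e)) (l \<cdot> e'))"
        by (rule el'(3)) (use xe e' le[of e] le[of e'] l1[of e] le_t D' in simp_all)
      also have "\<dots> = icomp_at E D' e e'"
        using l2[of e] l2[of e'] xe e' by simp
      finally have "l \<cdot> icomp_at E D' e e' = l \<cdot> sh \<phi>' (isrc D' \<cdot> e) (k (l \<cdot> e) (l \<cdot> e'))" by simp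
      also have "\<dots> = k (l \<cdot> e) (l \<cdot> e')"
        by (rule l3) (use xe e' le[of e] le[of e'] l1[of e] le_t D' in \<open>simp_all add: k_eq\<close>)
      finally show ?thesis .
    qed
    have hb: "h \<cdot> itgt D \<cdot> b = isrc D' \<cdot> e'" using t[OF xe] e' by (simp add: b_def)
    have "sh \<psi> x (icomp_at E D' e e') = sh \<phi> x (l \<cdot> icomp_at E D' e e')"
      by (rule sharp) (use xe e' D' elD'(3)[of e e'] in simp_all)
    also have "\<dots> = sh \<phi> x (k (l \<cdot> e) (l \<cdot> e'))" by (simp only: kk)
    also have "\<dots> = icomp_at E D b (sh \<phi> (itgt D \<cdot> b) (l \<cdot> e'))"
      unfolding b_def by (rule el(3)) (use xe e' le[of e] le[of e'] b le_t in simp_all)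
    also have "sh \<phi> (itgt D \<cdot> b) (l \<cdot> e') = sh \<psi> (itgt D \<cdot> b) e'"
      by (rule sharp[symmetric]) (use hb bs e' D in simp_all)
    finally show "sh \<psi> x (icomp_at E D' e e') =
        icomp_at E D (sh \<psi> x e) (sh \<psi> (itgt D \<cdot> sh \<psi> x e) e')"
      by (simp only: sharp[OF xe] b_def)
  qed
  \<comment> \<open>Lifting \<open>z\<close> along \<open>\<phi>'\<close> and applying
    \<open>l\<close> returns \<open>z\<close>, so the composite lifts exactly as
    \<open>\<phi>\<close> does.\<close>
  moreover have "poly_comp E \<phi>' \<psi> = \<phi>"
  proof (rule poly_map_ext)
    show "poly_map (poly_comp E \<phi>' \<psi>)" "poly_map \<phi>" "pdom (poly_comp E \<phi>' \<psi>) = pdom \<phi>"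
      "pcod (poly_comp E \<phi>' \<psi>) = pcod \<phi>" "pos (poly_comp E \<phi>' \<psi>) = pos \<phi>"
      using X Y \<psi> \<psi>_simps hs by simp_all
    fix x z
    assume "arr x" "arr z" "src x = src z" "tgt x = tgt (pdom \<phi>)"
      "tgt z = src (pcod \<phi>)" "pos \<phi> \<cdot> x = pcod \<phi> \<cdot> z"
    then have xz: "arr x" "arr z" "src x = src z" "tgt x = tgt (isrc D)"
      "tgt z = src c" "pos \<phi> \<cdot> x = c \<cdot> z" using X by simp_all
    have pz: "pos \<phi>' \<cdot> h \<cdot> x = c \<cdot> z" using ph xz by simp
    define e where "e = sh \<phi>' (h \<cdot> x) z"
    have e: "arr e" "src e = src z" "tgt e = src (isrc D')" "isrc D' \<cdot> e = h \<cdot> x"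
      unfolding e_def using xz pz hs Y by simp_all
    have "sh (poly_comp E \<phi>' \<psi>) x z = sh \<psi> x (sh \<phi>' (pos \<psi> \<cdot> x) z)"
      by (rule sharp_at_poly_comp) (use xz pz \<psi> \<psi>_simps Y in simp_all)
    also have "\<dots> = sh \<psi> x e" by (simp only: \<psi>_simps e_def)
    also have "\<dots> = sh \<phi> x (l \<cdot> e)"
      by (rule sharp) (use xz e in simp_all)
    also have "l \<cdot> e = z" unfolding e_def by (rule l3) (use xz pz hs in simp_all)
    finally show "sh (poly_comp E \<phi>' \<psi>) x z = sh \<phi> x z" .
  qed
  ultimately show ?thesis using \<psi>_simps by (auto simp: is_copresheaf_hom_def)
qed

text \<open>The copresheaf of a coalgebra \<open>(S, \<kappa>)\<close> is its category of elements: the arrows out of \<open>a\<close>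
  are the directions \<open>z\<close> over \<open>x a\<close>, and such an arrow ends at the value of \<open>\<kappa> a\<close> at \<open>z\<close>.\<close>

lemma coalg_functor_surjective:
  assumes S: "is_coalgebra E c \<epsilon> \<delta> (S, \<kappa>)"
  shows "\<exists>D \<phi>. is_copresheaf E CC (D, \<phi>) \<and> coalg_obj (D, \<phi>) = (S, \<kappa>)"
proof -
  define x where "x = PF_map E c S \<cdot> \<kappa>"
  note co = coalgebraD[OF S, folded x_def]
  \<comment> \<open>The object of arrows is the very pullback that \<open>is_poly_map\<close>
    prescribes as the source of the sharp map, so that map can be an identity below and
    cartesianness is immediate.\<close>
  define s q where "s = pr1 E x c" and "q = pr2 E x c"
  have sq: "arr s" "src s = pb E x c" "tgt s = S" "arr q" "src q = pb E x c" "tgt q = src c"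
    using co(5-7) by (simp_all add: s_def q_def)
  have x_s: "x \<cdot> s = c \<cdot> q" unfolding s_def q_def by (rule pb_square) (use co(5-7) in simp_all)
  have xs: "x \<cdot> s \<cdot> e = c \<cdot> q \<cdot> e" if "arr e" "tgt e = pb E x c" for e
    using Comp_cong1[OF x_s, of e] that sq co(5-7) by simp
  let ?pair = "pb_pair E x c"
  have pair: "arr (?pair a z)" "src (?pair a z) = src a" "tgt (?pair a z) = pb E x c"
    "s \<cdot> ?pair a z = a" "q \<cdot> ?pair a z = z"
    "\<And>w. arr w \<Longrightarrow> tgt w = src a \<Longrightarrow> ?pair a z \<cdot> w = ?pair (a \<cdot> w) (z \<cdot> w)"
    if "arr a" "arr z" "src a = src z" "tgt a = S" "tgt z = src c" "x \<cdot> a = c \<cdot> z" for a z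
    using that co(5-7) by (simp_all add: s_def q_def)
  have pair_eta: "?pair (s \<cdot> e) (q \<cdot> e) = e" if "arr e" "tgt e = pb E x c" for e
    unfolding s_def q_def by (rule pb_pair_eta) (use that co(5-7) in simp_all)
  define tD where "tD = PF_at E c S (\<kappa> \<cdot> s) q"
  have tD: "arr tD" "src tD = pb E x c" "tgt tD = S"
    unfolding tD_def using sq x_s co(1-4) co(8)[of s] by simp_all
  have tD_Comp: "tD \<cdot> e = PF_at E c S (\<kappa> \<cdot> s \<cdot> e) (q \<cdot> e)" if "arr e" "tgt e = pb E x c" for e
    unfolding tD_def using sq x_s co(1-4) co(8)[of s] that by simp
  have x_tD: "x \<cdot> tD \<cdot> e = t \<cdot> q \<cdot> e" if e: "arr e" "tgt e = pb E x c" for e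
    unfolding tD_Comp[OF e] by (rule co(10)) (use e sq xs in simp_all)
  define iD where "iD = ?pair (Id E S) (i \<cdot> x)"
  have iD: "arr iD" "src iD = S" "tgt iD = pb E x c" "s \<cdot> iD = Id E S" "q \<cdot> iD = i \<cdot> x"
    unfolding iD_def by (use pair[of "Id E S" "i \<cdot> x"] co(1,5-7) in simp_all)
  have iD_Comp: "iD \<cdot> a = ?pair a (i \<cdot> x \<cdot> a)" if "arr a" "tgt a = S" for a
    unfolding iD_def using pair(6)[of "Id E S" "i \<cdot> x" a] co(1,5-7) that by simp
  \<comment> \<open>A composite keeps the source of its first factor and composes the directions in
    \<open>CC\<close>. It is written on elements first, so that stability under change of stage is
    available when \<open>kD\<close> specializes it to the generic pair.\<close>
  define K where "K f g = ?pair (s \<cdot> f) (k (q \<cdot> f) (q \<cdot> g))" for f g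
  \<comment> \<open>Composable arrows have composable directions because acting by a direction lands
    over its target.\<close>
  have q_comp: "t \<cdot> q \<cdot> f = c \<cdot> q \<cdot> g"
    if "arr f" "arr g" "tgt f = pb E x c" "tgt g = pb E x c" "tD \<cdot> f = s \<cdot> g" for f g
    using x_tD[of f] xs[of g] that by simp
  have K: "arr (K f g)" "src (K f g) = src g" "tgt (K f g) = pb E x c"
    "s \<cdot> K f g = s \<cdot> f" "q \<cdot> K f g = k (q \<cdot> f) (q \<cdot> g)"
    "\<And>w. arr w \<Longrightarrow> tgt w = src g \<Longrightarrow> K f g \<cdot> w = K (f \<cdot> w) (g \<cdot> w)"
    if fg: "arr f" "arr g" "src f = src g" "tgt f = pb E x c" "tgt g = pb E x c"
      "tD \<cdot> f = s \<cdot> g" for f g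
  proof -
    note q_fg = q_comp[OF fg(1,2,4-6)]
    have kk: "arr (k (q \<cdot> f) (q \<cdot> g))" "src (k (q \<cdot> f) (q \<cdot> g)) = src g"
      "tgt (k (q \<cdot> f) (q \<cdot> g)) = src c" "c \<cdot> k (q \<cdot> f) (q \<cdot> g) = c \<cdot> q \<cdot> f"
      using q_fg fg sq by (simp_all add: k_eq)
    have sf: "arr (s \<cdot> f)" "src (s \<cdot> f) = src (k (q \<cdot> f) (q \<cdot> g))" "tgt (s \<cdot> f) = S"
      "x \<cdot> s \<cdot> f = c \<cdot> k (q \<cdot> f) (q \<cdot> g)"
      using fg sq kk xs[of f] by simp_all
    note p = pair[OF sf(1) kk(1) sf(2,3) kk(3) sf(4)]
    show "arr (K f g)" "src (K f g) = src g" "tgt (K f g) = pb E x c"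
      "s \<cdot> K f g = s \<cdot> f" "q \<cdot> K f g = k (q \<cdot> f) (q \<cdot> g)"
      unfolding K_def using p sf kk by simp_all
    show "K f g \<cdot> w = K (f \<cdot> w) (g \<cdot> w)" if w: "arr w" "tgt w = src g" for w
    proof -
      have "k (q \<cdot> f) (q \<cdot> g) \<cdot> w = k (q \<cdot> f \<cdot> w) (q \<cdot> g \<cdot> w)"
        using q_fg fg sq w icomp_CC_simps by simp
      then show ?thesis
        unfolding K_def using fg sq kk w p(6)[of w] by simp
    qed
  qed
  define kD where "kD = K (pr1 E tD s) (pr2 E tD s)"
  define D where "D = \<lparr>isrc = s, itgt = tD, iid = iD, icomp = kD\<rparr>"
  have pr: "tD \<cdot> pr1 E tD s = s \<cdot> pr2 E tD s"
    by (rule pb_square) (use sq tD in simp_all)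
  have kD: "arr kD" "src kD = pb E tD s" "tgt kD = src s"
    unfolding kD_def using K(1-3)[of "pr1 E tD s" "pr2 E tD s"] pr sq tD by simp_all
  have icomp_D: "icomp_at E D f g = K f g"
    if "arr f" "arr g" "src f = src g" "tgt f = pb E x c" "tgt g = pb E x c"
      "tD \<cdot> f = s \<cdot> g" for f g
    unfolding icomp_at_def using that K(6)[of "pr1 E tD s" "pr2 E tD s" "pb_pair E tD s f g"] pr sq tD
    by (simp add: D_def kD_def)
  \<comment> \<open>The target law is the composition law of the action: acting by a composite is
    acting by \<open>q \<cdot> f\<close>, which leads to \<open>s \<cdot> g\<close>, and then by
    \<open>q \<cdot> g\<close>.\<close>
  have tD_K: "tD \<cdot> K f g = tD \<cdot> g"
    if fg: "arr f" "arr g" "src f = src g" "tgt f = pb E x c" "tgt g = pb E x c"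
      "tD \<cdot> f = s \<cdot> g" for f g
  proof -
    have "tD \<cdot> K f g = PF_at E c S (\<kappa> \<cdot> s \<cdot> f) (k (q \<cdot> f) (q \<cdot> g))"
      using tD_Comp[of "K f g"] K[OF fg] by simp
    also have "\<dots> = PF_at E c S (\<kappa> \<cdot> PF_at E c S (\<kappa> \<cdot> s \<cdot> f) (q \<cdot> f)) (q \<cdot> g)"
      by (rule co(11)) (use fg sq xs[of f] q_comp[of f g] in simp_all)
    also have "PF_at E c S (\<kappa> \<cdot> s \<cdot> f) (q \<cdot> f) = s \<cdot> g"
      using tD_Comp[of f] fg by simp
    also have "PF_at E c S (\<kappa> \<cdot> s \<cdot> g) (q \<cdot> g) = tD \<cdot> g"
      using tD_Comp[of g] fg by simp
    finally show ?thesis .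
  qed
  note C = internal_cat_elements[OF internal_cat_CC, unfolded isrc_CC]
  have iD_e: "s \<cdot> iD \<cdot> a = a" "q \<cdot> iD \<cdot> a = i \<cdot> x \<cdot> a" "tD \<cdot> iD \<cdot> a = a" if a: "arr a" "tgt a = S" for a
  proof -
    show 1: "s \<cdot> iD \<cdot> a = a" "q \<cdot> iD \<cdot> a = i \<cdot> x \<cdot> a"
      using pair(4,5)[of a "i \<cdot> x \<cdot> a"] iD_Comp[OF a] a co(5-7) by simp_all
    show "tD \<cdot> iD \<cdot> a = a"
      using tD_Comp[of "iD \<cdot> a"] 1 co(9)[OF a] iD a by simp
  qed
  have D_cat: "is_internal_cat E D"
  proof (rule internal_catI[OF sq(1) tD(1) _ _ iD(1) _ _ kD D_def])
    show "src tD = src s" "tgt tD = tgt s" "src iD = tgt s" "tgt iD = src s"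
      using tD iD sq by simp_all
    show "s \<cdot> iD = Id E (tgt s)" using iD sq by simp
    show "tD \<cdot> iD = Id E (tgt s)" using iD_e(3)[of "Id E S"] iD sq co(1) tD by simp
    fix f
    assume "arr f" "tgt f = src s"
    then have f: "arr f" "tgt f = pb E x c" using sq by simp_all
    have "icomp_at E D (iD \<cdot> s \<cdot> f) f = K (iD \<cdot> s \<cdot> f) f"
      by (rule icomp_D) (use f iD iD_e(3)[of "s \<cdot> f"] sq in simp_all)
    also have "\<dots> = ?pair (s \<cdot> f) (k (i \<cdot> c \<cdot> q \<cdot> f) (q \<cdot> f))"
      unfolding K_def using iD_e(1,2)[of "s \<cdot> f"] f sq xs[of f] by simp
    also have "\<dots> = f" using C(5)[of "q \<cdot> f"] pair_eta[of f] f sq by simp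
    finally show "icomp_at E D (iD \<cdot> s \<cdot> f) f = f" .
    have "icomp_at E D f (iD \<cdot> tD \<cdot> f) = K f (iD \<cdot> tD \<cdot> f)"
      by (rule icomp_D) (use f iD iD_e(1)[of "tD \<cdot> f"] tD in simp_all)
    also have "\<dots> = ?pair (s \<cdot> f) (k (q \<cdot> f) (i \<cdot> t \<cdot> q \<cdot> f))"
      unfolding K_def using iD_e(2)[of "tD \<cdot> f"] f tD x_tD[of f] by simp
    also have "\<dots> = f" using C(6)[of "q \<cdot> f"] pair_eta[of f] f sq by simp
    finally show "icomp_at E D f (iD \<cdot> tD \<cdot> f) = f" .
  next
    fix f g
    assume "arr f" "arr g" "src f = src g" "tgt f = src s" "tgt g = src s"
      "tD \<cdot> f = s \<cdot> g"
    then have fg: "arr f" "arr g" "src f = src g" "tgt f = pb E x c" "tgt g = pb E x c"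
      "tD \<cdot> f = s \<cdot> g" using sq by simp_all
    show "s \<cdot> icomp_at E D f g = s \<cdot> f" "tD \<cdot> icomp_at E D f g = tD \<cdot> g"
      unfolding icomp_D[OF fg] using K(4)[OF fg] tD_K[OF fg] by simp_all
    fix h
    assume "arr h" "src g = src h" "tgt h = src s" "tD \<cdot> g = s \<cdot> h"
    then have h: "arr h" "src g = src h" "tgt h = pb E x c" "tD \<cdot> g = s \<cdot> h"
      using sq by simp_all
    have gh: "arr g" "arr h" "src g = src h" "tgt g = pb E x c" "tgt h = pb E x c"
      "tD \<cdot> g = s \<cdot> h" using fg h by simp_all
    note K1 = K[OF fg] and K2 = K[OF gh]
    have "icomp_at E D (K f g) h = K (K f g) h"
      by (rule icomp_D) (use K1 tD_K[OF fg] h fg in simp_all)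
    moreover have "icomp_at E D f (K g h) = K f (K g h)"
      by (rule icomp_D) (use K2 h fg in simp_all)
    \<comment> \<open>Associativity is inherited from the directions in \<open>CC\<close>, since
      both bracketings have source component \<open>s \<cdot> f\<close>.\<close>
    moreover have "k (k (q \<cdot> f) (q \<cdot> g)) (q \<cdot> h) = k (q \<cdot> f) (k (q \<cdot> g) (q \<cdot> h))"
      by (rule C(7)) (use fg h sq q_comp[of f g] q_comp[of g h] in simp_all)
    then have "K (K f g) h = K f (K g h)"
      unfolding K_def[of "K f g"] K_def[of f "K g h"] using K1 K2 by simp
    ultimately show "icomp_at E D (icomp_at E D f g) h = icomp_at E D f (icomp_at E D g h)"
      unfolding icomp_D[OF fg] icomp_D[OF gh] by simp
  qed
  have D_simps: "isrc D = s" "itgt D = tD" "iid D = iD" by (simp_all add: D_def)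
  define \<phi> where "\<phi> = \<lparr>pdom = s, pcod = c, pos = x, sharp = Id E (pb E x c)\<rparr>"
  have \<phi>_simps: "pdom \<phi> = s" "pcod \<phi> = c" "pos \<phi> = x" by (simp_all add: \<phi>_def)
  have pb: "obj (pb E x c)" using co(5-7) by simp
  have \<phi>: "poly_map \<phi>"
    unfolding \<phi>_def by (rule is_poly_mapI) (use co(5-7) sq pb in \<open>simp_all add: s_def\<close>)
  have sharp: "sh \<phi> a z = ?pair a z"
    if "arr a" "arr z" "src a = src z" "tgt a = S" "tgt z = src c" "x \<cdot> a = c \<cdot> z" for a z
    using pair(1-3)[OF that] by (simp add: sharp_at_def \<phi>_def)
  have "is_cofunctor E D CC \<phi>"
  proof (rule cofunctorI)
    show "is_internal_cat E D" "is_internal_cat E CC" "poly_map \<phi>" "pdom \<phi> = isrc D" "pcod \<phi> = isrc CC"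
      using D_cat \<phi> by (simp_all add: \<phi>_simps D_simps)
    show "sh \<phi> a (i \<cdot> pos \<phi> \<cdot> a) = iid D \<cdot> a" if "arr a" "tgt a = tgt (isrc D)" for a
      using that sharp[of a "i \<cdot> x \<cdot> a"] iD_Comp[of a] sq co(5-7) by (simp add: \<phi>_simps D_simps)
    fix a z
    assume "arr a" "arr z" "src a = src z" "tgt a = tgt (isrc D)"
      "tgt z = src (isrc CC)" "pos \<phi> \<cdot> a = isrc CC \<cdot> z"
    then have az: "arr a" "arr z" "src a = src z" "tgt a = S" "tgt z = src c" "x \<cdot> a = c \<cdot> z"
      using sq by (simp_all add: \<phi>_simps D_simps)
    note p = pair[OF az]
    show "pos \<phi> \<cdot> itgt D \<cdot> sh \<phi> a z = t \<cdot> z"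
      unfolding sharp[OF az] \<phi>_simps D_simps using x_tD[of "?pair a z"] p by simp
    fix w
    assume w: "arr w" "src z = src w" "tgt w = src (isrc CC)" "t \<cdot> z = isrc CC \<cdot> w"
    let ?b = "tD \<cdot> ?pair a z"
    have bw: "arr ?b" "arr w" "src ?b = src w" "tgt ?b = S" "tgt w = src c" "x \<cdot> ?b = c \<cdot> w"
      using p tD az w x_tD[of "?pair a z"] by simp_all
    note p' = pair[OF bw]
    have "sh \<phi> a (k z w) = ?pair a (k z w)"
      by (rule sharp) (use az w in \<open>simp_all add: k_eq\<close>)
    also have "\<dots> = K (?pair a z) (?pair ?b w)"
      unfolding K_def using p p' by simp
    also have "\<dots> = icomp_at E D (?pair a z) (?pair ?b w)"
      by (rule icomp_D[symmetric]) (use p p' az w tD in simp_all)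
    finally show "sh \<phi> a (k z w) =
        icomp_at E D (sh \<phi> a z) (sh \<phi> (itgt D \<cdot> sh \<phi> a z) w)"
      unfolding sharp[OF az] D_simps sharp[OF bw] .
  qed
  moreover have "cartesian E \<phi>"
    using \<phi> pb by (auto simp: cartesian_def is_iso_def \<phi>_def Hom_def intro!: bexI[of _ "Id E (pb E x c)"])
  moreover have "coalg_obj (D, \<phi>) = (S, \<kappa>)"
  proof -
    \<comment> \<open>\<open>tD\<close> is the evaluation of \<open>\<kappa>\<close> at the generic
      pair, so the eta rule returns \<open>\<kappa>\<close> itself.\<close>
    have "coalg_map D \<phi> = PF_elem E c S x tD"
      using sq tD pb by (simp add: coalg_map_def D_def \<phi>_def)
    also have "\<dots> = \<kappa>"
      unfolding tD_def s_def q_def by (rule PF_elem_eta) (use co(1-4) in \<open>simp_all add: x_def\<close>)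
    finally show ?thesis using sq by (simp add: coalg_obj_def D_simps)
  qed
  ultimately show ?thesis by (auto simp: is_copresheaf_def)
qed

end

theorem theorem5p18:
  fixes E :: "('o, 'm) category" and c :: "'m" and \<epsilon> \<delta> :: "'m poly_map"
  assumes "category E" and "has_finite_limits E"
    and "is_comonoid E c \<epsilon> \<delta>"
  shows "equivalent_categories (Coalg E c \<epsilon> \<delta>) (Copresheaves E (comonoid_cat E c \<epsilon> \<delta>))"
proof -
  interpret comonoid E c \<epsilon> \<delta>
    using assms by (simp add: comonoid_def finitely_complete_category_def
      finitely_complete_category_axioms_def comonoid_axioms_def)
  show ?thesis
  proof (rule equivalent_categories_if_surjective[OF coalg_functor])
    show "f = g"
      if "f \<in> Hom (Copresheaves E CC) X Y" "g \<in> Hom (Copresheaves E CC) X Y"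
        "FA coalg_functor f = FA coalg_functor g" for X Y f g
      using that coalg_functor_faithful[of "fst X" "snd X" "fst Y" "snd Y"]
      by (auto simp: Hom_def Copresheaves_def coalg_functor_def)
    show "\<exists>f \<in> Hom (Copresheaves E CC) X Y. FA coalg_functor f = u"
      if X: "X \<in> Obj (Copresheaves E CC)" and Y: "Y \<in> Obj (Copresheaves E CC)"
        and u: "u \<in> Hom (Coalg E c \<epsilon> \<delta>) (FO coalg_functor X) (FO coalg_functor Y)" for X Y u
    proof -
      obtain h where u: "u = (coalg_obj X, h, coalg_obj Y)"
        and h: "is_coalgebra_hom E c (coalg_obj X) h (coalg_obj Y)"
        using u by (auto simp: Hom_def Coalg_def coalg_functor_def)
      have XY: "is_copresheaf E CC X" "is_copresheaf E CC Y"
        using X Y by (simp_all add: Copresheaves_def)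
      then obtain \<psi> where "is_copresheaf_hom E X \<psi> Y" "pos \<psi> = h"
        using coalg_functor_full[of "fst X" "snd X" "fst Y" "snd Y" h] h by auto
      then show ?thesis
        using XY u by (intro bexI[of _ "(X, \<psi>, Y)"])
          (auto simp: Hom_def Copresheaves_def coalg_functor_def)
    qed
    show "\<exists>X \<in> Obj (Copresheaves E CC). FO coalg_functor X = A" if "A \<in> Obj (Coalg E c \<epsilon> \<delta>)" for A
      using that coalg_functor_surjective[of "fst A" "snd A"]
      by (auto simp: Coalg_def Copresheaves_def coalg_functor_def)
  qed
qed

end
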